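(* Let $r,p,q,n$ be positive integers with $p,q$ dividing $r$, $pq$ dividing $rn$, $n\geq3$, and $(r,p,q,n)\neq(1,1,1,6)$; let $G=G(r,p,q,n)$ and $N=N(r,p,q,n)$. If $\nu$ is an automorphism of $G$ with $\nu(N)=N$, then $\nu=\mathrm{Ad}(g)\circ\phi\circ\alpha_{j,k,z}$ for some $g\in G(r,1,q,n)$, some integers $j,k$ and some $z\in C(r,p,q,n)$ with $z^2=1$ such that $\alpha_{j,k,z}$ is an automorphism of $G$, where $\phi$ is either the identity, or (only when $n=4$, $q$ is even, and, in case $r/p$ is odd, also $r/q$ is even and $4r/(pq)$ is odd) the unique automorphism of $G(r,p,q,4)$ fixing $N$ pointwise with $\phi(s_i)=t_{i+2}s_i$ ($r/p$ even) or $\phi(s_i)=t_{i+2}s_ic^{r/(2q)}$ ($r/p$ odd) for $i\in\{1,2,3\}$, where $t_j=(1,e_j)^{r/2}$ and indices are taken mod 4.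
   Context: Let $\zeta_r=\exp(2\pi\sqrt{-1}/r)$, $\mathbb{Z}_r=\mathbb{Z}/r\mathbb{Z}$. $G(r,n)$ is the group of $n\times n$ complex matrices with exactly one nonzero entry in each row and column, each an $r$th root of unity; elements are written $(\pi,x)$, $\pi\in S_n$, $x\in(\mathbb{Z}_r)^n$, meaning the matrix whose $i$th column has $\zeta_r^{x_i}$ in row $\pi(i)$; $e_1,\dots,e_n$ is the standard basis of $(\mathbb{Z}_r)^n$; permutations $\pi$ are identified with $(\pi,0)$; $s_i=(i,i+1)$. Put $\Delta(x)=\Delta(\pi,x)=\sum_ix_i$. For $p\mid r$, $G(r,p,n)=\{g:\Delta(g)\in p\mathbb{Z}_r\}$. Let $c=\zeta_rI_n$; when $p,q\mid r$ and $pq\mid rn$, $C_q=\langle c^{r/q}\rangle$ is central of order $q$ in $G(r,p,n)$ and $G(r,p,q,n)=G(r,p,n)/C_q$. $G(r,p,q,n)$ is a normal subgroup of $G(r,1,q,n)$, and $\mathrm{Ad}(g)$ for $g\in G(r,1,q,n)$ is the automorphism $h\mapsto ghg^{-1}$ of $G(r,p,q,n)$. $N(r,p,q,n)$ is the image of the diagonal matrices and $C(r,p,q,n)$ the set of elements equal to some $c^i$. With $d_0=\mathrm{GCD}(p,q,n)$ and $\ell(\pi)$ the number of inversions of $\pi$, $\alpha_{j,k,z}$ is the endomorphism of $G(r,p,q,n)$ induced by $(\pi,x)\mapsto z^{\ell(\pi)}c^{\frac{\Delta(x)}{d_0}k}(\pi,jx)$. *)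

theory Defs
  imports
    "Jordan_Normal_Form.Matrix"
    "HOL-Algebra.Coset"
    "HOL-Algebra.Generated_Groups"
    "HOL-Combinatorics.Permutations"
    Complex_Main
begin

text \<open>
  Rows, columns and the coordinates of vectors are indexed by \<open>0, \<dots>, n - 1\<close>, and permutations
  are functions on \<open>nat\<close> that permute \<open>{..<n}\<close>.
\<close>

definition zeta :: "nat \<Rightarrow> complex" where
  "zeta r = exp (2 * complex_of_real pi * \<i> / of_nat r)"

definition Grn :: "nat \<Rightarrow> nat \<Rightarrow> complex mat monoid" where
  "Grn r n = \<lparr>
     carrier = {A \<in> carrier_mat n n.
       (\<forall>i<n. \<exists>!j. j < n \<and> A $$ (i, j) \<noteq> 0) \<and>
       (\<forall>j<n. \<exists>!i. i < n \<and> A $$ (i, j) \<noteq> 0) \<and>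
       (\<forall>i<n. \<forall>j<n. A $$ (i, j) \<noteq> 0 \<longrightarrow> (A $$ (i, j)) ^ r = 1)},
     monoid.mult = (*),
     one = 1\<^sub>m n\<rparr>"

text \<open>
  A vector over the integers modulo \<open>r\<close> is given by an arbitrary integer lift \<open>x\<close> of its
  coordinates: \<open>elt r n \<pi> x\<close> depends only on the residues of \<open>x 0, \<dots>, x (n - 1)\<close>
  modulo \<open>r\<close>.
\<close>

definition elt :: "nat \<Rightarrow> nat \<Rightarrow> (nat \<Rightarrow> nat) \<Rightarrow> (nat \<Rightarrow> int) \<Rightarrow> complex mat" where
  "elt r n \<pi> x = mat n n (\<lambda>(a, i). if a = \<pi> i then zeta r powi x i else 0)"

definition Delta :: "nat \<Rightarrow> (nat \<Rightarrow> int) \<Rightarrow> int" where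
  "Delta n x = (\<Sum>i<n. x i)"

text \<open>
  Only used for \<open>p dvd r\<close>, where divisibility of \<open>Delta n x\<close> by \<open>p\<close> does not depend on the lift.
\<close>

definition Grpn :: "nat \<Rightarrow> nat \<Rightarrow> nat \<Rightarrow> complex mat monoid" where
  "Grpn r p n = (Grn r n)\<lparr>carrier :=
     {g \<in> carrier (Grn r n). \<exists>\<pi> x. \<pi> permutes {..<n} \<and> g = elt r n \<pi> x \<and> int p dvd Delta n x}\<rparr>"

definition cmat :: "nat \<Rightarrow> nat \<Rightarrow> complex mat" where
  "cmat r n = zeta r \<cdot>\<^sub>m 1\<^sub>m n"

definition Cq :: "nat \<Rightarrow> nat \<Rightarrow> nat \<Rightarrow> complex mat set" where
  "Cq r q n = generate (Grn r n) {cmat r n [^]\<^bsub>Grn r n\<^esub> (r div q)}"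

definition Grpqn :: "nat \<Rightarrow> nat \<Rightarrow> nat \<Rightarrow> nat \<Rightarrow> complex mat set monoid" where
  "Grpqn r p q n = Grpn r p n Mod Cq r q n"

text \<open>
  The coset of \<open>g\<close> is the same set whether it is formed in \<open>Grpn r p n\<close> or in \<open>Grn r n\<close>, so
  \<open>Grpqn r p q n\<close> is literally a subgroup of \<open>Grpqn r 1 q n\<close>, and \<open>proj\<close> is the quotient map of
  both groups.
\<close>

definition proj :: "nat \<Rightarrow> nat \<Rightarrow> nat \<Rightarrow> complex mat \<Rightarrow> complex mat set" where
  "proj r q n g = Cq r q n #>\<^bsub>Grn r n\<^esub> g"

definition Nrpqn :: "nat \<Rightarrow> nat \<Rightarrow> nat \<Rightarrow> nat \<Rightarrow> complex mat set set" where
  "Nrpqn r p q n = proj r q n ` {A \<in> carrier (Grpn r p n). diagonal_mat A}"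

definition Crpqn :: "nat \<Rightarrow> nat \<Rightarrow> nat \<Rightarrow> nat \<Rightarrow> complex mat set set" where
  "Crpqn r p q n =
     {X \<in> carrier (Grpqn r p q n). \<exists>i::int. X = proj r q n (cmat r n [^]\<^bsub>Grn r n\<^esub> i)}"

definition Ad ::
    "nat \<Rightarrow> nat \<Rightarrow> nat \<Rightarrow> complex mat set \<Rightarrow> complex mat set \<Rightarrow> complex mat set" where
  "Ad r q n g h = g \<otimes>\<^bsub>Grpqn r 1 q n\<^esub> h \<otimes>\<^bsub>Grpqn r 1 q n\<^esub> inv\<^bsub>Grpqn r 1 q n\<^esub> g"

definition inversion_number :: "nat \<Rightarrow> (nat \<Rightarrow> nat) \<Rightarrow> nat" where
  "inversion_number n \<pi> = card {(i, j). i < j \<and> j < n \<and> \<pi> j < \<pi> i}"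

text \<open>
  The map induced on cosets: the set below collects the values at all representatives of \<open>X\<close>
  in \<open>Grpn r p n\<close> (and at all integer lifts), and it is a singleton for every coset \<open>X\<close> in
  \<open>Grpqn r p q n\<close>.  The division by \<open>gcd p q n\<close> is exact since \<open>p\<close> divides \<open>Delta n x\<close>;
  changing the lift alters the power of \<open>cmat r n\<close> by an element of \<open>Cq r q n\<close>.
\<close>

definition alpha ::
    "nat \<Rightarrow> nat \<Rightarrow> nat \<Rightarrow> nat \<Rightarrow> int \<Rightarrow> int \<Rightarrow> complex mat set \<Rightarrow>
     complex mat set \<Rightarrow> complex mat set" where
  "alpha r p q n j k z X = the_elem
     {z [^]\<^bsub>Grpqn r p q n\<^esub> inversion_number n \<pi> \<otimes>\<^bsub>Grpqn r p q n\<^esub>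
        proj r q n
          (cmat r n [^]\<^bsub>Grn r n\<^esub> (Delta n x div int (gcd p (gcd q n)) * k)
             \<otimes>\<^bsub>Grn r n\<^esub> elt r n \<pi> (\<lambda>i. j * x i))
      | \<pi> x. \<pi> permutes {..<n} \<and> elt r n \<pi> x \<in> X}"

text \<open>
  Since indices start at \<open>0\<close>, \<open>smat r n i\<close> is the transposition usually written
  \<open>s\<close> with index \<open>i + 1\<close>, and likewise for \<open>tmat\<close>; the shift is uniform, so the rule
  pairing \<open>s\<close> at index \<open>i\<close> with \<open>t\<close> at index \<open>i + 2\<close> modulo \<open>4\<close> is unchanged.
\<close>

definition smat :: "nat \<Rightarrow> nat \<Rightarrow> nat \<Rightarrow> complex mat" where
  "smat r n i = elt r n (Transposition.transpose i (Suc i)) (\<lambda>_. 0)"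

definition tmat :: "nat \<Rightarrow> nat \<Rightarrow> nat \<Rightarrow> complex mat" where
  "tmat r n i = elt r n id (\<lambda>a. if a = i then 1 else 0) [^]\<^bsub>Grn r n\<^esub> (r div 2)"

definition exotic_cond :: "nat \<Rightarrow> nat \<Rightarrow> nat \<Rightarrow> nat \<Rightarrow> bool" where
  "exotic_cond r p q n \<longleftrightarrow>
     n = 4 \<and> even q \<and> (odd (r div p) \<longrightarrow> even (r div q) \<and> odd ((4 * r) div (p * q)))"

definition exotic_image :: "nat \<Rightarrow> nat \<Rightarrow> nat \<Rightarrow> nat \<Rightarrow> complex mat" where
  "exotic_image r p q i =
     (if even (r div p)
      then tmat r 4 ((i + 2) mod 4) \<otimes>\<^bsub>Grn r 4\<^esub> smat r 4 i
      else tmat r 4 ((i + 2) mod 4) \<otimes>\<^bsub>Grn r 4\<^esub> smat r 4 i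
             \<otimes>\<^bsub>Grn r 4\<^esub> (cmat r 4 [^]\<^bsub>Grn r 4\<^esub> (r div (2 * q))))"

definition is_exotic ::
    "nat \<Rightarrow> nat \<Rightarrow> nat \<Rightarrow> (complex mat set \<Rightarrow> complex mat set) \<Rightarrow> bool" where
  "is_exotic r p q \<phi> \<longleftrightarrow>
     \<phi> \<in> iso (Grpqn r p q 4) (Grpqn r p q 4) \<and>
     (\<forall>h \<in> Nrpqn r p q 4. \<phi> h = h) \<and>
     (\<forall>i<3. \<phi> (proj r q 4 (smat r 4 i)) = proj r q 4 (exotic_image r p q i))"

text \<open>
  Maps are compared on the carrier only, since elements of \<open>iso\<close> are unconstrained outside it.
\<close>

definition is_unique_exotic ::
    "nat \<Rightarrow> nat \<Rightarrow> nat \<Rightarrow> (complex mat set \<Rightarrow> complex mat set) \<Rightarrow> bool" where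
  "is_unique_exotic r p q \<phi> \<longleftrightarrow>
     is_exotic r p q \<phi> \<and>
     (\<forall>\<psi>. is_exotic r p q \<psi> \<longrightarrow> (\<forall>h \<in> carrier (Grpqn r p q 4). \<psi> h = \<phi> h))"

end

theory Submission
  imports Defs
begin

text \<open>
  An automorphism \<open>\<nu>\<close> preserving \<open>N\<close> induces an automorphism of \<open>S\<^sub>n\<close>. The image of a transposition
  under it is an involution whose products with its conjugates have order at most three; this leaves
  transpositions, the double transpositions of \<open>S\<^sub>4\<close>, which are even, and the triple transpositions of
  \<open>S\<^sub>6\<close>, which are excluded because their commutators with \<open>N\<close> do not form a cyclic group when \<open>r > 1\<close>.
  Hence the induced automorphism is inner, and after composing with some \<open>Ad(g)\<close> it is trivial. Then \<open>\<nu>\<close> restricted to \<open>N\<close> is equivariant, which forces it to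
  be \<open>x \<mapsto> jx\<close> plus a multiple of \<open>\<Delta>(x)/d\<^sub>0\<close> times the all-ones vector, and \<open>\<nu>\<close> sends
  \<open>s\<^sub>i\<close> to \<open>s\<^sub>i y\<^sub>i\<close> for a cocycle \<open>y\<close> with values in \<open>N\<close>. The commutation and braid relations show that \<open>y\<close> is a
  coboundary times a central element of order at most two, except for \<open>n = 4\<close> and \<open>q\<close> even, where \<open>t\<^bsub>i+2\<^esub>\<close>
  may occur as a further factor. The exotic automorphism is obtained as what remains of \<open>\<nu>\<close> after removing
  \<open>Ad(g)\<close> and \<open>\<alpha>\<close>, so it need not be constructed separately.
\<close>

section \<open>Permutations of finite sets of natural numbers\<close>

text \<open>Calculations use integer lifts of vectors, compared by \<open>veq\<close>. An element of
  C_q is a constant vector whose entry is a multiple of d = r/q, so such a relation determines a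
  single coordinate only modulo d, but the difference of two coordinates modulo r. Most arguments
  evaluate one relation at well chosen coordinates and use one of these two facts.

  The number 4 is exceptional because comparing two coordinates outside i and i+1 needs another one,
  moved neither by s_i nor by their transposition. From n = 5 on it exists, and for n = 3 there is
  nothing to compare. For n = 4 the two coordinates may differ by r/2; commutation of the outer
  generators makes r/2 a multiple of r/q, so q is even. The vector of t_{i+2} has sum r/2, which p
  divides only if r/p is even. Otherwise a scalar must compensate that is nontrivial in the quotient
  but has trivial square, and this leaves c^{r/(2q)}.\<close>

abbreviation swp :: "'a \<Rightarrow> 'a \<Rightarrow> 'a \<Rightarrow> 'a" where
  "swp \<equiv> Transposition.transpose"

text \<open>The braid relations and the exotic images are given on adjacent transpositions, so an
  induction over permutations may multiply by these only. An arbitrary transposition enters as the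
  word \<open>adj_transp_seq\<close>.\<close>

lemma permutes_adjacent_induct [consumes 1, case_names id swap]:
  assumes "p permutes {..<n}" and id: "Q id"
    and swap: "\<And>i p. Suc i < n \<Longrightarrow> p permutes {..<n} \<Longrightarrow> Q p \<Longrightarrow> Q (p \<circ> swp i (Suc i))"
  shows "Q p"
proof -
  have *: "Q (p \<circ> apply_adj_transps xs) \<and> p \<circ> apply_adj_transps xs permutes {..<n}"
    if "Q p" "p permutes {..<n}" "\<forall>x\<in>set xs. Suc x < n" for p xs
    using that
  proof (induction xs arbitrary: p)
    case (Cons x xs)
    have "p \<circ> swp x (Suc x) permutes {..<n}"
      using Cons.prems by (intro permutes_compose permutes_swap_id) auto
    moreover have "Q (p \<circ> swp x (Suc x))"
      using Cons.prems by (intro swap) auto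
    ultimately have "Q ((p \<circ> swp x (Suc x)) \<circ> apply_adj_transps xs) \<and>
        (p \<circ> swp x (Suc x)) \<circ> apply_adj_transps xs permutes {..<n}"
      using Cons.IH Cons.prems(3) by (metis list.set_intros(2))
    moreover have "p \<circ> apply_adj_transps (x # xs) = (p \<circ> swp x (Suc x)) \<circ> apply_adj_transps xs"
      by (simp add: o_assoc)
    ultimately show ?case by metis
  qed simp
  have **: "Q (p \<circ> swp a b)" if "Q p" "p permutes {..<n}" "a < b" "b < n" for p a b
  proof -
    have "\<forall>x\<in>set (adj_transp_seq a b). Suc x < n"
      using that by (simp add: set_adj_transp_seq)
    from *[OF that(1,2) this] show ?thesis using that adj_transp_seq_correct[of a b] by simp
  qed
  have "finite {..<n}" by simp
  from this assms(1) show ?thesis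
  proof (induction p rule: permutes_rev_induct)
    case id from assms(2) show ?case .
  next
    case (swap a b p)
    then have "a < b \<or> b < a" "a < n" "b < n" by auto
    with swap **[of p a b] **[of p b a] have "Q (p \<circ> swp a b)"
      by (metis transpose_commute)
    then show ?case .
  qed
qed

text \<open>Exchanging the positions i and i+1 keeps the order of every other pair of positions, so
  it maps the inversions other than (i, i+1) bijectively to such inversions. Only the pair (i, i+1)
  itself changes its status.\<close>

lemma odd_inversion_number_comp_swap:
  assumes p: "p permutes {..<n}" and i: "Suc i < n"
  shows "even (inversion_number n (p \<circ> swp i (Suc i))) \<longleftrightarrow> odd (inversion_number n p)"
proof -
  define s where "s = swp i (Suc i)"
  define A where "A q = {(a, b). a < b \<and> b < n \<and> q b < (q a::nat)}" for q
  define B where "B q = A q - {(i, Suc i)}" for q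
  have fin: "finite (A q)" for q
    by (rule finite_subset[of _ "{..<n} \<times> {..<n}"]) (auto simp: A_def)
  have ss: "s (s a) = a" for a by (simp add: s_def)
  have inj: "p a = p b \<longleftrightarrow> a = b" for a b using p by (metis permutes_inj injD)
  have step: "map_prod s s ` B q \<subseteq> B (q \<circ> s)" for q
  proof -
    have "s a < s b" if "a < b" "\<not> (a = i \<and> b = Suc i)" for a b
      using that by (auto simp: s_def Transposition.transpose_def)
    moreover have "s b < n" if "b < n" for b
      using that i by (simp add: s_def Transposition.transpose_def)
    moreover have "\<not> (s a = i \<and> s b = Suc i)" if "a < b" for a b
    proof
      assume "s a = i \<and> s b = Suc i"
      then have "a = s i" "b = s (Suc i)" using ss by metis+
      then show False using that by (simp add: s_def)
    qed
    ultimately show ?thesis by (auto simp: B_def A_def ss)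
  qed
  have "B (p \<circ> s) \<subseteq> map_prod s s ` B p"
  proof
    fix x assume x: "x \<in> B (p \<circ> s)"
    have "map_prod s s x \<in> map_prod s s ` B (p \<circ> s)" using x by blast
    also have "\<dots> \<subseteq> B (p \<circ> s \<circ> s)" by (rule step)
    also have "p \<circ> s \<circ> s = p" by (simp add: fun_eq_iff ss)
    finally have "map_prod s s x \<in> B p" .
    moreover have "x = map_prod s s (map_prod s s x)" by (cases x) (simp add: ss)
    ultimately show "x \<in> map_prod s s ` B p" by blast
  qed
  with step[of p] have "B (p \<circ> s) = map_prod s s ` B p" by blast
  moreover have "inj (map_prod s s)" by (rule inj_on_inverseI[of _ "map_prod s s"]) (auto simp: ss)
  ultimately have card: "card (B (p \<circ> s)) = card (B p)"
    by (metis card_image inj_on_subset subset_UNIV)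
  have cardA: "card (A q) = card (B q) + (if q (Suc i) < q i then 1 else 0)" for q
  proof (cases "q (Suc i) < q i")
    case True
    then have "(i, Suc i) \<in> A q" using i by (simp add: A_def)
    then show ?thesis using fin[of q] True by (simp add: B_def card_Suc_Diff1 del: card_Diff_insert)
  next
    case False
    then show ?thesis by (simp add: B_def A_def)
  qed
  have "p (Suc i) \<noteq> p i" by (simp add: inj)
  then have "p (Suc i) < p i \<longleftrightarrow> \<not> (p \<circ> s) (Suc i) < (p \<circ> s) i" by (auto simp: s_def)
  with cardA[of p] cardA[of "p \<circ> s"] card have "even (card (A (p \<circ> s))) \<longleftrightarrow> odd (card (A p))"
    by presburger
  then show ?thesis unfolding inversion_number_def A_def s_def .
qed

text \<open>With z^2 = 1 the exponent in \<open>alpha\<close> counts only modulo two. As the sign,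
  its parity is additive under composition.\<close>

lemma even_inversion_number_iff:
  assumes "p permutes {..<n}"
  shows "even (inversion_number n p) \<longleftrightarrow> evenperm p"
  using assms
proof (induction p rule: permutes_adjacent_induct)
  case id
  have "{(i, j). i < j \<and> j < n \<and> id j < (id i :: nat)} = {}" by auto
  then have "inversion_number n id = 0" by (simp only: inversion_number_def card.empty)
  then have "even (inversion_number n id) \<longleftrightarrow> evenperm id" by simp
  then show ?case .
next
  case (swap i p)
  then have "permutation p" by (auto simp: permutation_permutes)
  then have "even (inversion_number n (p \<circ> swp i (Suc i))) \<longleftrightarrow> evenperm (p \<circ> swp i (Suc i))"
    using swap by (simp add: odd_inversion_number_comp_swap evenperm_comp evenperm_swap permutation_swap_id)
  then show ?case .
qed

lemma even_inversion_number_comp: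
  assumes "p permutes {..<n}" "q permutes {..<n}"
  shows "even (inversion_number n (p \<circ> q)) \<longleftrightarrow> even (inversion_number n p + inversion_number n q)"
proof -
  have "permutation p" "permutation q" "p \<circ> q permutes {..<n}"
    using assms by (auto simp: permutation_permutes intro!: permutes_compose)
  then show ?thesis using assms by (simp add: even_inversion_number_iff evenperm_comp)
qed

lemma odd_inversion_number_swap:
  assumes "Suc i < n" shows "odd (inversion_number n (swp i (Suc i)))"
  using assms by (subst even_inversion_number_iff) (auto simp: evenperm_swap intro!: permutes_swap_id)

section \<open>Products of transpositions and their conjugates\<close>

lemma noncommuting_swaps:
  assumes "a \<noteq> b" "c \<noteq> d" "swp a b \<circ> swp c d \<noteq> swp c d \<circ> swp a b"
  shows "a = c \<and> b \<noteq> d \<or> a = d \<and> b \<noteq> c \<or> b = c \<and> a \<noteq> d \<or> b = d \<and> a \<noteq> c"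
proof (rule ccontr)
  assume "\<not> ?thesis"
  then have "swp a b = swp c d \<or> (a \<noteq> c \<and> a \<noteq> d \<and> b \<noteq> c \<and> b \<noteq> d)"
    by (metis transpose_commute)
  then show False
  proof
    assume "a \<noteq> c \<and> a \<noteq> d \<and> b \<noteq> c \<and> b \<noteq> d"
    then have "swp a b \<circ> swp c d = swp c d \<circ> swp a b"
      using assms(1,2) by (auto simp: fun_eq_iff Transposition.transpose_def)
    then show False using assms(3) by simp
  qed (use assms in auto)
qed

lemma swap_eq_iff:
  assumes "a \<noteq> b" "c \<noteq> d"
  shows "swp a b = swp c d \<longleftrightarrow> a = c \<and> b = d \<or> a = d \<and> b = c"
  using assms by (metis transpose_apply_first transpose_apply_other transpose_apply_second transpose_commute)

abbreviation pinv :: "('a \<Rightarrow> 'a) \<Rightarrow> 'a \<Rightarrow> 'a" where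
  "pinv f \<equiv> inv_into UNIV f"

lemma bij_comp_swap:
  assumes "bij f" shows "f \<circ> swp a b = swp (f a) (f b) \<circ> f"
  using assms by (auto simp: fun_eq_iff Transposition.transpose_def bij_def inj_eq)

lemma swap_conj:
  assumes "bij f" shows "f \<circ> swp a b \<circ> pinv f = swp (f a) (f b)"
proof -
  have "f \<circ> swp a b \<circ> pinv f = swp (f a) (f b) \<circ> (f \<circ> pinv f)"
    by (simp only: bij_comp_swap[OF assms] o_assoc)
  also have "f \<circ> pinv f = id" using assms by (metis bij_is_surj surj_iff)
  finally show ?thesis by (simp only: comp_id)
qed

text \<open>Commuting transpositions have a product of order at most two; noncommuting ones share
  exactly one point, and their product is a three-cycle.\<close>

lemma swap_comp_order:
  assumes "a \<noteq> b" "c \<noteq> d"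
  defines "u \<equiv> swp a b \<circ> swp c d"
  shows "u \<circ> u = id \<or> u \<circ> u \<circ> u = id"
proof (cases "swp a b \<circ> swp c d = swp c d \<circ> swp a b")
  case True
  have "u \<circ> u = swp a b \<circ> (swp c d \<circ> swp a b) \<circ> swp c d" by (simp add: u_def o_assoc)
  also have "\<dots> = swp a b \<circ> (swp a b \<circ> swp c d) \<circ> swp c d" by (simp only: True)
  also have "\<dots> = id" by (auto simp: fun_eq_iff)
  finally show ?thesis by simp
next
  case False
  have *: "(swp a b \<circ> swp a d) \<circ> (swp a b \<circ> swp a d) \<circ> (swp a b \<circ> swp a d) = id"
    if "a \<noteq> b" "a \<noteq> d" "b \<noteq> d" for a b d :: 'a
  proof
    fix x
    consider "x = a" | "x = b" | "x = d" | "x \<noteq> a" "x \<noteq> b" "x \<noteq> d" by blast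
    then show "((swp a b \<circ> swp a d) \<circ> (swp a b \<circ> swp a d) \<circ> (swp a b \<circ> swp a d)) x = id x"
      using that by cases simp_all
  qed
  from noncommuting_swaps[OF assms(1,2) False]
  have "u \<circ> u \<circ> u = id"
    using assms(1,2) *[of a b d] *[of a b c] *[of b a d] *[of b a c]
    unfolding u_def by (metis transpose_commute)
  then show ?thesis by simp
qed

text \<open>Fischer's three-transposition property, for one element and its conjugates. It speaks of
  products and conjugation alone, so it passes to images under automorphisms, and it leaves few
  candidates for the image of a transposition.\<close>

definition three_transposition :: "nat \<Rightarrow> (nat \<Rightarrow> nat) \<Rightarrow> bool" where
  "three_transposition n t \<longleftrightarrow>
     (\<forall>\<rho>. \<rho> permutes {..<n} \<longrightarrow>
       (let u = t \<circ> (\<rho> \<circ> t \<circ> pinv \<rho>) in u \<circ> u = id \<or> u \<circ> u \<circ> u = id))"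

text \<open>Describing the conjugate by \<open>t' (\<rho> x) = \<rho> (t x)\<close> avoids the
  inverse of \<open>\<rho>\<close>: to refute the property it is enough to trace the orbit of one
  point through finitely many values of \<open>\<rho>\<close>.\<close>

lemma three_transpositionD:
  assumes "three_transposition n t" "\<rho> permutes {..<n}"
  shows "\<exists>t'. (\<forall>x. t' (\<rho> x) = \<rho> (t x)) \<and>
    ((\<forall>x. t (t' (t (t' x))) = x) \<or> (\<forall>x. t (t' (t (t' (t (t' x))))) = x))"
proof (intro exI conjI)
  let ?t = "\<rho> \<circ> t \<circ> pinv \<rho>"
  show "\<forall>x. ?t (\<rho> x) = \<rho> (t x)" using permutes_inverses[OF assms(2)] by simp
  show "(\<forall>x. t (?t (t (?t x))) = x) \<or> (\<forall>x. t (?t (t (?t (t (?t x))))) = x)"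
    using assms unfolding three_transposition_def Let_def by (auto simp: fun_eq_iff)
qed

text \<open>The cyclic shift serves as conjugator. Written as a product of transpositions it is
  visibly a permutation of \<open>{..<n}\<close> once its points lie there.\<close>

lemma five_cycle:
  fixes a b c d e :: 'a
  assumes "distinct [a, b, c, d, e]"
  defines "\<rho> \<equiv> swp a b \<circ> swp b c \<circ> swp c d \<circ> swp d e"
  shows "\<rho> a = b" "\<rho> b = c" "\<rho> c = d" "\<rho> d = e" "\<rho> e = a"
  using assms(1) by (simp_all add: \<rho>_def) (elim conjE, simp)+

lemma eight_cycle:
  fixes a b c d e f g h :: 'a
  assumes "distinct [a, b, c, d, e, f, g, h]"
  defines "\<rho> \<equiv> swp a b \<circ> swp b c \<circ> swp c d \<circ> swp d e \<circ> swp e f \<circ> swp f g \<circ> swp g h"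
  shows "\<rho> a = b" "\<rho> b = c" "\<rho> c = d" "\<rho> d = e" "\<rho> e = f" "\<rho> f = g" "\<rho> g = h" "\<rho> h = a"
  using assms(1) by (simp_all add: \<rho>_def) (elim conjE, simp)+

lemma two_swaps_eqI:
  fixes t :: "'a \<Rightarrow> 'a"
  assumes "distinct [a, b, c, d]" "t a = b" "t b = a" "t c = d" "t d = c"
    and "\<And>x. x \<notin> {a, b, c, d} \<Longrightarrow> t x = x"
  shows "t = swp a b \<circ> swp c d"
proof
  fix x
  consider "x = a" | "x = b" | "x = c" | "x = d" | "x \<notin> {a, b, c, d}" by blast
  then show "t x = (swp a b \<circ> swp c d) x" using assms(2-) assms(1)[simplified]
    by cases (elim conjE, simp)+
qed

lemma three_swaps_eqI:
  fixes t :: "'a \<Rightarrow> 'a"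
  assumes "distinct [a, b, c, d, e, f]" "t a = b" "t b = a" "t c = d" "t d = c" "t e = f" "t f = e"
    and "\<And>x. x \<notin> {a, b, c, d, e, f} \<Longrightarrow> t x = x"
  shows "t = swp a b \<circ> swp c d \<circ> swp e f"
proof
  fix x
  consider "x = a" | "x = b" | "x = c" | "x = d" | "x = e" | "x = f" | "x \<notin> {a, b, c, d, e, f}" by blast
  then show "t x = (swp a b \<circ> swp c d \<circ> swp e f) x" using assms(2-) assms(1)[simplified]
    by cases (elim conjE, simp)+
qed

text \<open>
  Besides a transposition, the only products of disjoint transpositions whose pairwise products
  of conjugates all have order at most three are fixed point free on four or six points: otherwise
  a cyclic shift of the pairs gives a conjugate for which the product is a five-cycle, or contains
  a four-cycle.
\<close>

lemma three_transposition_cases: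
  assumes t: "t permutes {..<n}" and inv: "\<And>x. t (t x) = x" and ne: "t \<noteq> id"
    and three: "three_transposition n t"
  obtains (swap) a b where "a \<noteq> b" "a < n" "b < n" "t = swp a b"
  | (four) a b c d where "n = 4" "distinct [a, b, c, d]" "t = swp a b \<circ> swp c d"
  | (six) a b c d e f where "n = 6" "distinct [a, b, c, d, e, f]" "{a, b, c, d, e, f} = {..<n}"
      "t = swp a b \<circ> swp c d \<circ> swp e f"
proof -
  have lt: "x < n" if "t x \<noteq> x" for x using t that by (metis permutes_not_in lessThan_iff)
  have tlt: "t x < n" if "t x \<noteq> x" for x using lt[of "t x"] that inv[of x] by auto
  obtain a where a: "t a \<noteq> a" using ne by (auto simp: fun_eq_iff)
  define b where "b = t a"
  have b: "t a = b" "t b = a" "a \<noteq> b" "a < n" "b < n" using a inv lt tlt by (auto simp: b_def)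
  show thesis
  proof (cases "\<forall>x. x \<noteq> a \<longrightarrow> x \<noteq> b \<longrightarrow> t x = x")
    case True
    then have "t = swp a b" using b by (auto simp: fun_eq_iff Transposition.transpose_def)
    then show thesis using b swap by blast
  next
    case False
    then obtain c where c: "c \<noteq> a" "c \<noteq> b" "t c \<noteq> c" by blast
    define d where "d = t c"
    have d: "t c = d" "t d = c" "c \<noteq> d" "c < n" "d < n" using c inv lt tlt by (auto simp: d_def)
    have dn: "d \<noteq> a" "d \<noteq> b" using b c d by (metis inv)+
    show thesis
    proof (cases "\<exists>e<n. e \<notin> {a,b,c,d} \<and> t e = e")
      case True
      then obtain e where e: "e < n" "e \<notin> {a,b,c,d}" "t e = e" by blast
      have dist: "distinct [a, b, c, d, e]" using b(3) c(1,2) d(3) dn e(2) by auto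
      define \<rho> where "\<rho> = swp a b \<circ> swp b c \<circ> swp c d \<circ> swp d e"
      have "\<rho> permutes {..<n}" unfolding \<rho>_def using b(4,5) d(4,5) e(1)
        by (intro permutes_compose permutes_swap_id) simp_all
      from three_transpositionD[OF three this] obtain t' where
        t': "\<And>x. t' (\<rho> x) = \<rho> (t x)" and
        or: "(\<forall>x. t (t' (t (t' x))) = x) \<or> (\<forall>x. t (t' (t (t' (t (t' x))))) = x)" by blast
      note \<rho> = five_cycle[OF dist, folded \<rho>_def]
      \<comment> \<open>The product of \<open>t\<close> and \<open>t'\<close> moves a to b, b to d
        and d to e, so neither its square nor its cube fixes a.\<close>
      have "t' a = a" "t' b = c" "t' d = e"
        using t' \<rho> e(3) b(1) d(1) by metis+
      then have "t (t' (t (t' a))) = d" "t (t' (t (t' (t (t' a))))) = e"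
        by (simp_all only: e(3) b(1) d(1))
      then have False using or dist by (metis distinct_length_2_or_more)
      then show thesis ..
    next
      case nofix: False
      show thesis
      proof (cases "\<exists>e<n. e \<notin> {a,b,c,d}")
        case False
        then have "{..<n} \<subseteq> {a,b,c,d}" by blast
        moreover have "{a,b,c,d} \<subseteq> {..<n}" using b(4,5) d(4,5) by simp
        ultimately have eq: "{..<n} = {a,b,c,d}" by blast
        have dist: "distinct [a, b, c, d]" using b(3) c(1,2) d(3) dn by auto
        have "n = card {a,b,c,d}" using eq by (metis card_lessThan)
        also have "\<dots> = 4" using distinct_card[OF dist] by simp
        finally have "n = 4" .
        moreover have "t = swp a b \<circ> swp c d"
          using b(1,2) d(1,2) t eq by (intro two_swaps_eqI dist) (auto dest: permutes_not_in)
        ultimately show thesis using dist by (intro four)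
      next
        case True
        then obtain e where e: "e < n" "e \<notin> {a,b,c,d}" by blast
        define f where "f = t e"
        have f: "t e = f" "t f = e" "e \<noteq> f" "f < n" using e nofix tlt[of e] inv by (auto simp: f_def)
        have fn: "f \<notin> {a,b,c,d}" using e(2) b(1,2) d(1,2) f(1,2) by auto
        have dist: "distinct [a, b, c, d, e, f]" using b(3) c(1,2) d(3) dn e(2) f(3) fn by auto
        show thesis
        proof (cases "\<exists>g<n. g \<notin> {a,b,c,d,e,f}")
          case True
          then obtain g where g: "g < n" "g \<notin> {a,b,c,d,e,f}" by blast
          define h where "h = t g"
          have h: "t g = h" "t h = g" "g \<noteq> h" "h < n" using g nofix tlt[of g] inv by (auto simp: h_def)
          have hn: "h \<notin> {a,b,c,d,e,f}" using g(2) b(1,2) d(1,2) f(1,2) h(1,2) by auto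
          have dist: "distinct [a, b, c, d, e, f, g, h]" using dist g(2) h(3) hn by auto
          define \<rho> where "\<rho> = swp a b \<circ> swp b c \<circ> swp c d \<circ> swp d e \<circ> swp e f \<circ> swp f g \<circ> swp g h"
          have "\<rho> permutes {..<n}" unfolding \<rho>_def using b(4,5) d(4,5) e(1) f(4) g(1) h(4)
            by (intro permutes_compose permutes_swap_id) simp_all
          from three_transpositionD[OF three this] obtain t' where
            t': "\<And>x. t' (\<rho> x) = \<rho> (t x)" and
            or: "(\<forall>x. t (t' (t (t' x))) = x) \<or> (\<forall>x. t (t' (t (t' (t (t' x))))) = x)" by blast
          note \<rho> = eight_cycle[OF dist, folded \<rho>_def]
          \<comment> \<open>Here the product runs through a, g, e, c, so again its square and its
            cube move a.\<close>
          have "t' a = h" "t' g = f" "t' e = d"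
            using t' \<rho> b(2) d(2) f(2) h(2) by metis+
          then have "t (t' (t (t' a))) = e" "t (t' (t (t' (t (t' a))))) = c"
            by (simp_all only: h(2) f(2) d(2))
          then have False using or e(2) c(1) by (metis insertI1)
          then show thesis ..
        next
          case False
          then have "{..<n} \<subseteq> {a,b,c,d,e,f}" by blast
          moreover have "{a,b,c,d,e,f} \<subseteq> {..<n}" using b(4,5) d(4,5) e(1) f(4) by simp
          ultimately have eq: "{..<n} = {a,b,c,d,e,f}" by blast
          have "n = card {a,b,c,d,e,f}" using eq by (metis card_lessThan)
          also have "\<dots> = 6" using distinct_card[OF dist] by simp
          finally have "n = 6" .
          moreover have "t = swp a b \<circ> swp c d \<circ> swp e f"
            using b(1,2) d(1,2) f(1,2) t eq by (intro three_swaps_eqI dist) (auto dest: permutes_not_in)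
          ultimately show thesis using dist eq by (intro six) auto
        qed
      qed
    qed
  qed
qed

section \<open>Automorphisms of symmetric groups\<close>

declare One_nat_def [simp del]

lemma permutes_two_points:
  fixes n :: nat
  assumes "c < n" "d < n" "c \<noteq> d" "a < n" "b < n" "a \<noteq> b"
  obtains \<rho> where "\<rho> permutes {..<n}" "\<rho> c = a" "\<rho> d = b"
proof
  \<comment> \<open>The inner factor moves c to a. The outer one moves the resulting image of d to b
    and leaves a alone, as neither of its two points is a.\<close>
  let ?\<rho> = "swp (swp c a d) b \<circ> swp c a"
  have "swp c a d < n" using assms by (simp add: Transposition.transpose_def)
  then show "?\<rho> permutes {..<n}"
    using assms by (intro permutes_compose permutes_swap_id) simp_all
  have "swp c a d \<noteq> a" using assms(3) by (metis transpose_apply_first transpose_involutory)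
  then show "?\<rho> c = a" "?\<rho> d = b" using assms(6) by simp_all
qed

locale symmetric_group_aut =
  fixes n :: nat and P :: "(nat \<Rightarrow> nat) \<Rightarrow> nat \<Rightarrow> nat"
  assumes bij: "bij_betw P {\<pi>. \<pi> permutes {..<n}} {\<pi>. \<pi> permutes {..<n}}"
    and hom: "\<And>\<pi> \<sigma>. \<pi> permutes {..<n} \<Longrightarrow> \<sigma> permutes {..<n} \<Longrightarrow> P (\<pi> \<circ> \<sigma>) = P \<pi> \<circ> P \<sigma>"
    and n3: "n \<ge> 3"
begin

lemma perm: "\<pi> permutes {..<n} \<Longrightarrow> P \<pi> permutes {..<n}"
  using bij by (auto simp: bij_betw_def)

lemma P_inj: "\<pi> permutes {..<n} \<Longrightarrow> \<sigma> permutes {..<n} \<Longrightarrow> P \<pi> = P \<sigma> \<longleftrightarrow> \<pi> = \<sigma>"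
  using bij by (auto simp: bij_betw_def inj_on_def)

lemma P_surj:
  assumes "\<rho> permutes {..<n}" obtains \<pi> where "\<pi> permutes {..<n}" "\<rho> = P \<pi>"
  using assms bij by (auto simp: bij_betw_def)

lemma P_id [simp]: "P id = id"
proof -
  have "P id \<circ> P id = P id \<circ> id" using hom[of id id] by simp
  moreover have "inj (P id)" using perm[of id] by (auto intro: permutes_inj)
  ultimately show ?thesis by (auto simp: fun_eq_iff inj_eq)
qed

lemma P_inv:
  assumes "\<pi> permutes {..<n}" shows "P (pinv \<pi>) = pinv (P \<pi>)"
proof -
  have p: "pinv \<pi> permutes {..<n}" using assms by (rule permutes_inv)
  have "P \<pi> \<circ> P (pinv \<pi>) = id" "P (pinv \<pi>) \<circ> P \<pi> = id"
    using hom[OF assms p] hom[OF p assms] permutes_inv_o[OF assms] by simp_all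
  then show ?thesis by (metis inv_unique_comp)
qed

lemma P_conj:
  assumes "\<pi> permutes {..<n}" "\<sigma> permutes {..<n}"
  shows "P (\<pi> \<circ> \<sigma> \<circ> pinv \<pi>) = P \<pi> \<circ> P \<sigma> \<circ> pinv (P \<pi>)"
  using assms by (simp add: hom P_inv permutes_compose permutes_inv)

lemma swap_permutes [simp]: "a < n \<Longrightarrow> b < n \<Longrightarrow> swp a b permutes {..<n}"
  by (rule permutes_swap_id) simp_all

lemma transposition_conj:
  assumes "a < n" "b < n" "a \<noteq> b" "c < n" "d < n" "c \<noteq> d"
  obtains \<rho> where "\<rho> permutes {..<n}" "swp a b = \<rho> \<circ> swp c d \<circ> pinv \<rho>"
proof -
  obtain \<rho> where \<rho>: "\<rho> permutes {..<n}" "\<rho> c = a" "\<rho> d = b"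
    using permutes_two_points[OF assms(4-6) assms(1-3)] .
  have "swp a b = \<rho> \<circ> swp c d \<circ> pinv \<rho>"
    using swap_conj[OF permutes_bij[OF \<rho>(1)], of c d] by (simp only: \<rho>)
  with \<rho>(1) show thesis by (rule that)
qed

text \<open>Surjectivity of \<open>P\<close> turns an arbitrary conjugate of the image into the
  image of a conjugate, so \<open>swap_comp_order\<close> carries over.\<close>

lemma three_transposition_image: "three_transposition n (P (swp 0 1))"
  unfolding three_transposition_def
proof (intro allI impI)
  fix \<rho> assume "\<rho> permutes {..<n}"
  then obtain \<pi> where \<pi>: "\<pi> permutes {..<n}" "\<rho> = P \<pi>" by (rule P_surj)
  have s: "swp 0 1 permutes {..<n}" using n3 by simp
  have inj: "\<pi> a = \<pi> b \<longleftrightarrow> a = b" for a b using \<pi>(1) by (metis permutes_inj injD)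
  have lt: "\<pi> 0 < n" "\<pi> 1 < n" using permutes_in_image[OF \<pi>(1)] n3 by auto
  define u where "u = swp 0 1 \<circ> swp (\<pi> 0) (\<pi> 1)"
  have u: "u permutes {..<n}" unfolding u_def using s lt by (intro permutes_compose) simp_all
  have "P (swp 0 1) \<circ> (\<rho> \<circ> P (swp 0 1) \<circ> pinv \<rho>) = P u"
    using \<pi> s lt by (simp add: u_def hom swap_conj[symmetric] permutes_bij P_conj[symmetric] permutes_compose permutes_inv)
  moreover have "u \<circ> u = id \<or> u \<circ> u \<circ> u = id"
    unfolding u_def by (rule swap_comp_order) (simp_all add: inj)
  then have "P u \<circ> P u = id \<or> P u \<circ> P u \<circ> P u = id"
    using hom[OF u u] hom[OF permutes_compose[OF u u] u] by force
  ultimately show "let u = P (swp 0 1) \<circ> (\<rho> \<circ> P (swp 0 1) \<circ> pinv \<rho>) in u \<circ> u = id \<or> u \<circ> u \<circ> u = id"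
    by simp
qed

text \<open>All transpositions are conjugate. If one had an even image, every image would be even,
  and \<open>P\<close> would miss the odd permutations. This disposes of the double transpositions
  of S_4.\<close>

lemma not_all_even:
  assumes "evenperm (P (swp 0 1))" shows False
proof -
  have s: "swp 0 1 permutes {..<n}" using n3 by simp
  have pm: "permutation \<pi>" if "\<pi> permutes {..<n}" for \<pi> :: "nat \<Rightarrow> nat"
    using that by (auto simp: permutation_permutes)
  have ev: "evenperm (P \<pi>)" if "\<pi> permutes {..<n}" for \<pi>
    using that
  proof (induction \<pi> rule: permutes_adjacent_induct)
    case id
    have "evenperm (P id)" by simp
    then show ?case .
  next
    case (swap i \<pi>)
    have lt: "i < n" "Suc i < n" "i \<noteq> Suc i" "0 < n" "1 < n" using swap n3 by simp_all
    obtain \<rho> where \<rho>: "\<rho> permutes {..<n}" "swp i (Suc i) = \<rho> \<circ> swp 0 1 \<circ> pinv \<rho>"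
      using transposition_conj[OF lt] by (metis zero_neq_one)
    have "evenperm (P (swp i (Suc i)))"
      using \<rho> assms s perm[OF \<rho>(1)] perm[OF s]
      by (simp add: P_conj evenperm_comp evenperm_inv pm permutes_compose permutes_inv)
    then have "evenperm (P (\<pi> \<circ> swp i (Suc i)))"
      using swap lt by (simp add: hom evenperm_comp pm perm)
    then show ?case .
  qed
  obtain \<pi> where "\<pi> permutes {..<n}" "swp 0 1 = P \<pi>" using P_surj[OF s] .
  then have "evenperm (swp 0 (1::nat))" using ev by simp
  then show False by (simp add: evenperm_swap)
qed

text \<open>The transpositions (0 i) pairwise do not commute, so their images pairwise share a
  point. A triangle is ruled out, hence there is a common point \<open>a\<close>; sending 0 to
  \<open>a\<close> and i to the second point gives the conjugating permutation. The case
  \<open>six\<close> has to be assumed away: S_6 has outer automorphisms, and they take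
  transpositions to triple transpositions.\<close>

theorem inner:
  assumes six: "\<And>a b c d e f. \<lbrakk>n = 6; distinct [a, b, c, d, e, f]; {a, b, c, d, e, f} = {..<n}\<rbrakk>
      \<Longrightarrow> P (swp 0 1) \<noteq> swp a b \<circ> swp c d \<circ> swp e f"
  obtains f where "f permutes {..<n}" "\<And>\<pi>. \<pi> permutes {..<n} \<Longrightarrow> P \<pi> = f \<circ> \<pi> \<circ> pinv f"
proof -
  have s: "swp 0 1 permutes {..<n}" using n3 by simp
  define t where "t = P (swp 0 1)"
  have t: "t permutes {..<n}" unfolding t_def using s by (rule perm)
  have "t \<circ> t = id" using hom[OF s s] by (simp add: t_def)
  then have inv: "t (t x) = x" for x by (simp add: fun_eq_iff)
  have ne: "t \<noteq> id" using P_inj[OF s permutes_id] unfolding t_def P_id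
    by (metis transpose_eq_id_iff zero_neq_one)
  have "\<exists>a b. a \<noteq> b \<and> a < n \<and> b < n \<and> P (swp 0 1) = swp a b"
    using t inv ne three_transposition_image[folded t_def]
  proof (cases rule: three_transposition_cases)
    case (swap a b)
    then show ?thesis by (auto simp: t_def)
  next
    case (four a b c d)
    then have "evenperm (P (swp 0 1))"
      by (simp add: t_def evenperm_comp evenperm_swap permutation_swap_id)
    then show ?thesis using not_all_even by blast
  next
    case (six a b c d e f)
    then show ?thesis using assms[of a b c d e f] by (simp add: t_def)
  qed
  then obtain a0 b0 where ab0: "a0 \<noteq> b0" "a0 < n" "b0 < n" "P (swp 0 1) = swp a0 b0" by blast
  have lt: "0 < n" "1 < n" "2 < n" using n3 by simp_all
  have swap: "\<exists>a b. a \<noteq> b \<and> a < n \<and> b < n \<and> P (swp i j) = swp a b" if ij: "i < n" "j < n" "i \<noteq> j" for i j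
  proof -
    obtain \<rho> where \<rho>: "\<rho> permutes {..<n}" "swp i j = \<rho> \<circ> swp 0 1 \<circ> pinv \<rho>"
      using transposition_conj[OF ij lt(1,2) zero_neq_one] .
    have "P (swp i j) = P \<rho> \<circ> swp a0 b0 \<circ> pinv (P \<rho>)"
      using P_conj[OF \<rho>(1) s] by (simp add: \<rho>(2) ab0(4))
    also have "\<dots> = swp (P \<rho> a0) (P \<rho> b0)"
      using perm[OF \<rho>(1)] by (intro swap_conj permutes_bij)
    finally show ?thesis
      using ab0(1-3) permutes_in_image[OF perm[OF \<rho>(1)]] permutes_inj[OF perm[OF \<rho>(1)]]
      by (metis injD lessThan_iff)
  qed
  have noncomm: "P (swp 0 i) \<circ> P (swp 0 j) \<noteq> P (swp 0 j) \<circ> P (swp 0 i)"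
    if "0 < i" "i < n" "0 < j" "j < n" "i \<noteq> j" for i j
  proof
    assume "P (swp 0 i) \<circ> P (swp 0 j) = P (swp 0 j) \<circ> P (swp 0 i)"
    then have "P (swp 0 i \<circ> swp 0 j) = P (swp 0 j \<circ> swp 0 i)" using that by (simp add: hom)
    then have "swp 0 i \<circ> swp 0 j = swp 0 j \<circ> swp 0 i"
      using that by (simp add: P_inj permutes_compose)
    then have "(swp 0 i \<circ> swp 0 j) 0 = (swp 0 j \<circ> swp 0 i) 0" by simp
    then show False using that by simp
  qed
  obtain a b c where abc: "a \<noteq> b" "a \<noteq> c" "b \<noteq> c" "P (swp 0 1) = swp a b" "P (swp 0 2) = swp a c"
  proof -
    obtain a b c d where 1: "a \<noteq> b" "P (swp 0 1) = swp a b" and 2: "c \<noteq> d" "P (swp 0 2) = swp c d"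
      using swap[of 0 1] swap[of 0 2] lt by auto
    have "swp a b \<circ> swp c d \<noteq> swp c d \<circ> swp a b" using noncomm[of 1 2] lt 1 2 by simp
    from noncommuting_swaps[OF 1(1) 2(1) this]
    consider "a = c" "b \<noteq> d" | "a = d" "b \<noteq> c" | "b = c" "a \<noteq> d" | "b = d" "a \<noteq> c" by blast
    then show thesis
    proof cases
      case a1: 1 then show thesis using that[of a b d] 1 2 by simp
    next
      case a2: 2 then show thesis using that[of a b c] 1 2 by (simp add: transpose_commute[of c])
    next
      case a3: 3 then show thesis using that[of b a d] 1 2 by (simp add: transpose_commute[of a])
    next
      case a4: 4 then show thesis using that[of b a c] 1 2
        by (simp add: transpose_commute[of a] transpose_commute[of c])
    qed
  qed
  \<comment> \<open>This is the third side of the triangle on a, b, c. As it is already the image of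
    (1 2), injectivity of \<open>P\<close> keeps it from being the image of some (0 i).\<close>
  have bc: "P (swp 1 2) = swp b c"
  proof -
    have "swp 1 2 = swp 0 1 \<circ> swp 0 2 \<circ> pinv (swp 0 (1::nat))"
      using swap_conj[OF bij_transpose, of 0 "1::nat" 0 2] by simp
    then have "P (swp 1 2) = swp a b \<circ> swp a c \<circ> pinv (swp a b)"
      using P_conj[of "swp 0 1" "swp 0 2"] lt abc by simp
    also have "\<dots> = swp b c"
      using swap_conj[OF bij_transpose, of a b a c] abc by simp
    finally show ?thesis .
  qed
  have star: "\<exists>x. x \<noteq> a \<and> P (swp 0 i) = swp a x" if i: "0 < i" "i < n" for i
  proof (cases "i = 1 \<or> i = 2")
    case True
    then show ?thesis using abc by metis
  next
    case False
    then have i12: "i \<noteq> 1" "i \<noteq> 2" by auto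
    obtain u v where uv: "u \<noteq> v" "P (swp 0 i) = swp u v" using swap[of 0 i] i lt by auto
    have n1: "swp a b \<circ> swp u v \<noteq> swp u v \<circ> swp a b" using noncomm[of 1 i] lt abc uv i i12 by simp
    have n2: "swp a c \<circ> swp u v \<noteq> swp u v \<circ> swp a c" using noncomm[of 2 i] lt abc uv i i12 by simp
    have "swp 0 i \<noteq> swp 1 (2::nat)"
    proof -
      have "swp 0 i 0 \<noteq> swp 1 (2::nat) 0" using i by simp
      then show ?thesis by metis
    qed
    then have n3: "swp u v \<noteq> swp b c" using P_inj[of "swp 0 i" "swp 1 2"] lt i bc uv by simp
    have "\<not> (u = b \<and> v = c)" "\<not> (u = c \<and> v = b)" using n3 by (auto simp: transpose_commute)
    then have "u = a \<or> v = a"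
      using noncommuting_swaps[OF abc(1) uv(1) n1] noncommuting_swaps[OF abc(2) uv(1) n2] abc(3) by blast
    then show ?thesis
    proof
      assume "u = a" then show ?thesis using uv by auto
    next
      assume "v = a" then show ?thesis using uv by (auto simp: transpose_commute[of u])
    qed
  qed
  \<comment> \<open>Points outside \<open>{..<n}\<close> are fixed, as \<open>permutes\<close>
    requires.\<close>
  define f where "f i = (if i = 0 then a else if i < n then (SOME x. x \<noteq> a \<and> P (swp 0 i) = swp a x) else i)" for i
  have f: "f i \<noteq> a" "P (swp 0 i) = swp a (f i)" if "0 < i" "i < n" for i
    using someI_ex[OF star[OF that]] that by (simp_all add: f_def)
  have f0: "f 0 = a" by (simp add: f_def)
  have an: "a < n" and fn: "0 < i \<Longrightarrow> i < n \<Longrightarrow> f i < n" for i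
  proof -
    have *: "x < n \<and> y < n" if "x \<noteq> y" "i < n" "0 < i" "P (swp 0 i) = swp x y" for x y i
    proof -
      obtain x' y' where "x' \<noteq> y'" "x' < n" "y' < n" "P (swp 0 i) = swp x' y'"
        using swap[of 0 i] \<open>i < n\<close> \<open>0 < i\<close> lt by (metis nat_neq_iff)
      then show ?thesis using that swap_eq_iff[of x y x' y'] by auto
    qed
    show "a < n" using *[of a b 1] abc lt by auto
    show "f i < n" if "0 < i" "i < n" using *[of a "f i" i] f[of i] that by auto
  qed
  have "inj_on f {..<n}"
  proof (rule inj_onI)
    fix i j assume ij: "i \<in> {..<n}" "j \<in> {..<n}" "f i = f j"
    have "swp 0 i = swp 0 j" if "0 < i" "0 < j"
    proof -
      have "P (swp 0 i) = P (swp 0 j)" using f[of i] f[of j] ij that by simp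
      then show ?thesis using P_inj[of "swp 0 i" "swp 0 j"] ij lt by simp
    qed
    then have "i = j" if "0 < i" "0 < j" using that by (metis transpose_apply_first)
    then show "i = j" using ij f(1) f0 by (metis lessThan_iff neq0_conv)
  qed
  then have fp: "f permutes {..<n}"
    using fn an f0 by (intro inj_imp_permutes) (auto simp: f_def)
  have bf: "bij f" by (rule permutes_bij[OF fp])
  have main: "P (swp 0 i) = f \<circ> swp 0 i \<circ> pinv f" if "0 < i" "i < n" for i
    using f[OF that] swap_conj[OF bf] f0 by simp
  have "P \<pi> = f \<circ> \<pi> \<circ> pinv f" if "\<pi> permutes {..<n}" for \<pi>
    using that
  proof (induction \<pi> rule: permutes_adjacent_induct)
    case id
    have "P id = f \<circ> id \<circ> pinv f" using permutes_inv_o[OF fp] by simp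
    then show ?case .
  next
    case (swap i \<pi>)
    \<comment> \<open>The fact \<open>main\<close> covers only transpositions that involve 0. For i
      > 0 the adjacent one is the conjugate of (0 i+1) by (0 i).\<close>
    have adj: "P (swp i (Suc i)) = f \<circ> swp i (Suc i) \<circ> pinv f"
    proof (cases "i = 0")
      case True
      then show ?thesis using main[of 1] lt by (simp add: One_nat_def)
    next
      case False
      then have i: "0 < i" "i < n" "0 < Suc i" "Suc i < n" using swap by simp_all
      have "swp i (Suc i) = swp 0 i \<circ> swp 0 (Suc i) \<circ> pinv (swp 0 i)"
        using swap_conj[OF bij_transpose, of 0 i 0 "Suc i"] i by simp
      then have "P (swp i (Suc i)) = P (swp 0 i) \<circ> P (swp 0 (Suc i)) \<circ> pinv (P (swp 0 i))"
        using P_conj[of "swp 0 i" "swp 0 (Suc i)"] i lt by simp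
      also have "\<dots> = swp a (f i) \<circ> swp a (f (Suc i)) \<circ> pinv (swp a (f i))"
        using f(2)[OF i(1,2)] f(2)[OF i(3,4)] by simp
      also have "\<dots> = swp (f i) (f (Suc i))"
      proof -
        have "f i \<noteq> f (Suc i)" using bf by (metis bij_pointE n_not_Suc_n)
        then have "swp a (f i) (f (Suc i)) = f (Suc i)" using f(1)[OF i(3,4)] by simp
        then show ?thesis using swap_conj[OF bij_transpose, of a "f i" a "f (Suc i)"] by simp
      qed
      also have "\<dots> = f \<circ> swp i (Suc i) \<circ> pinv f" using swap_conj[OF bf] by simp
      finally show ?thesis .
    qed
    have "P (\<pi> \<circ> swp i (Suc i)) = P \<pi> \<circ> P (swp i (Suc i))" using swap by (simp add: hom)
    also have "\<dots> = f \<circ> \<pi> \<circ> (pinv f \<circ> f) \<circ> swp i (Suc i) \<circ> pinv f"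
      unfolding adj swap.IH by (simp only: o_assoc)
    also have "pinv f \<circ> f = id" by (rule permutes_inv_o(2)[OF fp])
    finally have "P (\<pi> \<circ> swp i (Suc i)) = f \<circ> (\<pi> \<circ> swp i (Suc i)) \<circ> pinv f"
      by (simp only: comp_id o_assoc)
    then show ?case .
  qed
  with fp show thesis using that by blast
qed

end

section \<open>Integer vectors modulo the central subgroup\<close>

text \<open>Two vectors are related if and only if they define the same element of \<open>N(r,1,q,n)\<close>.\<close>

definition veq :: "nat \<Rightarrow> nat \<Rightarrow> nat \<Rightarrow> (nat \<Rightarrow> int) \<Rightarrow> (nat \<Rightarrow> int) \<Rightarrow> bool" where
  "veq r q n x y \<longleftrightarrow> (\<exists>m. \<forall>i<n. int r dvd x i - y i - m * int (r div q))"

lemma Delta_add: "Delta n (\<lambda>i. x i + y i) = Delta n x + Delta n y"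
  by (simp add: Delta_def sum.distrib)

lemma Delta_mult: "Delta n (\<lambda>i. m * x i) = m * Delta n x"
  by (simp add: Delta_def sum_distrib_left)

lemma Delta_const: "Delta n (\<lambda>_. m) = int n * m"
  by (simp add: Delta_def)

lemma Delta_permute: "\<pi> permutes {..<n} \<Longrightarrow> Delta n (x \<circ> \<pi>) = Delta n x"
  unfolding Delta_def using sum.permute[of \<pi> "{..<n}" x] by (simp add: o_def)

lemma Delta_single: "a < n \<Longrightarrow> Delta n (\<lambda>i. if i = a then m else 0) = m"
  by (simp add: Delta_def)

locale grpqn_params =
  fixes r p q n :: nat
  assumes r0: "r > 0" and p0: "p > 0" and q0: "q > 0"
    and pr: "p dvd r" and qr: "q dvd r" and pqn: "p * q dvd r * n" and n3: "n \<ge> 3"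
begin

text \<open>The integer multiples of \<open>d\<close> are the entries of the constant vectors that
  make up \<open>Cq\<close>; \<open>d0\<close> is the denominator in \<open>alpha\<close>.\<close>

definition d :: int where "d = int (r div q)"
definition d0 :: int where "d0 = int (gcd p (gcd q n))"

lemma r_eq: "int r = int q * d"
  unfolding d_def using qr by (metis dvd_mult_div_cancel of_nat_mult)

lemma d_pos: "d > 0"
  unfolding d_def using r0 q0 qr by (simp add: dvd_imp_le div_greater_zero_iff)

lemma d_dvd_r: "d dvd int r"
  by (simp add: r_eq)

text \<open>The generator of \<open>Cq\<close> is the constant vector \<open>d\<close>, with
  coordinate sum \<open>n * d\<close>. So this expresses that \<open>Cq\<close> lies in G(r,p,n),
  and it makes divisibility of \<open>Delta\<close> by p well defined on cosets.\<close>

lemma p_dvd_nd: "int p dvd int n * d"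
proof -
  have "int p * int q dvd int q * d * int n"
    using pqn unfolding r_eq[symmetric] by (metis of_nat_dvd_iff of_nat_mult)
  then have "int q * int p dvd int q * (int n * d)" by (simp add: ac_simps)
  then show ?thesis using q0 by simp
qed

lemma d0_pos: "d0 > 0"
  unfolding d0_def using p0 by simp

lemma d0_dvd: "d0 dvd int p" "d0 dvd int q" "d0 dvd int n" "d0 dvd int r"
proof -
  show 1: "d0 dvd int p" by (simp add: d0_def)
  show "d0 dvd int q" unfolding d0_def of_nat_dvd_iff by (meson dvd_trans gcd_dvd1 gcd_dvd2)
  show "d0 dvd int n" unfolding d0_def of_nat_dvd_iff by (meson dvd_trans gcd_dvd1 gcd_dvd2)
  show "d0 dvd int r" using 1 pr by (meson dvd_trans of_nat_dvd_iff)
qed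

abbreviation eqv (infix "\<simeq>" 50) where "x \<simeq> y \<equiv> veq r q n x y"

lemma eqvI: "(\<And>i. i < n \<Longrightarrow> int r dvd x i - y i - m * d) \<Longrightarrow> x \<simeq> y"
  unfolding veq_def d_def by blast

lemma eqvD: "x \<simeq> y \<Longrightarrow> \<exists>m. \<forall>i<n. int r dvd x i - y i - m * d"
  unfolding veq_def d_def by blast

lemma eqvI0: "(\<And>i. i < n \<Longrightarrow> int r dvd x i - y i) \<Longrightarrow> x \<simeq> y"
  by (rule eqvI[of _ _ 0]) simp

lemma eqv_cong: "(\<And>i. i < n \<Longrightarrow> x i = y i) \<Longrightarrow> x \<simeq> y"
  by (rule eqvI0) simp

lemma eqv_refl [simp]: "x \<simeq> x"
  by (rule eqv_cong) simp

lemma eqv_sym: assumes "x \<simeq> y" shows "y \<simeq> x"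
proof -
  obtain m where m: "\<And>i. i < n \<Longrightarrow> int r dvd x i - y i - m * d" using eqvD[OF assms] by blast
  have "int r dvd y i - x i - (-m) * d" if "i < n" for i
    using m[OF that] by (metis (no_types, opaque_lifting) diff_minus_eq_add dvd_minus_iff minus_diff_eq mult_minus_left add.commute diff_diff_eq2)
  then show ?thesis by (rule eqvI)
qed

lemma eqv_add:
  assumes "x \<simeq> y" "x' \<simeq> y'" shows "(\<lambda>i. x i + x' i) \<simeq> (\<lambda>i. y i + y' i)"
proof -
  obtain m where m: "\<And>i. i < n \<Longrightarrow> int r dvd x i - y i - m * d" using eqvD[OF assms(1)] by blast
  obtain m' where m': "\<And>i. i < n \<Longrightarrow> int r dvd x' i - y' i - m' * d" using eqvD[OF assms(2)] by blast
  have "int r dvd (x i + x' i) - (y i + y' i) - (m + m') * d" if "i < n" for i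
    using dvd_add[OF m[OF that] m'[OF that]] by (simp add: algebra_simps)
  then show ?thesis by (rule eqvI)
qed

lemma eqv_scale:
  assumes "x \<simeq> y" shows "(\<lambda>i. c * x i) \<simeq> (\<lambda>i. c * y i)"
proof -
  obtain m where m: "\<And>i. i < n \<Longrightarrow> int r dvd x i - y i - m * d" using eqvD[OF assms(1)] by blast
  have "int r dvd c * x i - c * y i - (c * m) * d" if "i < n" for i
    using dvd_mult[OF m[OF that], of c] by (simp add: algebra_simps)
  then show ?thesis by (rule eqvI)
qed

lemma eqv_minus: "x \<simeq> y \<Longrightarrow> (\<lambda>i. - x i) \<simeq> (\<lambda>i. - y i)"
  using eqv_scale[of x y "-1"] by simp

lemma eqv_diff: "x \<simeq> y \<Longrightarrow> x' \<simeq> y' \<Longrightarrow> (\<lambda>i. x i - x' i) \<simeq> (\<lambda>i. y i - y' i)"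
  using eqv_add[OF _ eqv_minus] by simp

lemma eqv_trans [trans]: assumes "x \<simeq> y" "y \<simeq> z" shows "x \<simeq> z"
  using eqv_diff[OF eqv_add[OF assms] eqv_refl[of y]] by simp

lemma eqv_permute:
  assumes "x \<simeq> y" "\<pi> permutes {..<n}" shows "x \<circ> \<pi> \<simeq> y \<circ> \<pi>"
proof -
  obtain m where m: "\<And>i. i < n \<Longrightarrow> int r dvd x i - y i - m * d" using eqvD[OF assms(1)] by blast
  show ?thesis using m permutes_in_image[OF assms(2)] by (intro eqvI[of _ _ m]) simp
qed

text \<open>The multiple of \<open>d\<close> by which two lifts differ is unknown, so a single
  coordinate retains no more than this.\<close>

lemma eqv_dvd: assumes "x \<simeq> y" "i < n" shows "d dvd x i - y i"
proof -
  obtain m where m: "\<And>i. i < n \<Longrightarrow> int r dvd x i - y i - m * d" using eqvD[OF assms(1)] by blast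
  have "d dvd x i - y i - m * d" using m[OF assms(2)] d_dvd_r by (rule dvd_trans[rotated])
  then show ?thesis by (metis dvd_add_left_iff dvd_triv_right diff_add_cancel)
qed

text \<open>The elements of the central subgroup are constant vectors, so one exact coordinate
  makes all coordinates exact.\<close>

lemma eqv_diff_const:
  assumes "x \<simeq> y" "i < n" "j < n" shows "int r dvd (x i - y i) - (x j - y j)"
proof -
  obtain m where m: "\<And>i. i < n \<Longrightarrow> int r dvd x i - y i - m * d" using eqvD[OF assms(1)] by blast
  have "(x i - y i) - (x j - y j) = (x i - y i - m * d) - (x j - y j - m * d)" by simp
  then show ?thesis using dvd_diff[OF m m] assms(2,3) by metis
qed

lemma eqv_exact:
  assumes "x \<simeq> y" "i < n" "j < n" "int r dvd x i - y i" shows "int r dvd x j - y j"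
proof -
  have "int r dvd (x j - y j) - (x i - y i) + (x i - y i)"
    using eqv_diff_const[OF assms(1,3,2)] assms(4) by (rule dvd_add)
  then show ?thesis by simp
qed

lemma eqv_shift:
  assumes "d dvd c" shows "(\<lambda>i. x i + c) \<simeq> x"
proof -
  obtain m where "c = d * m" using assms by blast
  then show ?thesis by (intro eqvI[of _ _ m]) (simp add: ac_simps)
qed

lemma eqv_const: "d dvd a - b \<Longrightarrow> (\<lambda>_. a) \<simeq> (\<lambda>_. b)"
  using eqv_shift[of "a - b" "\<lambda>_. b"] by simp

lemma Delta_eqv:
  assumes "x \<simeq> y" obtains s m where "Delta n x - Delta n y = int r * s + int n * d * m"
proof -
  obtain m where m: "\<And>i. i < n \<Longrightarrow> int r dvd x i - y i - m * d" using eqvD[OF assms(1)] by blast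
  have "int r dvd (\<Sum>i<n. x i - y i - m * d)" using m by (intro dvd_sum) simp
  also have "(\<Sum>i<n. x i - y i - m * d) = Delta n x - Delta n y - int n * d * m"
    by (simp add: Delta_def sum_subtractf)
  finally obtain s where "Delta n x - Delta n y - int n * d * m = int r * s" by blast
  then show thesis by (intro that[of s m]) simp
qed

lemma p_dvd_Delta_eqv:
  assumes "x \<simeq> y" shows "int p dvd Delta n x \<longleftrightarrow> int p dvd Delta n y"
proof -
  obtain s m where sm: "Delta n x - Delta n y = int r * s + int n * d * m" using Delta_eqv[OF assms] .
  have "int p dvd Delta n x - Delta n y"
    unfolding sm using pr by (intro dvd_add dvd_mult2 p_dvd_nd) simp
  then show ?thesis by (metis dvd_add_right_iff diff_add_cancel)
qed

text \<open>The action of \<open>alpha\<close> on the diagonal part. The division is exact when p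
  divides \<open>Delta n x\<close>.\<close>

definition T :: "int \<Rightarrow> int \<Rightarrow> (nat \<Rightarrow> int) \<Rightarrow> nat \<Rightarrow> int" where
  "T j k x = (\<lambda>i. j * x i + Delta n x div d0 * k)"

text \<open>Passing to another lift alters \<open>Delta\<close> by r s + n d m. Both q and n are
  multiples of \<open>d0\<close>, so the quotient by \<open>d0\<close> changes by a multiple of
  \<open>d\<close>, and such a constant vector is trivial. This explains q and n in the gcd; p makes
  the division exact.\<close>

lemma T_eqv:
  assumes "x \<simeq> y" "int p dvd Delta n x" shows "T j k x \<simeq> T j k y"
proof -
  obtain s m where sm: "Delta n x - Delta n y = int r * s + int n * d * m" using Delta_eqv[OF assms(1)] .
  obtain q' n' where qn: "int q = d0 * q'" "int n = d0 * n'" using d0_dvd by (meson dvdE)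
  have r': "int r = d0 * (q' * d)" by (simp add: r_eq qn)
  have "int p dvd Delta n y" using p_dvd_Delta_eqv assms by blast
  then obtain a b where ab: "Delta n x = d0 * a" "Delta n y = d0 * b"
    using assms(2) d0_dvd(1) by (meson dvdE dvd_trans)
  have "d0 * (a - b) = d0 * (d * (q' * s + n' * m))"
    using sm unfolding ab r' qn by (simp add: algebra_simps)
  then have "a - b = d * (q' * s + n' * m)" using d0_pos by simp
  then have "d dvd a * k - b * k" by (metis dvd_mult2 dvd_triv_left left_diff_distrib)
  then have "(\<lambda>_. a * k) \<simeq> (\<lambda>_. b * k)" by (rule eqv_const)
  then show ?thesis unfolding T_def using ab d0_pos eqv_add[OF eqv_scale[OF assms(1)]] by simp
qed

lemma T_add:
  assumes "int p dvd Delta n x" "int p dvd Delta n y"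
  shows "T j k (\<lambda>i. x i + y i) = (\<lambda>i. T j k x i + T j k y i)"
proof -
  have "d0 dvd Delta n x" "d0 dvd Delta n y" using assms d0_dvd(1) by (meson dvd_trans)+
  then show ?thesis by (simp add: T_def Delta_add div_plus_div_distrib_dvd_left algebra_simps)
qed

lemma T_permute: "\<pi> permutes {..<n} \<Longrightarrow> T j k (x \<circ> \<pi>) = T j k x \<circ> \<pi>"
  by (simp add: T_def Delta_permute fun_eq_iff)

lemma T_zero: "T j k (\<lambda>_. 0) = (\<lambda>_. 0)"
  by (simp add: T_def Delta_def)

text \<open>The constant summand of \<open>T\<close> contributes \<open>Delta n x\<close> times a
  multiple of n/d0, an integer.\<close>

lemma p_dvd_Delta_T:
  assumes "int p dvd Delta n x" shows "int p dvd Delta n (T j k x)"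
proof -
  obtain n' where n': "int n = d0 * n'" using d0_dvd by (meson dvdE)
  obtain a where a: "Delta n x = d0 * a" using assms d0_dvd(1) by (meson dvdE dvd_trans)
  have "Delta n (T j k x) = j * Delta n x + Delta n x * (n' * k)"
    unfolding T_def Delta_add Delta_mult Delta_const using a n' d0_pos by simp
  then show ?thesis using assms by simp
qed

end

section \<open>Equivariant endomorphisms of the normal part\<close>

text \<open>\<open>F\<close> acts on chosen lifts, so additivity and compatibility can be asked for
  only up to \<open>\<simeq>\<close>.\<close>

locale endomorphism = grpqn_params +
  fixes F :: "(nat \<Rightarrow> int) \<Rightarrow> nat \<Rightarrow> int"
  assumes F_Delta: "int p dvd Delta n x \<Longrightarrow> int p dvd Delta n (F x)"
    and F_eqv: "int p dvd Delta n x \<Longrightarrow> int p dvd Delta n y \<Longrightarrow> x \<simeq> y \<Longrightarrow> F x \<simeq> F y"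
    and F_add: "int p dvd Delta n x \<Longrightarrow> int p dvd Delta n y \<Longrightarrow>
      F (\<lambda>i. x i + y i) \<simeq> (\<lambda>i. F x i + F y i)"
begin

lemma F_zero: "F (\<lambda>_. 0) \<simeq> (\<lambda>_. 0)"
proof -
  have "F (\<lambda>_. 0) \<simeq> (\<lambda>i. F (\<lambda>_. 0) i + F (\<lambda>_. 0) i)"
    using F_add[of "\<lambda>_. 0" "\<lambda>_. 0"] by (simp add: Delta_def)
  from eqv_diff[OF this eqv_refl[of "F (\<lambda>_. 0)"]] show ?thesis by (simp add: eqv_sym)
qed

lemma F_scale:
  assumes x: "int p dvd Delta n x" shows "F (\<lambda>i. m * x i) \<simeq> (\<lambda>i. m * F x i)"
proof -
  have nat: "F (\<lambda>i. int m * x i) \<simeq> (\<lambda>i. int m * F x i)" for m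
  proof (induction m)
    case 0 then show ?case using F_zero by simp
  next
    case (Suc m)
    have "F (\<lambda>i. int m * x i + x i) \<simeq> (\<lambda>i. F (\<lambda>i. int m * x i) i + F x i)"
      using x by (intro F_add) (simp_all add: Delta_mult)
    also have "\<dots> \<simeq> (\<lambda>i. int m * F x i + F x i)" by (intro eqv_add Suc eqv_refl)
    finally show ?case by (simp add: algebra_simps)
  qed
  show ?thesis
  proof (cases "m \<ge> 0")
    case True then show ?thesis using nat[of "nat m"] by simp
  next
    case False
    have mx: "int p dvd Delta n (\<lambda>i. k * x i)" for k using x by (simp add: Delta_mult)
    have "(\<lambda>i. m * x i + int (nat (-m)) * x i) = (\<lambda>_. 0)" using False by (simp add: algebra_simps)
    then have "(\<lambda>_. 0) \<simeq> F (\<lambda>i. m * x i + int (nat (-m)) * x i)" using eqv_sym[OF F_zero] by (simp only:)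
    also have "\<dots> \<simeq> (\<lambda>i. F (\<lambda>i. m * x i) i + F (\<lambda>i. int (nat (-m)) * x i) i)" by (rule F_add[OF mx mx])
    also have "\<dots> \<simeq> (\<lambda>i. F (\<lambda>i. m * x i) i + int (nat (-m)) * F x i)" by (intro eqv_add eqv_refl nat)
    finally have "(\<lambda>_. 0) \<simeq> (\<lambda>i. F (\<lambda>i. m * x i) i + int (nat (-m)) * F x i)" .
    from eqv_sym[OF eqv_diff[OF this eqv_refl[of "\<lambda>i. int (nat (-m)) * F x i"]]]
    show ?thesis using False by simp
  qed
qed

end

locale equivariant_endomorphism = endomorphism +
  assumes F_permute: "int p dvd Delta n x \<Longrightarrow> \<pi> permutes {..<n} \<Longrightarrow> F (x \<circ> \<pi>) \<simeq> F x \<circ> \<pi>"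
begin

text \<open>The roots of type A. Together with p times one unit vector they generate the vectors
  whose coordinate sum is divisible by p.\<close>

definition e :: "nat \<Rightarrow> nat \<Rightarrow> nat \<Rightarrow> int" where
  "e a b = (\<lambda>i. (if i = a then 1 else 0) - (if i = b then 1 else 0))"

lemma Delta_e: "a < n \<Longrightarrow> b < n \<Longrightarrow> Delta n (e a b) = 0"
  by (simp add: e_def Delta_def sum_subtractf)

lemma e_permute:
  assumes "\<pi> permutes {..<n}" shows "e a b \<circ> \<pi> = e (pinv \<pi> a) (pinv \<pi> b)"
  using permutes_inverses[OF assms] by (auto simp: e_def fun_eq_iff)

text \<open>The good vectors form a group closed under \<open>\<simeq>\<close>, so agreement of
  \<open>F\<close> with \<open>T\<close> has to be tested on generators only.\<close>

definition good :: "int \<Rightarrow> int \<Rightarrow> (nat \<Rightarrow> int) \<Rightarrow> bool" where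
  "good j k x \<longleftrightarrow> int p dvd Delta n x \<and> F x \<simeq> T j k x"

lemma good_eqv:
  assumes "good j k x" "x \<simeq> y" shows "good j k y"
proof -
  have x: "int p dvd Delta n x" and y: "int p dvd Delta n y"
    using assms p_dvd_Delta_eqv by (auto simp: good_def)
  have "F y \<simeq> F x" using F_eqv[OF x y assms(2)] by (rule eqv_sym)
  also have "F x \<simeq> T j k x" using assms by (simp add: good_def)
  also have "\<dots> \<simeq> T j k y" by (rule T_eqv[OF assms(2) x])
  finally show ?thesis using y by (simp add: good_def)
qed

lemma good_zero: "good j k (\<lambda>_. 0)"
  using F_zero by (simp add: good_def T_zero Delta_const)

lemma good_add:
  assumes "good j k x" "good j k y" shows "good j k (\<lambda>i. x i + y i)"
proof -
  have x: "int p dvd Delta n x" and y: "int p dvd Delta n y" using assms by (auto simp: good_def)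
  have "F (\<lambda>i. x i + y i) \<simeq> (\<lambda>i. F x i + F y i)" by (rule F_add[OF x y])
  also have "\<dots> \<simeq> (\<lambda>i. T j k x i + T j k y i)" using assms by (intro eqv_add) (simp_all add: good_def)
  also have "\<dots> = T j k (\<lambda>i. x i + y i)" by (rule T_add[OF x y, symmetric])
  finally show ?thesis using x y by (simp add: good_def Delta_add)
qed

lemma T_scale:
  assumes "int p dvd Delta n x" shows "T j k (\<lambda>i. m * x i) = (\<lambda>i. m * T j k x i)"
proof -
  have "d0 dvd Delta n x" using assms d0_dvd(1) by (rule dvd_trans[rotated])
  then show ?thesis by (simp add: T_def Delta_mult div_mult_swap[symmetric] algebra_simps)
qed

lemma good_scale:
  assumes "good j k x" shows "good j k (\<lambda>i. m * x i)"
proof -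
  have x: "int p dvd Delta n x" using assms by (simp add: good_def)
  have "F (\<lambda>i. m * x i) \<simeq> (\<lambda>i. m * F x i)" by (rule F_scale[OF x])
  also have "\<dots> \<simeq> (\<lambda>i. m * T j k x i)" using assms by (intro eqv_scale) (simp add: good_def)
  finally show ?thesis using x by (simp add: good_def Delta_mult T_scale)
qed

lemma good_sum:
  assumes "finite A" "\<And>a. a \<in> A \<Longrightarrow> good j k (x a)"
  shows "good j k (\<lambda>i. \<Sum>a\<in>A. x a i)"
  using assms by (induction A) (simp_all add: good_zero good_add)

text \<open>Symmetry forces the image of a root to be j times the root plus a constant c. Exchanging
  its two points gives d | 2c, and three roots round a triangle, whose sum is 0, give d | 3c; so c
  is trivial in the quotient. Here \<open>k\<close> stays arbitrary because a root has coordinate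
  sum 0.\<close>

lemma F_e:
  obtains j where "\<And>k a b. a < n \<Longrightarrow> b < n \<Longrightarrow> good j k (e a b)"
proof -
  define v where "v = F (e 0 1)"
  define c where "c = v 2"
  define j where "j = v 0 - c"
  have lt: "0 < n" "1 < n" "2 < n" using n3 by simp_all
  have pe: "int p dvd Delta n (e a b)" if "a < n" "b < n" for a b using that by (simp add: Delta_e)
  \<comment> \<open>These transpositions do not move the coordinate 0. The relation is therefore
    exact there, which eliminates the unknown multiple of \<open>d\<close>.\<close>
  have vc: "int r dvd v k - c" if "2 \<le> k" "k < n" for k
  proof -
    have s: "swp 2 k permutes {..<n}" using that lt by (intro permutes_swap_id) simp_all
    have "e 0 1 \<circ> swp 2 k = e 0 1"
      using that by (subst e_permute[OF s]) simp
    then have "v \<simeq> v \<circ> swp 2 k" using F_permute[OF pe s, of 0 1] lt by (simp add: v_def)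
    from eqv_exact[OF this, of 0 k] that lt show ?thesis by (simp add: c_def)
  qed
  have s01: "swp 0 1 permutes {..<n}" using lt by (intro permutes_swap_id) simp_all
  have "e 0 1 \<circ> swp 0 1 = e 1 0" by (subst e_permute[OF s01]) simp
  then have v10: "F (e 1 0) \<simeq> v \<circ> swp 0 1" using F_permute[OF pe s01, of 0 1] lt by (simp add: v_def)
  have "(\<lambda>i. e 0 1 i + e 1 0 i) = (\<lambda>_. 0)" by (simp add: e_def fun_eq_iff)
  then have "(\<lambda>_. 0) \<simeq> F (\<lambda>i. e 0 1 i + e 1 0 i)" using eqv_sym[OF F_zero] by (simp only:)
  also have "\<dots> \<simeq> (\<lambda>i. v i + F (e 1 0) i)" unfolding v_def using lt by (intro F_add pe)
  also have "\<dots> \<simeq> (\<lambda>i. v i + (v \<circ> swp 0 1) i)" by (intro eqv_add eqv_refl v10)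
  finally have sym: "(\<lambda>i. v i + (v \<circ> swp 0 1) i) \<simeq> (\<lambda>_. 0)" by (rule eqv_sym)
  from eqv_dvd[OF this, of 2] lt have c2: "d dvd 2 * c" by (simp add: c_def)
  from eqv_diff_const[OF sym, of 0 2] lt have v1: "int r dvd v 0 + v 1 - 2 * c" by (simp add: c_def)
  have v: "v \<simeq> (\<lambda>i. j * e 0 1 i + c)"
  proof (rule eqvI0)
    fix i assume "i < n"
    consider "i = 0" | "i = 1" | "2 \<le> i" by linarith
    then show "int r dvd v i - (j * e 0 1 i + c)"
    proof cases
      case 1 then show ?thesis by (simp add: e_def j_def)
    next
      case 2
      have eq: "v 1 - (j * e 0 1 1 + c) = v 0 + v 1 - 2 * c" by (simp add: e_def j_def)
      show ?thesis unfolding 2 eq by (rule v1)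
    next
      case 3 then show ?thesis using vc[of i] \<open>i < n\<close> by (simp add: e_def)
    qed
  qed
  have Fe: "F (e a b) \<simeq> (\<lambda>i. j * e a b i + c)" if ab: "a < n" "b < n" "a \<noteq> b" for a b
  proof -
    obtain \<pi> where \<pi>: "\<pi> permutes {..<n}" "\<pi> a = 0" "\<pi> b = 1"
      using permutes_two_points[OF ab lt(1,2) zero_neq_one] .
    have e: "e 0 1 \<circ> \<pi> = e a b"
      unfolding e_permute[OF \<pi>(1)] using \<pi> by (metis permutes_inverses(2))
    have "F (e a b) \<simeq> v \<circ> \<pi>" using F_permute[OF pe \<pi>(1), of 0 1] lt by (simp add: v_def e)
    also have "\<dots> \<simeq> (\<lambda>i. j * e 0 1 i + c) \<circ> \<pi>" by (rule eqv_permute[OF v \<pi>(1)])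
    also have "\<dots> = (\<lambda>i. j * e a b i + c)" using e by (simp add: fun_eq_iff)
    finally show ?thesis .
  qed
  have "(\<lambda>i. (e 0 1 i + e 1 2 i) + e 2 0 i) = (\<lambda>_. 0)" by (simp add: e_def fun_eq_iff)
  then have "(\<lambda>_. 0) \<simeq> F (\<lambda>i. (e 0 1 i + e 1 2 i) + e 2 0 i)" using eqv_sym[OF F_zero] by (simp only:)
  also have "\<dots> \<simeq> (\<lambda>i. F (\<lambda>i. e 0 1 i + e 1 2 i) i + F (e 2 0) i)"
    using lt by (intro F_add pe) (simp_all add: Delta_add Delta_e)
  also have "\<dots> \<simeq> (\<lambda>i. (F (e 0 1) i + F (e 1 2) i) + F (e 2 0) i)"
    using lt by (intro eqv_add F_add pe) simp_all
  also have "\<dots> \<simeq> (\<lambda>i. ((j * e 0 1 i + c) + (j * e 1 2 i + c)) + (j * e 2 0 i + c))"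
    using lt by (intro eqv_add Fe) simp_all
  finally have "(\<lambda>_. 0) \<simeq> (\<lambda>i. ((j * e 0 1 i + c) + (j * e 1 2 i + c)) + (j * e 2 0 i + c))" .
  from eqv_dvd[OF this lt(1)] have "d dvd - (3 * c)" by (simp add: e_def algebra_simps)
  then have "d dvd 3 * c" by simp
  then have "d dvd 3 * c - 2 * c" using c2 by (rule dvd_diff)
  then have dc: "d dvd c" by simp
  have "good j k (e a b)" if ab: "a < n" "b < n" for a b k
  proof (cases "a = b")
    case True
    then have "e a b = (\<lambda>_. 0)" by (simp add: e_def)
    then show ?thesis by (simp add: good_zero)
  next
    case False
    have "F (e a b) \<simeq> (\<lambda>i. j * e a b i)" using eqv_trans[OF Fe[OF ab False] eqv_shift[OF dc]] .
    then show ?thesis using ab by (simp add: good_def T_def Delta_e)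
  qed
  then show thesis by (rule that)
qed

text \<open>Besides the roots there remains p e_0, whose image is j p e_0 plus a constant b. The
  coordinate sum gives p | b n, and applying \<open>F\<close> to r e_0, which is 0, gives p | b q.
  Hence p divides b d0, and b is a multiple of p/d0, exactly what the second summand of
  \<open>T\<close> produces at p e_0.\<close>

theorem F_eq_T: "\<exists>j k. \<forall>x. int p dvd Delta n x \<longrightarrow> F x \<simeq> T j k x"
proof -
  obtain j where je: "\<And>k a b. a < n \<Longrightarrow> b < n \<Longrightarrow> good j k (e a b)" using F_e by blast
  define f where "f a = (\<lambda>i. if i = a then int p else 0)" for a :: nat
  have lt: "0 < n" "1 < n" "2 < n" using n3 by simp_all
  have pf: "int p dvd Delta n (f a)" if "a < n" for a using that by (simp add: f_def Delta_single)
  define w where "w = F (f 0)"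
  define b where "b = w 1"
  have wb: "int r dvd w k - b" if "1 \<le> k" "k < n" for k
  proof -
    have s: "swp 1 k permutes {..<n}" using that lt by (intro permutes_swap_id) simp_all
    have "swp 1 k i = 0 \<longleftrightarrow> i = 0" for i using that by (auto simp: Transposition.transpose_def)
    then have "f 0 \<circ> swp 1 k = f 0" by (simp add: f_def fun_eq_iff)
    then have "w \<simeq> w \<circ> swp 1 k" using F_permute[OF pf s, of 0] lt by (simp add: w_def)
    from eqv_exact[OF this, of 0 k] that lt show ?thesis by (simp add: b_def)
  qed
  \<comment> \<open>The vectors p e_0 and p e_1 differ by p times a root, whose image is
    known.\<close>
  have w0: "int r dvd w 0 - b - j * int p"
  proof -
    have s: "swp 0 1 permutes {..<n}" using lt by (intro permutes_swap_id) simp_all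
    have "swp 0 1 i = 0 \<longleftrightarrow> i = (1::nat)" for i by (auto simp: Transposition.transpose_def)
    then have "f 0 \<circ> swp 0 1 = f 1" by (simp add: f_def fun_eq_iff)
    then have f1: "F (f 1) \<simeq> w \<circ> swp 0 1" using F_permute[OF pf s, of 0] lt by (simp add: w_def)
    have g: "good j 0 (\<lambda>i. int p * e 0 1 i)" using je lt by (intro good_scale)
    have "f 0 = (\<lambda>i. f 1 i + int p * e 0 1 i)" by (auto simp: f_def e_def fun_eq_iff)
    then have "w \<simeq> (\<lambda>i. F (f 1) i + F (\<lambda>i. int p * e 0 1 i) i)"
      using F_add[of "f 1" "\<lambda>i. int p * e 0 1 i"] pf[of 1] g lt by (simp add: w_def good_def)
    also have "\<dots> \<simeq> (\<lambda>i. (w \<circ> swp 0 1) i + T j 0 (\<lambda>i. int p * e 0 1 i) i)"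
      using g by (intro eqv_add f1) (simp add: good_def)
    finally have "w \<simeq> (\<lambda>i. (w \<circ> swp 0 1) i + T j 0 (\<lambda>i. int p * e 0 1 i) i)" .
    from eqv_diff_const[OF this lt(1,3)] show ?thesis by (simp add: T_def e_def b_def algebra_simps)
  qed
  have w: "w \<simeq> (\<lambda>i. j * f 0 i + b)"
  proof (rule eqvI0)
    fix i assume "i < n"
    then show "int r dvd w i - (j * f 0 i + b)"
      using w0 wb[of i] by (cases "i = 0") (simp_all add: f_def algebra_simps)
  qed
  have bn: "int p dvd b * int n"
  proof -
    have "int p dvd Delta n (\<lambda>i. j * f 0 i + b)"
      using F_Delta[OF pf[of 0]] p_dvd_Delta_eqv[OF w] lt by (simp add: w_def)
    also have "Delta n (\<lambda>i. j * f 0 i + b) = j * int p + b * int n"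
      using lt by (simp add: Delta_add Delta_mult Delta_const f_def Delta_single)
    finally show ?thesis by (metis dvd_add_right_iff dvd_triv_right)
  qed
  \<comment> \<open>With r = p r' the vector r' p e_0 is trivial, so d divides r' b. Multiplying by
    p q and cancelling p r' leaves p | b q.\<close>
  have bq: "int p dvd b * int q"
  proof -
    obtain r' where r': "int r = int p * r'" using pr by (metis dvdE of_nat_mult)
    have "0 < int p * r'" using r0 unfolding r'[symmetric] by simp
    then have "r' > 0" using p0 by (simp add: zero_less_mult_iff)
    have f0: "(\<lambda>i. r' * f 0 i) \<simeq> (\<lambda>_. 0)" by (rule eqvI0) (simp add: f_def r')
    have "(\<lambda>i. r' * w i) \<simeq> F (\<lambda>i. r' * f 0 i)" unfolding w_def using lt by (intro eqv_sym[OF F_scale] pf)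
    also have "\<dots> \<simeq> F (\<lambda>_. 0)"
      using pf[of 0] lt f0 by (intro F_eqv) (simp_all add: Delta_mult Delta_const)
    also have "\<dots> \<simeq> (\<lambda>_. 0)" by (rule F_zero)
    finally have "(\<lambda>i. r' * w i) \<simeq> (\<lambda>_. 0)" .
    from eqv_dvd[OF this lt(2)] have "d dvd r' * b" by (simp add: b_def)
    then have "int p * (int q * d) dvd int p * (int q * (r' * b))" by (simp add: mult_dvd_mono)
    then have "r' * int p * int p dvd r' * int p * (b * int q)"
      unfolding r_eq[symmetric] r' by (simp add: ac_simps)
    then show ?thesis using \<open>r' > 0\<close> p0 by simp
  qed
  have dvd_gcd: "int p dvd b * gcd x y" if "int p dvd b * x" "int p dvd b * y" for x y
  proof -
    obtain s t where st: "s * x + t * y = gcd x y" using bezout_int[of x y] by blast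
    have "b * gcd x y = s * (b * x) + t * (b * y)" unfolding st[symmetric] by (simp only: algebra_simps)
    then show ?thesis using that by simp
  qed
  have "int p dvd b * gcd (int p) (gcd (int q) (int n))" using bq bn by (intro dvd_gcd) simp_all
  then have "int p dvd b * d0" by (simp add: d0_def)
  obtain p' where p': "int p = d0 * p'" using d0_dvd(1) by blast
  then have "d0 * p' dvd d0 * b" using \<open>int p dvd b * d0\<close> by (simp add: mult.commute)
  then have "p' dvd b" using d0_pos by simp
  then obtain k where k: "b = p' * k" by blast
  have gf: "good j k (f 0)"
    using w pf[of 0] lt d0_pos by (simp add: good_def w_def T_def f_def Delta_single p' k)
  have "F x \<simeq> T j k x" if x: "int p dvd Delta n x" for x
  proof -
    obtain m where m: "Delta n x = int p * m" using x by blast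
    \<comment> \<open>A vector x with coordinate sum p m is the combination of the roots e_a - e_0
      with coefficients x_a, corrected by m p at coordinate 0.\<close>
    have "good j k (\<lambda>i. (\<Sum>a<n. x a * e a 0 i) + m * f 0 i)"
      using lt by (intro good_add good_scale good_sum gf je) simp_all
    moreover have "(\<Sum>a<n. x a * e a 0 i) + m * f 0 i = x i" if "i < n" for i
    proof -
      have "x a * e a 0 i = (if i = a then x a else 0) - (if i = 0 then x a else 0)" for a
        by (simp add: e_def)
      then have "(\<Sum>a<n. x a * e a 0 i) = (\<Sum>a<n. if i = a then x a else 0) - (\<Sum>a<n. if i = 0 then x a else 0)"
        by (simp only: sum_subtractf)
      also have "\<dots> = x i - (if i = 0 then Delta n x else 0)"
        using that by (simp add: Delta_def)
      finally show ?thesis by (simp add: f_def m)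
    qed
    ultimately have "good j k x" by (rule good_eqv[OF _ eqv_cong])
    then show ?thesis by (simp add: good_def)
  qed
  then show ?thesis by blast
qed

end

section \<open>One-cocycles of the symmetric group\<close>

text \<open>This is the product rule \<open>elt_mult\<close>, read on the images of permutation
  matrices under an automorphism that induces the identity on S_n.\<close>

locale cocycle = grpqn_params +
  fixes Y :: "(nat \<Rightarrow> nat) \<Rightarrow> nat \<Rightarrow> int"
  assumes Y_comp: "\<pi> permutes {..<n} \<Longrightarrow> \<sigma> permutes {..<n} \<Longrightarrow>
      Y (\<pi> \<circ> \<sigma>) \<simeq> (\<lambda>i. Y \<pi> (\<sigma> i) + Y \<sigma> i)"
begin

definition y :: "nat \<Rightarrow> nat \<Rightarrow> int" where
  "y i = Y (swp i (Suc i))"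

lemma Y_id: "Y id \<simeq> (\<lambda>_. 0)"
proof -
  have "Y id \<simeq> (\<lambda>i. Y id i + Y id i)" using Y_comp[of id id] by simp
  from eqv_diff[OF this eqv_refl[of "Y id"]] show ?thesis by (simp add: eqv_sym)
qed

lemma Y_involution:
  assumes "s permutes {..<n}" "s \<circ> s = id"
  shows "(\<lambda>i. Y s (s i) + Y s i) \<simeq> (\<lambda>_. 0)"
  using eqv_trans[OF eqv_sym[OF Y_comp[OF assms(1,1)]]] Y_id unfolding assms(2) .

lemma Y_commute:
  assumes "s permutes {..<n}" "t permutes {..<n}" "s \<circ> t = t \<circ> s"
  shows "(\<lambda>i. Y s (t i) + Y t i) \<simeq> (\<lambda>i. Y t (s i) + Y s i)"
  using eqv_trans[OF eqv_sym[OF Y_comp[OF assms(1,2)]]] Y_comp[OF assms(2,1)] unfolding assms(3) .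

lemma Y_comp3:
  assumes "s permutes {..<n}" "t permutes {..<n}"
  shows "Y (s \<circ> t \<circ> s) \<simeq> (\<lambda>i. Y s (t (s i)) + Y t (s i) + Y s i)"
proof -
  have "Y (s \<circ> t \<circ> s) \<simeq> (\<lambda>i. (Y (s \<circ> t) \<circ> s) i + Y s i)"
    using Y_comp[OF permutes_compose[OF assms(2,1)] assms(1)] by simp
  also have "\<dots> \<simeq> (\<lambda>i. ((\<lambda>i. Y s (t i) + Y t i) \<circ> s) i + Y s i)"
    by (intro eqv_add eqv_refl eqv_permute Y_comp assms)
  finally show ?thesis by simp
qed

lemma Y_braid:
  assumes "s permutes {..<n}" "t permutes {..<n}" "s \<circ> t \<circ> s = t \<circ> s \<circ> t"
  shows "(\<lambda>i. Y s (t (s i)) + Y t (s i) + Y s i) \<simeq> (\<lambda>i. Y t (s (t i)) + Y s (t i) + Y t i)"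
  using eqv_trans[OF eqv_sym[OF Y_comp3[OF assms(1,2)]]] Y_comp3[OF assms(2,1)] unfolding assms(3) .

lemma swp_perm: "Suc i < n \<Longrightarrow> swp i (Suc i) permutes {..<n}"
  by (rule permutes_swap_id) simp_all

lemma y_involution:
  assumes "Suc i < n"
  shows "(\<lambda>l. y i (swp i (Suc i) l) + y i l) \<simeq> (\<lambda>_. 0)"
  unfolding y_def using Y_involution[OF swp_perm[OF assms]] by simp

lemma y_braid:
  assumes "Suc (Suc i) < n"
  defines "s \<equiv> swp i (Suc i)" and "t \<equiv> swp (Suc i) (Suc (Suc i))"
  shows "(\<lambda>l. y i (t (s l)) + y (Suc i) (s l) + y i l) \<simeq>
    (\<lambda>l. y (Suc i) (s (t l)) + y i (t l) + y (Suc i) l)"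
proof -
  have "s \<circ> t \<circ> s = t \<circ> s \<circ> t"
  proof
    fix l
    consider "l = i" | "l = Suc i" | "l = Suc (Suc i)" | "l \<noteq> i" "l \<noteq> Suc i" "l \<noteq> Suc (Suc i)" by blast
    then show "(s \<circ> t \<circ> s) l = (t \<circ> s \<circ> t) l" by cases (simp_all add: s_def t_def)
  qed
  then show ?thesis unfolding y_def s_def t_def using assms(1) by (intro Y_braid swp_perm) simp_all
qed

text \<open>At coordinate i every other term occurs on both sides of the braid relation.\<close>

lemma y_braid_dvd:
  assumes "Suc (Suc i) < n" shows "d dvd y i (Suc (Suc i)) - y (Suc i) i"
  using eqv_dvd[OF y_braid[OF assms], of i] assms by simp

text \<open>Outside i and i+1 the vector \<open>y i\<close> is constant up to the deviation
  \<open>h i\<close>; \<open>o' i\<close> is a reference coordinate there, with value g i. The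
  entries at i and i+1 add up to 2 g i, so their deviation from g i is a coboundary. The values g i
  agree modulo \<open>d\<close>, so one \<gamma> serves all generators.\<close>

lemma y_assemble:
  assumes o: "\<And>i. Suc i < n \<Longrightarrow> o' i < n \<and> o' i \<noteq> i \<and> o' i \<noteq> Suc i"
    and off: "\<And>i l. Suc i < n \<Longrightarrow> l < n \<Longrightarrow> l \<noteq> i \<Longrightarrow> l \<noteq> Suc i \<Longrightarrow> int r dvd y i l - y i (o' i) - h i l"
    and h: "\<And>i. h i i = 0" "\<And>i. h i (Suc i) = 0"
    and step: "\<And>i. Suc (Suc i) < n \<Longrightarrow> d dvd y i (o' i) - y (Suc i) (o' (Suc i))"
  shows "\<exists>\<beta> \<gamma>. d dvd 2 * \<gamma> \<and>
    (\<forall>i. Suc i < n \<longrightarrow> y i \<simeq> (\<lambda>l. \<gamma> + h i l + (\<beta> (swp i (Suc i) l) - \<beta> l)))"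
proof (intro exI conjI allI impI)
  define g where "g i = y i (o' i)" for i
  \<comment> \<open>Telescoping: the increment of \<beta> from i to i+1 is the excess of
    \<open>y i i\<close> over g i.\<close>
  define \<beta> where "\<beta> l = (\<Sum>k<l. y k k - g k)" for l :: nat
  have sum: "int r dvd y i i + y i (Suc i) - 2 * g i" if "Suc i < n" for i
    using eqv_diff_const[OF y_involution[OF that], of i "o' i"] o[OF that] that by (simp add: g_def algebra_simps)
  have "Suc 0 < n" using n3 by simp
  then show "d dvd 2 * g 0"
    using eqv_dvd[OF y_involution, of 0 "o' 0"] o[of 0] by (simp add: g_def)
  have gg: "d dvd g 0 - g i" if "Suc i < n" for i
    using that
  proof (induction i)
    case (Suc i)
    then have "d dvd (g 0 - g i) + (g i - g (Suc i))" using step[of i] by (intro dvd_add) (simp_all add: g_def)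
    then show ?case by simp
  qed simp
  fix i assume i: "Suc i < n"
  let ?b = "\<lambda>l. \<beta> (swp i (Suc i) l) - \<beta> l"
  have "y i \<simeq> (\<lambda>l. g i + h i l + ?b l)"
  proof (rule eqvI0)
    fix l assume l: "l < n"
    consider "l = i" | "l = Suc i" | "l \<noteq> i" "l \<noteq> Suc i" by blast
    then show "int r dvd y i l - (g i + h i l + ?b l)"
    proof cases
      case 1 then show ?thesis by (simp add: h \<beta>_def)
    next
      case 2
      have "y i (Suc i) - (g i + h i (Suc i) + ?b (Suc i)) = y i i + y i (Suc i) - 2 * g i"
        by (simp add: h \<beta>_def)
      then show ?thesis using sum[OF i] 2 by metis
    next
      case 3
      then show ?thesis using off[OF i l 3] by (simp add: g_def algebra_simps)
    qed
  qed
  also have "(\<lambda>l. g i + h i l + ?b l) \<simeq> (\<lambda>l. g 0 + h i l + ?b l)"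
    using gg[OF i] by (intro eqv_add eqv_refl eqv_const) (simp add: dvd_diff_commute)
  finally show "y i \<simeq> (\<lambda>l. g 0 + h i l + ?b l)" .
qed

text \<open>For n > 4 some coordinate l differs from i, i+1, a, b. The relation that s_i commutes
  with (a b) is exact at l, hence exact at b, where it compares the two values. For n = 3 only one
  coordinate lies outside i and i+1.\<close>

lemma y_const:
  assumes "n \<noteq> 4" "Suc i < n" "a < n" "b < n" "a \<noteq> i" "a \<noteq> Suc i" "b \<noteq> i" "b \<noteq> Suc i"
  shows "int r dvd y i a - y i b"
proof (cases "a = b \<or> n = 3")
  case True
  then have "a = b" using assms(2-) by linarith
  then show ?thesis by simp
next
  case False
  have "card {i, Suc i, a, b} \<le> 4" by (simp add: card_insert_if)
  also have "4 < card {..<n}" using False n3 assms(1) by simp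
  finally have "\<not> {..<n} \<subseteq> {i, Suc i, a, b}" by (metis card_mono finite.emptyI finite_insert linorder_not_le)
  then obtain l where l: "l < n" "l \<noteq> i" "l \<noteq> Suc i" "l \<noteq> a" "l \<noteq> b" by auto
  have t: "swp a b permutes {..<n}" using assms by (intro permutes_swap_id) simp_all
  have comm: "swp i (Suc i) \<circ> swp a b = swp a b \<circ> swp i (Suc i)"
    using assms(5-8) by (intro swap_id_independent) simp_all
  have "(\<lambda>l. y i (swp a b l) + Y (swp a b) l) \<simeq> (\<lambda>l. Y (swp a b) (swp i (Suc i) l) + y i l)"
    unfolding y_def by (intro Y_commute swp_perm assms(2) t comm)
  from eqv_exact[OF this, of l b] l assms show ?thesis by simp
qed

text \<open>Each generator has two remaining coordinates, and only the differences A, B, C of its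
  values there are under control. Modulo r, the involution gives 2A = 0, the braid relation of the
  first two generators A + B = 0, and commutation of the outer two A + C = 0. So all three are 0 or
  all are r/2.\<close>

lemma y_four:
  assumes "n = 4"
  obtains H where "H = 0 \<or> even q \<and> H = int (r div 2)" "d dvd H"
    "\<And>i. i < 3 \<Longrightarrow> int r dvd y i ((i + 2) mod 4) - y i ((i + 3) mod 4) - H"
proof -
  have num: "Suc 0 = 1" "Suc 1 = 2" "Suc 2 = 3" by simp_all
  have lt: "0 < n" "1 < n" "2 < n" "3 < n" using assms by simp_all
  define A where "A = y 0 2 - y 0 3"
  define B where "B = y 1 3 - y 1 0"
  define C where "C = y 2 0 - y 2 1"
  have AA: "int r dvd 2 * A"
    using eqv_diff_const[OF y_involution, of 0 2 3] lt by (simp add: num A_def algebra_simps)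
  have s0: "swp 0 1 permutes {..<n}" and s2: "swp 2 3 permutes {..<n}"
    using lt by (auto intro!: permutes_swap_id)
  have "swp 0 1 \<circ> swp 2 3 = swp 2 3 \<circ> swp 0 (1::nat)"
    by (rule swap_id_independent) simp_all
  from Y_commute[OF s0 s2 this]
  have comm: "(\<lambda>l. y 0 (swp 2 3 l) + y 2 l) \<simeq> (\<lambda>l. y 2 (swp 0 1 l) + y 0 l)"
    by (simp add: y_def num)
  from eqv_diff_const[OF comm, of 0 2] lt have AC: "int r dvd A + C" by (simp add: A_def C_def algebra_simps)
  \<comment> \<open>The same commutation relation at a single coordinate makes C, and with it A, a
    multiple of \<open>d\<close>. If A is r/2 modulo r, this forces q to be even.\<close>
  from eqv_dvd[OF comm, of 0] lt have dC: "d dvd C" by (simp add: C_def)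
  from eqv_diff_const[OF y_braid[of 0], of 0 3] lt have AB: "int r dvd A + B"
    by (simp add: num A_def B_def algebra_simps)
  note result = that
  \<comment> \<open>Signs are immaterial, since 2H = 0 modulo r; so B and C, which equal -A, match H
    as soon as A does.\<close>
  have *: thesis if H: "H = 0 \<or> even q \<and> H = int (r div 2)" "d dvd H" "int r dvd 2 * H" "int r dvd A - H" for H
  proof (rule result[OF H(1,2)])
    fix i :: nat assume "i < 3"
    then consider "i = 0" | "i = 1" | "i = 2" by linarith
    then show "int r dvd y i ((i + 2) mod 4) - y i ((i + 3) mod 4) - H"
    proof cases
      case 1 then show ?thesis using H(4) by (simp add: A_def num)
    next
      case 2
      have "int r dvd (A + B) - (A - H) - 2 * H" using dvd_diff[OF dvd_diff[OF AB H(4)] H(3)] .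
      then show ?thesis using 2 by (simp add: B_def num)
    next
      case 3
      have "int r dvd (A + C) - (A - H) - 2 * H" using dvd_diff[OF dvd_diff[OF AC H(4)] H(3)] .
      then show ?thesis using 3 by (simp add: C_def num)
    qed
  qed
  show thesis
  proof (cases "int r dvd A")
    case True then show thesis by (intro *[of 0]) simp_all
  next
    case False
    obtain m where m: "2 * A = int r * m" using AA by blast
    have "odd m"
    proof
      assume "even m" then obtain m' where "m = 2 * m'" by blast
      with m have "A = int r * m'" by simp
      with False show False by simp
    qed
    have "even (int r)" using m \<open>odd m\<close> by (metis dvd_triv_left even_mult_iff)
    then obtain h where h: "r = 2 * h" by auto
    obtain m' where m': "m = 2 * m' + 1" using \<open>odd m\<close> by (rule oddE)
    have A: "A = int h + int r * m'" using m by (simp add: h m' algebra_simps)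
    have "d dvd (A + C) - C - int r * m'"
      using dvd_trans[OF d_dvd_r AC] dC d_dvd_r by (intro dvd_diff) simp_all
    then have dh: "d dvd int h" by (simp add: A)
    then obtain t where t: "int h = d * t" by blast
    have "int r = 2 * int h" by (simp add: h)
    then have "d * int q = d * (2 * t)" using r_eq t by (simp add: mult.commute mult.left_commute)
    then have "int q = 2 * t" using d_pos by simp
    then have "even (int q)" by (metis dvd_triv_left)
    then have "even q" by simp
    then show thesis using dh by (intro *[of "int h"]) (simp_all add: h A)
  qed
qed

theorem Y_classification:
  "\<exists>\<beta> \<gamma> H. d dvd 2 * \<gamma> \<and> (H = 0 \<or> n = 4 \<and> even q \<and> H = int (r div 2)) \<and>
    (\<forall>i. Suc i < n \<longrightarrow> Y (swp i (Suc i)) \<simeq>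
      (\<lambda>l. \<gamma> + (if l = (i + 2) mod 4 then H else 0) + (\<beta> (swp i (Suc i) l) - \<beta> l)))"
proof (cases "n = 4")
  case False
  \<comment> \<open>Any coordinate outside i and i+1 will do; 2 is available for i = 0 because n is
    at least 3.\<close>
  define o' where "o' i = (if i = 0 then 2 else (0::nat))" for i :: nat
  have o: "o' i < n \<and> o' i \<noteq> i \<and> o' i \<noteq> Suc i" if "Suc i < n" for i
    using n3 by (auto simp: o'_def)
  have "\<exists>\<beta> \<gamma>. d dvd 2 * \<gamma> \<and> (\<forall>i. Suc i < n \<longrightarrow> y i \<simeq> (\<lambda>l. \<gamma> + 0 + (\<beta> (swp i (Suc i) l) - \<beta> l)))"
  proof (rule y_assemble[where o' = o'])
    fix i assume i: "Suc (Suc i) < n"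
    have "int r dvd y i (o' i) - y i (Suc (Suc i))"
      using False o[of i] i by (intro y_const) simp_all
    moreover have "int r dvd y (Suc i) i - y (Suc i) (o' (Suc i))"
      using False o[of "Suc i"] i by (intro y_const) simp_all
    ultimately have "d dvd (y i (o' i) - y i (Suc (Suc i))) + (y i (Suc (Suc i)) - y (Suc i) i)
        + (y (Suc i) i - y (Suc i) (o' (Suc i)))"
      using y_braid_dvd[OF i] d_dvd_r by (intro dvd_add) (auto intro: dvd_trans)
    then show "d dvd y i (o' i) - y (Suc i) (o' (Suc i))" by simp
  qed (use o y_const False in simp_all)
  then obtain \<beta> \<gamma> where "d dvd 2 * \<gamma>"
    "\<forall>i. Suc i < n \<longrightarrow> y i \<simeq> (\<lambda>l. \<gamma> + 0 + (\<beta> (swp i (Suc i) l) - \<beta> l))" by blast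
  then show ?thesis by (intro exI[of _ \<beta>] exI[of _ \<gamma>] exI[of _ 0]) (simp add: y_def)
next
  case True
  obtain H where H: "H = 0 \<or> even q \<and> H = int (r div 2)" "d dvd H"
    "\<And>i. i < 3 \<Longrightarrow> int r dvd y i ((i + 2) mod 4) - y i ((i + 3) mod 4) - H"
    using y_four[OF True] by blast
  define h where "h i l = (if l = (i + 2) mod 4 then H else 0)" for i l :: nat
  \<comment> \<open>Outside i and i+1 lie i+2 and i+3 modulo 4. With the latter as reference, H sits
    at the former, as in t_{i+2}. The reference of i+1 is then i, the coordinate occurring in
    \<open>y_braid_dvd\<close>.\<close>
  have "\<exists>\<beta> \<gamma>. d dvd 2 * \<gamma> \<and> (\<forall>i. Suc i < n \<longrightarrow> y i \<simeq> (\<lambda>l. \<gamma> + h i l + (\<beta> (swp i (Suc i) l) - \<beta> l)))"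
  proof (rule y_assemble[where o' = "\<lambda>i. (i + 3) mod 4"])
    fix i assume i: "Suc (Suc i) < n"
    then have "i < 3" using True by simp
    have "(i + 2) mod 4 = Suc (Suc i)" "(Suc i + 3) mod 4 = i" using i True by simp_all
    moreover from this have "d dvd y i (Suc (Suc i)) - y i ((i + 3) mod 4) - H"
      using dvd_trans[OF d_dvd_r H(3)[OF \<open>i < 3\<close>]] by simp
    note dvd_diff[OF dvd_diff[OF y_braid_dvd[OF i] this] H(2)]
    ultimately show "d dvd y i ((i + 3) mod 4) - y (Suc i) ((Suc i + 3) mod 4)" by simp
  next
    fix i assume "Suc i < n"
    then consider "i = 0" | "i = 1" | "i = 2" using True by linarith
    then show "(i + 3) mod 4 < n \<and> (i + 3) mod 4 \<noteq> i \<and> (i + 3) mod 4 \<noteq> Suc i"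
      using True by cases simp_all
  next
    fix i l assume il: "Suc i < n" "l < n" "l \<noteq> i" "l \<noteq> Suc i"
    have "i < 3" using il True by simp
    then have "l = (i + 2) mod 4 \<or> l = (i + 3) mod 4 \<and> l \<noteq> (i + 2) mod 4"
    proof -
      have "l = 0 \<or> l = 1 \<or> l = 2 \<or> l = 3" "i = 0 \<or> i = 1 \<or> i = 2"
        using il True by linarith+
      then show ?thesis using il(3,4) by (elim disjE) simp_all
    qed
    then show "int r dvd y i l - y i ((i + 3) mod 4) - h i l"
      using H(3)[OF \<open>i < 3\<close>] by (elim disjE) (simp_all add: h_def)
  next
    fix i :: nat
    have "i \<noteq> (i + 2) mod 4" "Suc i \<noteq> (i + 2) mod 4" by presburger+
    then show "h i i = 0" "h i (Suc i) = 0" by (simp_all add: h_def)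
  qed
  then obtain \<beta> \<gamma> where "d dvd 2 * \<gamma>"
    "\<forall>i. Suc i < n \<longrightarrow> y i \<simeq> (\<lambda>l. \<gamma> + h i l + (\<beta> (swp i (Suc i) l) - \<beta> l))" by blast
  then show ?thesis using H(1) True
    by (intro exI[of _ \<beta>] exI[of _ \<gamma>] exI[of _ H]) (simp add: y_def h_def)
qed

end

section \<open>Monomial matrices in coordinates\<close>

lemma zeta_nonzero [simp]: "zeta r \<noteq> 0"
  by (simp add: zeta_def)

lemma zeta_powi: "zeta r powi k = cis (2 * pi * real_of_int k / real r)"
proof -
  have "zeta r = cis (2 * pi / real r)"
    by (simp add: zeta_def cis_conv_exp mult.commute)
  then show ?thesis by (simp add: cis_power_int mult.commute)
qed

lemma zeta_power_eq_one:
  assumes "r > 0" shows "zeta r ^ r = 1"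
proof -
  have "zeta r ^ r = zeta r powi int r" by simp
  also have "\<dots> = cis (2 * pi)" unfolding zeta_powi using assms by simp
  also have "\<dots> = 1" by (simp add: complex_eq_iff)
  finally show ?thesis .
qed

lemma zeta_powi_eq_one_iff:
  assumes "r > 0" shows "zeta r powi k = 1 \<longleftrightarrow> int r dvd k"
proof
  assume "int r dvd k"
  then obtain m where "k = int r * m" by blast
  then have "zeta r powi k = (zeta r powi int r) powi m" by (simp only: power_int_mult)
  then show "zeta r powi k = 1" using zeta_power_eq_one[OF assms] by simp
next
  assume 1: "zeta r powi k = 1"
  define l where "l = nat (k mod int r)"
  have l: "int l = k mod int r" "l < r" using assms by (simp_all add: l_def nat_less_iff)
  have "zeta r powi k = zeta r powi (int r * (k div int r) + int l)" using l by simp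
  also have "\<dots> = (zeta r powi int r) powi (k div int r) * zeta r powi int l"
    by (simp only: power_int_add power_int_mult zeta_nonzero not_False_eq_True simp_thms)
  also have "\<dots> = zeta r powi int l" using zeta_power_eq_one[OF assms] by simp
  finally have "zeta r powi int l = 1" using 1 by simp
  then have "cis (2 * pi * real l / real r) = cis (2 * pi * real 0 / real r)"
    unfolding zeta_powi by simp
  then have "l = 0" using inj_onD[OF bij_betw_imp_inj_on[OF bij_betw_roots_unity[OF assms]], of l 0] l(2) assms
    by simp
  then show "int r dvd k" using l by (simp add: dvd_eq_mod_eq_0)
qed

lemma zeta_powi_eq_iff:
  assumes "r > 0" shows "zeta r powi a = zeta r powi b \<longleftrightarrow> int r dvd a - b"
  using zeta_powi_eq_one_iff[OF assms, of "a - b"] by (simp add: power_int_diff)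

lemma root_of_unity_eq_zeta_powi:
  assumes "r > 0" "z ^ r = 1" obtains k where "z = zeta r powi k"
proof -
  have "z \<in> (\<lambda>k. cis (2 * pi * real k / real r)) ` {..<r}"
    using bij_betw_imp_surj_on[OF bij_betw_roots_unity[OF assms(1)]] assms(2) by simp
  then obtain k where "z = cis (2 * pi * real k / real r)" by blast
  then have "z = zeta r powi int k" by (simp only: zeta_powi of_int_of_nat_eq)
  then show thesis by (rule that)
qed

lemma elt_carrier [simp]: "elt r n \<pi> x \<in> carrier_mat n n"
  and elt_dim [simp]: "dim_row (elt r n \<pi> x) = n" "dim_col (elt r n \<pi> x) = n"
  by (simp_all add: elt_def)

lemma elt_index: "a < n \<Longrightarrow> i < n \<Longrightarrow> elt r n \<pi> x $$ (a, i) = (if a = \<pi> i then zeta r powi x i else 0)"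
  by (simp add: elt_def)

lemma elt_mult:
  assumes "\<sigma> permutes {..<n}"
  shows "elt r n \<pi> x * elt r n \<sigma> y = elt r n (\<pi> \<circ> \<sigma>) (\<lambda>i. x (\<sigma> i) + y i)"
proof (rule eq_matI)
  fix a i assume "a < dim_row (elt r n (\<pi> \<circ> \<sigma>) (\<lambda>i. x (\<sigma> i) + y i))"
    "i < dim_col (elt r n (\<pi> \<circ> \<sigma>) (\<lambda>i. x (\<sigma> i) + y i))"
  then have ai: "a < n" "i < n" by simp_all
  have s: "\<sigma> i < n" using permutes_in_image[OF assms] ai by simp
  have "(elt r n \<pi> x * elt r n \<sigma> y) $$ (a, i) = (\<Sum>k = 0..<n. elt r n \<pi> x $$ (a, k) * elt r n \<sigma> y $$ (k, i))"
    using ai by (simp add: scalar_prod_def)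
  also have "\<dots> = (\<Sum>k = 0..<n. if k = \<sigma> i then elt r n \<pi> x $$ (a, \<sigma> i) * zeta r powi y i else 0)"
    using ai by (intro sum.cong) (auto simp: elt_index)
  also have "\<dots> = elt r n \<pi> x $$ (a, \<sigma> i) * zeta r powi y i" using s by simp
  finally show "(elt r n \<pi> x * elt r n \<sigma> y) $$ (a, i) = elt r n (\<pi> \<circ> \<sigma>) (\<lambda>i. x (\<sigma> i) + y i) $$ (a, i)"
    using ai s by (simp add: elt_index power_int_add)
qed simp_all

lemma elt_eq_iff:
  assumes "r > 0" "\<pi> permutes {..<n}" "\<sigma> permutes {..<n}"
  shows "elt r n \<pi> x = elt r n \<sigma> y \<longleftrightarrow> \<pi> = \<sigma> \<and> (\<forall>i<n. int r dvd x i - y i)"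
proof
  assume eq: "elt r n \<pi> x = elt r n \<sigma> y"
  have *: "\<pi> i = \<sigma> i \<and> int r dvd x i - y i" if i: "i < n" for i
  proof -
    have s: "\<pi> i < n" using permutes_in_image[OF assms(2)] i by simp
    have "elt r n \<pi> x $$ (\<pi> i, i) = elt r n \<sigma> y $$ (\<pi> i, i)" by (simp only: eq)
    then show ?thesis using i s zeta_powi_eq_iff[OF assms(1)]
      by (auto simp: elt_index split: if_splits)
  qed
  moreover have "\<pi> i = \<sigma> i" if "\<not> i < n" for i
    using assms(2,3) that by (metis lessThan_iff permutes_not_in)
  ultimately show "\<pi> = \<sigma> \<and> (\<forall>i<n. int r dvd x i - y i)" by (auto simp: fun_eq_iff)
next
  assume "\<pi> = \<sigma> \<and> (\<forall>i<n. int r dvd x i - y i)"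
  then show "elt r n \<pi> x = elt r n \<sigma> y"
    by (intro eq_matI) (auto simp: elt_index zeta_powi_eq_iff[OF assms(1)])
qed

lemma one_eq_elt: "1\<^sub>m n = elt r n id (\<lambda>_. 0)"
  by (rule eq_matI) (auto simp: elt_index)

lemma cmat_eq_elt: "cmat r n = elt r n id (\<lambda>_. 1)"
  by (rule eq_matI) (auto simp: elt_index cmat_def)

lemma diagonal_elt_iff:
  assumes "\<pi> permutes {..<n}"
  shows "diagonal_mat (elt r n \<pi> x) \<longleftrightarrow> \<pi> = id"
proof
  assume d: "diagonal_mat (elt r n \<pi> x)"
  have "\<pi> i = i" for i
  proof (cases "i < n")
    case True
    then have "\<pi> i < n" using permutes_in_image[OF assms] by simp
    show ?thesis
    proof (rule ccontr)
      assume "\<pi> i \<noteq> i"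
      then have "elt r n \<pi> x $$ (\<pi> i, i) = 0" using d True \<open>\<pi> i < n\<close> by (simp add: diagonal_mat_def)
      then show False using True \<open>\<pi> i < n\<close> by (simp add: elt_index)
    qed
  next
    case False then show ?thesis using assms by (simp add: permutes_not_in)
  qed
  then show "\<pi> = id" by (simp add: fun_eq_iff)
qed (auto simp: diagonal_mat_def elt_index)

lemma Grn_mult [simp]: "A \<otimes>\<^bsub>Grn r n\<^esub> B = A * B"
  and Grn_one [simp]: "\<one>\<^bsub>Grn r n\<^esub> = 1\<^sub>m n"
  and Grpn_mult [simp]: "A \<otimes>\<^bsub>Grpn r p n\<^esub> B = A * B"
  and Grpn_one [simp]: "\<one>\<^bsub>Grpn r p n\<^esub> = 1\<^sub>m n"
  by (simp_all add: Grn_def Grpn_def)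

lemma carrier_Grn:
  assumes "r > 0"
  shows "carrier (Grn r n) = {elt r n \<pi> x | \<pi> x. \<pi> permutes {..<n}}"
proof (intro equalityI subsetI)
  fix A assume "A \<in> {elt r n \<pi> x | \<pi> x. \<pi> permutes {..<n}}"
  then obtain \<pi> x where A: "A = elt r n \<pi> x" and \<pi>: "\<pi> permutes {..<n}" by blast
  have nz: "A $$ (a, i) \<noteq> 0 \<longleftrightarrow> a = \<pi> i" if "a < n" "i < n" for a i
    using that by (simp add: A elt_index)
  have "\<exists>!j. j < n \<and> A $$ (i, j) \<noteq> 0" if "i < n" for i
  proof (rule ex1I[of _ "pinv \<pi> i"])
    have "pinv \<pi> i < n" using permutes_in_image[OF permutes_inv[OF \<pi>]] that by simp
    then show "pinv \<pi> i < n \<and> A $$ (i, pinv \<pi> i) \<noteq> 0"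
      using that by (simp add: nz permutes_inverses[OF \<pi>])
    show "j = pinv \<pi> i" if "j < n \<and> A $$ (i, j) \<noteq> 0" for j
    proof -
      have "i = \<pi> j" using that \<open>i < n\<close> nz by blast
      then show ?thesis by (simp add: permutes_inverses[OF \<pi>])
    qed
  qed
  moreover have "\<exists>!i. i < n \<and> A $$ (i, j) \<noteq> 0" if "j < n" for j
  proof (rule ex1I[of _ "\<pi> j"])
    show "\<pi> j < n \<and> A $$ (\<pi> j, j) \<noteq> 0"
      using that permutes_in_image[OF \<pi>] by (simp add: nz)
    show "i = \<pi> j" if "i < n \<and> A $$ (i, j) \<noteq> 0" for i
      using that \<open>j < n\<close> nz by blast
  qed
  moreover have "(A $$ (i, j)) ^ r = 1" if "i < n" "j < n" "A $$ (i, j) \<noteq> 0" for i j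
  proof -
    have "A $$ (i, j) = zeta r powi x j" using that by (simp add: A elt_index split: if_splits)
    moreover have "(zeta r powi x j) ^ r = (zeta r ^ r) powi x j"
      by (metis mult.commute power_int_mult power_int_of_nat)
    ultimately show ?thesis using zeta_power_eq_one[OF assms] by simp
  qed
  ultimately show "A \<in> carrier (Grn r n)" by (simp add: Grn_def A)
next
  fix A assume "A \<in> carrier (Grn r n)"
  then have A: "A \<in> carrier_mat n n"
    and row: "\<And>i. i < n \<Longrightarrow> \<exists>!j. j < n \<and> A $$ (i, j) \<noteq> 0"
    and col: "\<And>j. j < n \<Longrightarrow> \<exists>!i. i < n \<and> A $$ (i, j) \<noteq> 0"
    and root: "\<And>i j. i < n \<Longrightarrow> j < n \<Longrightarrow> A $$ (i, j) \<noteq> 0 \<Longrightarrow> (A $$ (i, j)) ^ r = 1"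
    by (simp_all add: Grn_def)
  \<comment> \<open>The permutation is read off the columns; it is the identity outside the matrix,
    as \<open>permutes\<close> requires.\<close>
  define \<pi> where "\<pi> j = (if j < n then (THE i. i < n \<and> A $$ (i, j) \<noteq> 0) else j)" for j
  have \<pi>: "\<pi> j < n" "A $$ (\<pi> j, j) \<noteq> 0" if "j < n" for j
    using theI'[OF col[OF that]] that by (simp_all add: \<pi>_def)
  have \<pi>u: "i = \<pi> j" if "i < n" "j < n" "A $$ (i, j) \<noteq> 0" for i j
    using col[OF that(2)] \<pi>[OF that(2)] that by blast
  have "inj_on \<pi> {..<n}"
  proof (rule inj_onI)
    fix i j assume "i \<in> {..<n}" "j \<in> {..<n}" "\<pi> i = \<pi> j"
    then have "\<pi> i < n" "i < n" "A $$ (\<pi> i, i) \<noteq> 0" "j < n" "A $$ (\<pi> i, j) \<noteq> 0"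
      using \<pi>[of i] \<pi>[of j] by simp_all
    then show "i = j" using row by blast
  qed
  then have perm: "\<pi> permutes {..<n}" using \<pi> by (intro inj_imp_permutes) (auto simp: \<pi>_def)
  have "\<exists>k. A $$ (\<pi> j, j) = zeta r powi k" if "j < n" for j
    using root_of_unity_eq_zeta_powi[OF assms root[OF \<pi>(1)[OF that] that \<pi>(2)[OF that]]] by blast
  then obtain x where x: "\<And>j. j < n \<Longrightarrow> A $$ (\<pi> j, j) = zeta r powi x j" by metis
  have "A = elt r n \<pi> x"
  proof (rule eq_matI)
    fix i j assume "i < dim_row (elt r n \<pi> x)" "j < dim_col (elt r n \<pi> x)"
    then have ij: "i < n" "j < n" by simp_all
    show "A $$ (i, j) = elt r n \<pi> x $$ (i, j)"
    proof (cases "i = \<pi> j")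
      case True then show ?thesis using x[OF ij(2)] ij by (simp add: elt_index)
    next
      case False then show ?thesis using \<pi>u[OF ij] ij by (simp add: elt_index) blast
    qed
  qed (use A in auto)
  then show "A \<in> {elt r n \<pi> x | \<pi> x. \<pi> permutes {..<n}}" using perm by blast
qed

section \<open>The quotient group in coordinates\<close>

lemma group_Grn:
  assumes "r > 0" shows "group (Grn r n)"
proof (rule groupI)
  fix A B assume "A \<in> carrier (Grn r n)" "B \<in> carrier (Grn r n)"
  then obtain \<pi> x \<sigma> y where "A = elt r n \<pi> x" "\<pi> permutes {..<n}" "B = elt r n \<sigma> y" "\<sigma> permutes {..<n}"
    unfolding carrier_Grn[OF assms] by blast
  then show "A \<otimes>\<^bsub>Grn r n\<^esub> B \<in> carrier (Grn r n)"
    unfolding carrier_Grn[OF assms] by (auto simp: elt_mult intro!: permutes_compose)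
next
  show "\<one>\<^bsub>Grn r n\<^esub> \<in> carrier (Grn r n)"
    unfolding carrier_Grn[OF assms] Grn_one one_eq_elt[of n r] using permutes_id by blast
next
  fix A B C assume "A \<in> carrier (Grn r n)" "B \<in> carrier (Grn r n)" "C \<in> carrier (Grn r n)"
  then have "A \<in> carrier_mat n n" "B \<in> carrier_mat n n" "C \<in> carrier_mat n n"
    unfolding carrier_Grn[OF assms] by auto
  then show "A \<otimes>\<^bsub>Grn r n\<^esub> B \<otimes>\<^bsub>Grn r n\<^esub> C = A \<otimes>\<^bsub>Grn r n\<^esub> (B \<otimes>\<^bsub>Grn r n\<^esub> C)"
    by simp
next
  fix A assume "A \<in> carrier (Grn r n)"
  then obtain \<pi> x where A: "A = elt r n \<pi> x" "\<pi> permutes {..<n}"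
    unfolding carrier_Grn[OF assms] by blast
  then show "\<one>\<^bsub>Grn r n\<^esub> \<otimes>\<^bsub>Grn r n\<^esub> A = A" by simp
  have "elt r n (pinv \<pi>) (\<lambda>i. - x (pinv \<pi> i)) * A = elt r n id (\<lambda>_. 0)"
    using A(2) by (simp add: A(1) elt_mult permutes_inverses(2) permutes_inv_o(2))
  moreover have "elt r n (pinv \<pi>) (\<lambda>i. - x (pinv \<pi> i)) \<in> carrier (Grn r n)"
    unfolding carrier_Grn[OF assms] using permutes_inv[OF A(2)] by blast
  ultimately show "\<exists>B\<in>carrier (Grn r n). B \<otimes>\<^bsub>Grn r n\<^esub> A = \<one>\<^bsub>Grn r n\<^esub>"
    by (auto simp: one_eq_elt[of n r])
qed

lemma elt_nat_pow: "elt r n id x [^]\<^bsub>Grn r n\<^esub> (k::nat) = elt r n id (\<lambda>i. int k * x i)"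
proof (induction k)
  case 0
  have "elt r n id x [^]\<^bsub>Grn r n\<^esub> (0::nat) = elt r n id (\<lambda>i. int 0 * x i)"
    by (simp add: one_eq_elt[of n r])
  then show ?case .
next
  case (Suc k)
  have "elt r n id x [^]\<^bsub>Grn r n\<^esub> k = elt r n id (\<lambda>i. int k * x i)" by (rule Suc)
  then have "elt r n id x [^]\<^bsub>Grn r n\<^esub> Suc k = elt r n id (\<lambda>i. int (Suc k) * x i)"
    by (simp add: elt_mult algebra_simps)
  then show ?case .
qed

lemma elt_int_pow:
  assumes "r > 0" shows "elt r n id x [^]\<^bsub>Grn r n\<^esub> (k::int) = elt r n id (\<lambda>i. k * x i)"
proof -
  interpret group "Grn r n" by (rule group_Grn[OF assms])
  have c: "elt r n id x \<in> carrier (Grn r n)" for x unfolding carrier_Grn[OF assms] using permutes_id by blast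
  show ?thesis
  proof (cases "k \<ge> 0")
    case True
    then show ?thesis using int_pow_int[of "Grn r n" "elt r n id x" "nat k"] elt_nat_pow[of r n x "nat k"] by simp
  next
    case False
    have "elt r n id x [^]\<^bsub>Grn r n\<^esub> k = inv\<^bsub>Grn r n\<^esub> (elt r n id x [^]\<^bsub>Grn r n\<^esub> (nat (-k)))"
      using int_pow_neg_int[OF c, of x "nat (-k)"] False by simp
    also have "\<dots> = elt r n id (\<lambda>i. k * x i)"
      using False by (intro inv_equality c) (simp_all add: elt_nat_pow elt_mult one_eq_elt[of n r] c)
    finally show ?thesis .
  qed
qed

context grpqn_params
begin

lemma Cq_eq: "Cq r q n = {elt r n id (\<lambda>_. m * d) | m. True}"
proof -
  interpret group "Grn r n" by (rule group_Grn[OF r0])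
  have c: "elt r n id x \<in> carrier (Grn r n)" for x unfolding carrier_Grn[OF r0] using permutes_id by blast
  have "cmat r n [^]\<^bsub>Grn r n\<^esub> (r div q) = elt r n id (\<lambda>_. d)"
    by (simp add: cmat_eq_elt elt_nat_pow d_def)
  then show ?thesis unfolding Cq_def using generate_pow[OF c, of "\<lambda>_. d"] by (simp add: elt_int_pow[OF r0])
qed

abbreviation E :: "(nat \<Rightarrow> nat) \<Rightarrow> (nat \<Rightarrow> int) \<Rightarrow> complex mat set" where
  "E \<pi> x \<equiv> proj r q n (elt r n \<pi> x)"

abbreviation G :: "complex mat set monoid" where
  "G \<equiv> Grpqn r p q n"

lemma proj_elt:
  assumes "\<pi> permutes {..<n}" shows "E \<pi> x = {elt r n \<pi> (\<lambda>i. x i + m * d) | m. True}"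
  unfolding proj_def r_coset_def Cq_eq using assms by (auto simp: elt_mult add.commute)

text \<open>The dictionary between cosets and vectors: from here on equality in the quotient is
  decided by \<open>\<simeq>\<close>, without matrices.\<close>

lemma E_eq_iff:
  assumes "\<pi> permutes {..<n}" "\<sigma> permutes {..<n}"
  shows "E \<pi> x = E \<sigma> y \<longleftrightarrow> \<pi> = \<sigma> \<and> x \<simeq> y"
proof
  assume eq: "E \<pi> x = E \<sigma> y"
  have "elt r n \<pi> (\<lambda>i. x i + 0 * d) \<in> E \<pi> x" unfolding proj_elt[OF assms(1)] by blast
  then obtain m where "elt r n \<pi> (\<lambda>i. x i + 0 * d) = elt r n \<sigma> (\<lambda>i. y i + m * d)"
    unfolding eq proj_elt[OF assms(2)] by blast
  then have "\<pi> = \<sigma>" and "\<forall>i<n. int r dvd x i + 0 * d - (y i + m * d)"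
    unfolding elt_eq_iff[OF r0 assms] by blast+
  then have "\<forall>i<n. int r dvd x i - y i - m * d" by (simp add: algebra_simps)
  then have "x \<simeq> y" by (intro eqvI[of _ _ m]) blast
  with \<open>\<pi> = \<sigma>\<close> show "\<pi> = \<sigma> \<and> x \<simeq> y" ..
next
  have sub: "E \<pi> x \<subseteq> E \<pi> y" if xy: "x \<simeq> y" for x y
  proof
    fix A assume "A \<in> E \<pi> x"
    then obtain l where A: "A = elt r n \<pi> (\<lambda>i. x i + l * d)" unfolding proj_elt[OF assms(1)] by blast
    obtain m where m: "\<forall>i<n. int r dvd x i - y i - m * d" using eqvD[OF xy] by blast
    have "x i + l * d - (y i + (l + m) * d) = x i - y i - m * d" for i by (simp add: algebra_simps)
    then have "A = elt r n \<pi> (\<lambda>i. y i + (l + m) * d)"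
      unfolding A elt_eq_iff[OF r0 assms(1) assms(1)] using m by (simp only: simp_thms)
    then show "A \<in> E \<pi> y" unfolding proj_elt[OF assms(1)] by blast
  qed
  assume "\<pi> = \<sigma> \<and> x \<simeq> y"
  then show "E \<pi> x = E \<sigma> y" using sub eqv_sym by blast
qed

lemma elt_mem_E_iff:
  assumes "\<pi> permutes {..<n}" "\<sigma> permutes {..<n}"
  shows "elt r n \<sigma> y \<in> E \<pi> x \<longleftrightarrow> \<sigma> = \<pi> \<and> y \<simeq> x"
proof
  assume "elt r n \<sigma> y \<in> E \<pi> x"
  then obtain m where "elt r n \<sigma> y = elt r n \<pi> (\<lambda>i. x i + m * d)" unfolding proj_elt[OF assms(1)] by blast
  then have "\<sigma> = \<pi>" and m: "\<forall>i<n. int r dvd y i - (x i + m * d)"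
    unfolding elt_eq_iff[OF r0 assms(2,1)] by blast+
  have "y \<simeq> x" using m by (intro eqvI[of _ _ m]) (simp add: algebra_simps)
  with \<open>\<sigma> = \<pi>\<close> show "\<sigma> = \<pi> \<and> y \<simeq> x" ..
next
  assume a: "\<sigma> = \<pi> \<and> y \<simeq> x"
  have "elt r n \<sigma> (\<lambda>i. y i + 0 * d) \<in> E \<sigma> y" unfolding proj_elt[OF assms(2)] by blast
  also have "E \<sigma> y = E \<pi> x" using a assms by (simp add: E_eq_iff)
  finally show "elt r n \<sigma> y \<in> E \<pi> x" by simp
qed

text \<open>The product in the quotient is a product of sets. Constant vectors are unaffected by
  permuting coordinates, so the two central factors merge into one.\<close>

lemma E_mult:
  assumes "\<pi> permutes {..<n}" "\<sigma> permutes {..<n}"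
  shows "E \<pi> x \<otimes>\<^bsub>G\<^esub> E \<sigma> y = E (\<pi> \<circ> \<sigma>) (\<lambda>i. x (\<sigma> i) + y i)"
proof -
  have comp: "\<pi> \<circ> \<sigma> permutes {..<n}" using assms by (intro permutes_compose)
  have prod: "elt r n \<pi> (\<lambda>i. x i + m * d) * elt r n \<sigma> (\<lambda>i. y i + l * d)
      = elt r n (\<pi> \<circ> \<sigma>) (\<lambda>i. x (\<sigma> i) + y i + (m + l) * d)" for m l
    unfolding elt_mult[OF assms(2)] by (simp add: algebra_simps)
  have "E \<pi> x \<otimes>\<^bsub>G\<^esub> E \<sigma> y = (\<Union>A \<in> E \<pi> x. \<Union>B \<in> E \<sigma> y. {A * B})"
    by (simp add: Grpqn_def FactGroup_def set_mult_def)
  also have "\<dots> = {elt r n (\<pi> \<circ> \<sigma>) (\<lambda>i. x (\<sigma> i) + y i + m * d) | m. True}"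
  proof (intro equalityI subsetI)
    fix C assume "C \<in> (\<Union>A \<in> E \<pi> x. \<Union>B \<in> E \<sigma> y. {A * B})"
    then obtain m l where "C = elt r n \<pi> (\<lambda>i. x i + m * d) * elt r n \<sigma> (\<lambda>i. y i + l * d)"
      unfolding proj_elt[OF assms(1)] proj_elt[OF assms(2)] by blast
    then show "C \<in> {elt r n (\<pi> \<circ> \<sigma>) (\<lambda>i. x (\<sigma> i) + y i + m * d) | m. True}"
      unfolding prod by blast
  next
    fix C assume "C \<in> {elt r n (\<pi> \<circ> \<sigma>) (\<lambda>i. x (\<sigma> i) + y i + m * d) | m. True}"
    then obtain m where "C = elt r n (\<pi> \<circ> \<sigma>) (\<lambda>i. x (\<sigma> i) + y i + (m + 0) * d)" by auto
    then have "C = elt r n \<pi> (\<lambda>i. x i + m * d) * elt r n \<sigma> (\<lambda>i. y i + 0 * d)" by (simp only: prod)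
    then show "C \<in> (\<Union>A \<in> E \<pi> x. \<Union>B \<in> E \<sigma> y. {A * B})"
      unfolding proj_elt[OF assms(1)] proj_elt[OF assms(2)] by blast
  qed
  finally show ?thesis unfolding proj_elt[OF comp] .
qed

lemma carrier_Grpn:
  "carrier (Grpn r p n) = {elt r n \<pi> x | \<pi> x. \<pi> permutes {..<n} \<and> int p dvd Delta n x}"
proof -
  have "carrier (Grpn r p n) = {g \<in> carrier (Grn r n).
      \<exists>\<pi> x. \<pi> permutes {..<n} \<and> g = elt r n \<pi> x \<and> int p dvd Delta n x}"
    by (simp add: Grpn_def)
  then show ?thesis unfolding carrier_Grn[OF r0] by blast
qed

lemma carrier_G: "carrier G = {E \<pi> x | \<pi> x. \<pi> permutes {..<n} \<and> int p dvd Delta n x}"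
proof -
  have "Cq r q n #>\<^bsub>Grpn r p n\<^esub> A = proj r q n A" for A
    by (simp add: proj_def r_coset_def)
  then have "carrier G = proj r q n ` carrier (Grpn r p n)"
    by (auto simp: Grpqn_def FactGroup_def RCOSETS_def)
  then show ?thesis unfolding carrier_Grpn by blast
qed

lemma E_carrier [simp]: "\<pi> permutes {..<n} \<Longrightarrow> int p dvd Delta n x \<Longrightarrow> E \<pi> x \<in> carrier G"
  unfolding carrier_G by blast

lemma G_cases:
  assumes "h \<in> carrier G"
  obtains \<pi> x where "h = E \<pi> x" "\<pi> permutes {..<n}" "int p dvd Delta n x"
  using assms unfolding carrier_G by blast

lemma G_one: "\<one>\<^bsub>G\<^esub> = E id (\<lambda>_. 0)"
  unfolding proj_elt[OF permutes_id] by (simp add: Grpqn_def FactGroup_def Cq_eq)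

lemma p_dvd_Delta_comp:
  assumes "\<sigma> permutes {..<n}" "int p dvd Delta n x" "int p dvd Delta n y"
  shows "int p dvd Delta n (\<lambda>i. x (\<sigma> i) + y i)"
  using Delta_permute[OF assms(1), of x] assms by (simp add: Delta_add o_def)

lemma p_dvd_Delta_inv:
  assumes "\<pi> permutes {..<n}" "int p dvd Delta n x"
  shows "int p dvd Delta n (\<lambda>i. - x (pinv \<pi> i))"
  using Delta_permute[OF permutes_inv[OF assms(1)], of x] Delta_mult[of n "-1" "x \<circ> pinv \<pi>"] assms
  by (simp add: o_def)

lemma E_inverse:
  assumes "\<pi> permutes {..<n}"
  shows "E (pinv \<pi>) (\<lambda>i. - x (pinv \<pi> i)) \<otimes>\<^bsub>G\<^esub> E \<pi> x = \<one>\<^bsub>G\<^esub>"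
  using assms by (simp add: E_mult permutes_inv permutes_inverses(2) permutes_inv_o(2) G_one)

lemma group_G: "group G"
proof (rule groupI)
  fix g h assume "g \<in> carrier G" "h \<in> carrier G"
  then obtain \<pi> x \<sigma> y where g: "g = E \<pi> x" "\<pi> permutes {..<n}" "int p dvd Delta n x"
    and h: "h = E \<sigma> y" "\<sigma> permutes {..<n}" "int p dvd Delta n y" by (elim G_cases) blast
  then show "g \<otimes>\<^bsub>G\<^esub> h \<in> carrier G"
    by (simp add: E_mult p_dvd_Delta_comp permutes_compose)
next
  show "\<one>\<^bsub>G\<^esub> \<in> carrier G" by (simp add: G_one Delta_const)
next
  fix g h k assume "g \<in> carrier G" "h \<in> carrier G" "k \<in> carrier G"
  then obtain \<pi> x \<sigma> y \<tau> z where g: "g = E \<pi> x" "\<pi> permutes {..<n}"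
    and h: "h = E \<sigma> y" "\<sigma> permutes {..<n}" and k: "k = E \<tau> z" "\<tau> permutes {..<n}"
    by (elim G_cases) blast
  then show "g \<otimes>\<^bsub>G\<^esub> h \<otimes>\<^bsub>G\<^esub> k = g \<otimes>\<^bsub>G\<^esub> (h \<otimes>\<^bsub>G\<^esub> k)"
    by (simp add: E_mult permutes_compose o_assoc add.assoc)
next
  fix g assume "g \<in> carrier G"
  then obtain \<pi> x where g: "g = E \<pi> x" "\<pi> permutes {..<n}" "int p dvd Delta n x" by (elim G_cases)
  then show "\<one>\<^bsub>G\<^esub> \<otimes>\<^bsub>G\<^esub> g = g" by (simp add: G_one E_mult)
  show "\<exists>h\<in>carrier G. h \<otimes>\<^bsub>G\<^esub> g = \<one>\<^bsub>G\<^esub>"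
    using g E_inverse[OF g(2), of x] E_carrier[OF permutes_inv[OF g(2)] p_dvd_Delta_inv[OF g(2,3)]] by blast
qed

lemma E_inv:
  assumes "\<pi> permutes {..<n}" "int p dvd Delta n x"
  shows "inv\<^bsub>G\<^esub> (E \<pi> x) = E (pinv \<pi>) (\<lambda>i. - x (pinv \<pi> i))"
proof -
  interpret group G by (rule group_G)
  show ?thesis using assms by (intro inv_equality E_inverse) (simp_all add: permutes_inv p_dvd_Delta_inv)
qed

lemma N_eq: "Nrpqn r p q n = {E id x | x. int p dvd Delta n x}"
proof -
  have "{A \<in> carrier (Grpn r p n). diagonal_mat A} = {elt r n id x | x. int p dvd Delta n x}"
    unfolding carrier_Grpn using diagonal_elt_iff permutes_id[of "{..<n}"] by blast
  then have "Nrpqn r p q n = proj r q n ` {elt r n id x | x. int p dvd Delta n x}"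
    by (simp only: Nrpqn_def)
  then show ?thesis by blast
qed

lemma C_eq: "Crpqn r p q n = {E id (\<lambda>_. k) | k. int p dvd int n * k}"
proof -
  have 1: "cmat r n [^]\<^bsub>Grn r n\<^esub> (i::int) = elt r n id (\<lambda>_. i)" for i
    by (simp add: cmat_eq_elt elt_int_pow[OF r0])
  \<comment> \<open>Membership in the carrier may be witnessed by another lift;
    \<open>p_dvd_Delta_eqv\<close> brings the divisibility back to the constant vector.\<close>
  have 2: "E id (\<lambda>_. i) \<in> carrier G \<longleftrightarrow> int p dvd int n * i" for i
  proof
    assume "E id (\<lambda>_. i) \<in> carrier G"
    then obtain \<pi> x where x: "E id (\<lambda>_. i) = E \<pi> x" "\<pi> permutes {..<n}" "int p dvd Delta n x" by (elim G_cases)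
    then have "(\<lambda>_. i) \<simeq> x" using E_eq_iff[OF permutes_id x(2)] by blast
    then show "int p dvd int n * i" using p_dvd_Delta_eqv x(3) by (simp add: Delta_const[symmetric])
  qed (simp add: Delta_const)
  show ?thesis unfolding Crpqn_def 1 using 2 by blast
qed

lemma E_const_nat_pow: "E id (\<lambda>_. k) [^]\<^bsub>G\<^esub> (m::nat) = E id (\<lambda>_. int m * k)"
proof (induction m)
  case 0
  have "E id (\<lambda>_. k) [^]\<^bsub>G\<^esub> (0::nat) = E id (\<lambda>_. int 0 * k)" by (simp add: G_one)
  then show ?case .
next
  case (Suc m)
  have "E id (\<lambda>_. k) [^]\<^bsub>G\<^esub> m = E id (\<lambda>_. int m * k)" by (rule Suc)
  then have "E id (\<lambda>_. k) [^]\<^bsub>G\<^esub> Suc m = E id (\<lambda>_. int (Suc m) * k)"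
    by (simp add: E_mult algebra_simps)
  then show ?case .
qed

text \<open>By \<open>T_eqv\<close> all representatives give the same value, so the set under
  \<open>the_elem\<close> is a singleton. The central element is given by its constant c, and its
  powers add multiples of that constant.\<close>

lemma alpha_E:
  assumes \<pi>: "\<pi> permutes {..<n}" and x: "int p dvd Delta n x"
  shows "alpha r p q n j k (E id (\<lambda>_. c)) (E \<pi> x) =
    E \<pi> (\<lambda>i. T j k x i + int (inversion_number n \<pi>) * c)"
proof -
  have val: "E id (\<lambda>_. c) [^]\<^bsub>G\<^esub> inversion_number n \<sigma> \<otimes>\<^bsub>G\<^esub>
      proj r q n (cmat r n [^]\<^bsub>Grn r n\<^esub> (Delta n y div int (gcd p (gcd q n)) * k)
        \<otimes>\<^bsub>Grn r n\<^esub> elt r n \<sigma> (\<lambda>i. j * y i))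
      = E \<pi> (\<lambda>i. T j k x i + int (inversion_number n \<pi>) * c)"
    if y: "\<sigma> permutes {..<n} \<and> elt r n \<sigma> y \<in> E \<pi> x" for \<sigma> y
  proof -
    have s: "\<sigma> = \<pi>" "y \<simeq> x" using y elt_mem_E_iff[OF \<pi>] by blast+
    then have "T j k y \<simeq> T j k x" using T_eqv p_dvd_Delta_eqv x by blast
    then have "(\<lambda>i. int (inversion_number n \<pi>) * c + T j k y i) \<simeq> (\<lambda>i. int (inversion_number n \<pi>) * c + T j k x i)"
      by (intro eqv_add eqv_refl)
    then show ?thesis using \<pi>
      by (simp add: s E_const_nat_pow cmat_eq_elt elt_int_pow[OF r0] elt_mult E_mult E_eq_iff
          T_def d0_def add.commute)
  qed
  have "elt r n \<pi> x \<in> E \<pi> x" using elt_mem_E_iff[OF \<pi> \<pi>] by simp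
  then have "{E id (\<lambda>_. c) [^]\<^bsub>G\<^esub> inversion_number n \<sigma> \<otimes>\<^bsub>G\<^esub>
      proj r q n (cmat r n [^]\<^bsub>Grn r n\<^esub> (Delta n y div int (gcd p (gcd q n)) * k)
        \<otimes>\<^bsub>Grn r n\<^esub> elt r n \<sigma> (\<lambda>i. j * y i)) | \<sigma> y. \<sigma> permutes {..<n} \<and> elt r n \<sigma> y \<in> E \<pi> x}
    = {E \<pi> (\<lambda>i. T j k x i + int (inversion_number n \<pi>) * c)}" (is "?S = {?v}")
    using val \<pi> by (intro equalityI subsetI) (blast, force)
  then show ?thesis unfolding alpha_def by simp
qed

lemma smat_eq: "proj r q n (smat r n i) = E (swp i (Suc i)) (\<lambda>_. 0)"
  by (simp add: smat_def)

end

text \<open>The conjugating elements live in the case p = 1 of the same construction, so all facts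
  of the locale can be reused for them.\<close>

lemma grpqn_params_one: assumes "grpqn_params r p q n" shows "grpqn_params r 1 q n"
proof -
  interpret grpqn_params r p q n by fact
  show ?thesis using r0 q0 qr n3 by unfold_locales simp_all
qed

section \<open>Conjugation by elements of G(r,1,q,n)\<close>

context grpqn_params
begin

lemma one_mult: "g \<otimes>\<^bsub>Grpqn r 1 q n\<^esub> h = g \<otimes>\<^bsub>G\<^esub> h"
  by (simp add: Grpqn_def FactGroup_def set_mult_def)

lemma E_one_carrier: "\<pi> permutes {..<n} \<Longrightarrow> E \<pi> x \<in> carrier (Grpqn r 1 q n)"
  by (rule grpqn_params.E_carrier[OF grpqn_params_one[OF grpqn_params_axioms]]) simp_all

lemma E_one_inv:
  "\<pi> permutes {..<n} \<Longrightarrow> inv\<^bsub>Grpqn r 1 q n\<^esub> (E \<pi> x) = E (pinv \<pi>) (\<lambda>i. - x (pinv \<pi> i))"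
  by (rule grpqn_params.E_inv[OF grpqn_params_one[OF grpqn_params_axioms]]) simp_all

text \<open>For \<sigma> = id, conjugation adds the coboundary of b. No condition falls on the sum
  of b, which is why the conjugators are taken from G(r,1,q,n).\<close>

lemma Ad_E:
  assumes \<sigma>: "\<sigma> permutes {..<n}" and \<pi>: "\<pi> permutes {..<n}"
  shows "Ad r q n (E \<sigma> b) (E \<pi> x) =
    E (\<sigma> \<circ> \<pi> \<circ> pinv \<sigma>) (\<lambda>i. b (\<pi> (pinv \<sigma> i)) + x (pinv \<sigma> i) - b (pinv \<sigma> i))"
  using assms by (simp add: Ad_def one_mult E_one_inv E_mult permutes_compose permutes_inv)

lemma Ad_carrier:
  assumes "g \<in> carrier (Grpqn r 1 q n)" "h \<in> carrier G" shows "Ad r q n g h \<in> carrier G"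
proof -
  interpret one: grpqn_params r 1 q n using grpqn_params_one grpqn_params_axioms .
  obtain \<sigma> b where g: "g = E \<sigma> b" "\<sigma> permutes {..<n}" using assms(1) by (elim one.G_cases)
  obtain \<pi> x where h: "h = E \<pi> x" "\<pi> permutes {..<n}" "int p dvd Delta n x" using assms(2) by (elim G_cases)
  have s: "pinv \<sigma> permutes {..<n}" by (rule permutes_inv[OF g(2)])
  have ps: "\<pi> \<circ> pinv \<sigma> permutes {..<n}" by (rule permutes_compose[OF s h(2)])
  have "Delta n (\<lambda>i. b (\<pi> (pinv \<sigma> i)) + x (pinv \<sigma> i) - b (pinv \<sigma> i))
      = Delta n (b \<circ> (\<pi> \<circ> pinv \<sigma>)) + Delta n (x \<circ> pinv \<sigma>) - Delta n (b \<circ> pinv \<sigma>)"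
    by (simp add: Delta_def sum.distrib sum_subtractf)
  \<comment> \<open>The two terms in b cancel: permuting coordinates does not change their
    sum.\<close>
  also have "\<dots> = Delta n x" by (simp only: Delta_permute[OF s] Delta_permute[OF ps])
  finally have "int p dvd Delta n (\<lambda>i. b (\<pi> (pinv \<sigma> i)) + x (pinv \<sigma> i) - b (pinv \<sigma> i))"
    using h(3) by simp
  then show ?thesis
    unfolding g(1) h(1) Ad_E[OF g(2) h(2)]
    by (intro E_carrier permutes_compose[OF s] permutes_compose[OF h(2)] g(2))
qed

lemma Ad_N:
  assumes "g \<in> carrier (Grpqn r 1 q n)" "h \<in> Nrpqn r p q n" shows "Ad r q n g h \<in> Nrpqn r p q n"
proof -
  interpret one: grpqn_params r 1 q n using grpqn_params_one grpqn_params_axioms .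
  obtain \<sigma> b where g: "g = E \<sigma> b" "\<sigma> permutes {..<n}" using assms(1) by (elim one.G_cases)
  obtain x where h: "h = E id x" "int p dvd Delta n x" using assms(2) unfolding N_eq by blast
  have "Ad r q n g h = E id (x \<circ> pinv \<sigma>)"
    unfolding g(1) h(1) Ad_E[OF g(2) permutes_id] using permutes_inv_o(1)[OF g(2)] by (simp add: o_def id_def)
  then show ?thesis unfolding N_eq using h(2) Delta_permute[OF permutes_inv[OF g(2)]] by auto
qed

lemma carrier_subset_one: "carrier G \<subseteq> carrier (Grpqn r 1 q n)"
proof
  interpret one: grpqn_params r 1 q n using grpqn_params_one grpqn_params_axioms .
  fix h assume "h \<in> carrier G"
  then obtain \<pi> x where "h = E \<pi> x" "\<pi> permutes {..<n}" by (elim G_cases)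
  then show "h \<in> carrier (Grpqn r 1 q n)" by simp
qed

lemma group_one: "group (Grpqn r 1 q n)"
  by (rule grpqn_params.group_G[OF grpqn_params_one[OF grpqn_params_axioms]])

lemma Ad_mult:
  assumes "g \<in> carrier (Grpqn r 1 q n)" "g' \<in> carrier (Grpqn r 1 q n)" "h \<in> carrier G"
  shows "Ad r q n (g \<otimes>\<^bsub>Grpqn r 1 q n\<^esub> g') h = Ad r q n g (Ad r q n g' h)"
proof -
  interpret group "Grpqn r 1 q n" by (rule group_one)
  have "h \<in> carrier (Grpqn r 1 q n)" using assms(3) carrier_subset_one by blast
  then show ?thesis using assms(1,2) by (simp add: Ad_def m_assoc inv_mult_group)
qed

lemma Ad_inverse:
  assumes "g \<in> carrier (Grpqn r 1 q n)" "h \<in> carrier G"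
  shows "Ad r q n (inv\<^bsub>Grpqn r 1 q n\<^esub> g) (Ad r q n g h) = h"
    and "Ad r q n g (Ad r q n (inv\<^bsub>Grpqn r 1 q n\<^esub> g) h) = h"
proof -
  interpret group "Grpqn r 1 q n" by (rule group_one)
  have h: "h \<in> carrier (Grpqn r 1 q n)" using assms(2) carrier_subset_one by blast
  have one: "Ad r q n \<one>\<^bsub>Grpqn r 1 q n\<^esub> h = h" using h by (simp add: Ad_def)
  show "Ad r q n (inv\<^bsub>Grpqn r 1 q n\<^esub> g) (Ad r q n g h) = h"
    using Ad_mult[OF inv_closed[OF assms(1)] assms] assms(1) one by simp
  show "Ad r q n g (Ad r q n (inv\<^bsub>Grpqn r 1 q n\<^esub> g) h) = h"
    using Ad_mult[OF assms(1) inv_closed[OF assms(1)] assms(2)] assms(1) one by simp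
qed

lemma inv_one_carrier:
  "g \<in> carrier (Grpqn r 1 q n) \<Longrightarrow> inv\<^bsub>Grpqn r 1 q n\<^esub> g \<in> carrier (Grpqn r 1 q n)"
  by (rule group.inv_closed[OF group_one])

lemma Ad_iso:
  assumes g: "g \<in> carrier (Grpqn r 1 q n)" shows "Ad r q n g \<in> iso G G"
proof -
  interpret group "Grpqn r 1 q n" by (rule group_one)
  have "Ad r q n g (h \<otimes>\<^bsub>G\<^esub> k) = Ad r q n g h \<otimes>\<^bsub>G\<^esub> Ad r q n g k"
    if "h \<in> carrier G" "k \<in> carrier G" for h k
  proof -
    have hk: "h \<in> carrier (Grpqn r 1 q n)" "k \<in> carrier (Grpqn r 1 q n)" using that carrier_subset_one by auto
    have "inv\<^bsub>Grpqn r 1 q n\<^esub> g \<otimes>\<^bsub>Grpqn r 1 q n\<^esub> (g \<otimes>\<^bsub>Grpqn r 1 q n\<^esub> (k \<otimes>\<^bsub>Grpqn r 1 q n\<^esub> inv\<^bsub>Grpqn r 1 q n\<^esub> g))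
      = k \<otimes>\<^bsub>Grpqn r 1 q n\<^esub> inv\<^bsub>Grpqn r 1 q n\<^esub> g"
      using g hk by (simp add: m_assoc[symmetric])
    then show ?thesis unfolding one_mult[symmetric] Ad_def using g hk by (simp add: m_assoc)
  qed
  then have "Ad r q n g \<in> hom G G" using Ad_carrier[OF g] by (intro homI)
  moreover have "bij_betw (Ad r q n g) (carrier G) (carrier G)"
    using Ad_inverse[OF g] Ad_carrier[OF g] Ad_carrier[OF inv_one_carrier[OF g]]
    by (intro bij_betw_byWitness[where f' = "Ad r q n (inv\<^bsub>Grpqn r 1 q n\<^esub> g)"]) blast+
  ultimately show ?thesis unfolding iso_def by blast
qed

lemma N_subset: "Nrpqn r p q n \<subseteq> carrier G"
  unfolding N_eq using E_carrier[OF permutes_id] by auto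

lemma Ad_image_N:
  assumes g: "g \<in> carrier (Grpqn r 1 q n)" shows "Ad r q n g ` Nrpqn r p q n = Nrpqn r p q n"
proof (intro equalityI subsetI)
  fix h assume h: "h \<in> Nrpqn r p q n"
  then have "h = Ad r q n g (Ad r q n (inv\<^bsub>Grpqn r 1 q n\<^esub> g) h)"
    using Ad_inverse(2)[OF g] N_subset by auto
  moreover have "Ad r q n (inv\<^bsub>Grpqn r 1 q n\<^esub> g) h \<in> Nrpqn r p q n"
    by (rule Ad_N[OF inv_one_carrier[OF g] h])
  ultimately show "h \<in> Ad r q n g ` Nrpqn r p q n" by (rule image_eqI)
qed (use Ad_N[OF g] in blast)

lemma E_decompose: "\<pi> permutes {..<n} \<Longrightarrow> E \<pi> x = E \<pi> (\<lambda>_. 0) \<otimes>\<^bsub>G\<^esub> E id x"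
  by (simp add: E_mult)

lemma p_dvd_Delta_zero: "int p dvd Delta n (\<lambda>_. 0)"
  by (simp add: Delta_const)

text \<open>N and the adjacent transpositions generate G. Both the comparison with
  \<open>alpha\<close> and the uniqueness of the exotic automorphism rest on this.\<close>

lemma hom_eqI:
  assumes \<phi>: "\<phi> \<in> hom G H" and \<psi>: "\<psi> \<in> hom G H"
    and N: "\<And>x. int p dvd Delta n x \<Longrightarrow> \<phi> (E id x) = \<psi> (E id x)"
    and s: "\<And>i. Suc i < n \<Longrightarrow> \<phi> (E (swp i (Suc i)) (\<lambda>_. 0)) = \<psi> (E (swp i (Suc i)) (\<lambda>_. 0))"
    and h: "h \<in> carrier G"
  shows "\<phi> h = \<psi> h"
proof -
  note z = p_dvd_Delta_zero
  have perm: "\<phi> (E \<pi> (\<lambda>_. 0)) = \<psi> (E \<pi> (\<lambda>_. 0))" if "\<pi> permutes {..<n}" for \<pi>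
    using that
  proof (induction \<pi> rule: permutes_adjacent_induct)
    case id
    have "\<phi> (E id (\<lambda>_. 0)) = \<psi> (E id (\<lambda>_. 0))" by (rule N[OF z])
    then show ?case .
  next
    case (swap i \<pi>)
    have IH: "\<phi> (E \<pi> (\<lambda>_. 0)) = \<psi> (E \<pi> (\<lambda>_. 0))" by (rule swap.IH)
    have sp: "swp i (Suc i) permutes {..<n}" using swap(1) by (intro permutes_swap_id) simp_all
    have m: "E (\<pi> \<circ> swp i (Suc i)) (\<lambda>_. 0) = E \<pi> (\<lambda>_. 0) \<otimes>\<^bsub>G\<^esub> E (swp i (Suc i)) (\<lambda>_. 0)"
      using swap(2) sp by (simp add: E_mult)
    have c: "E \<pi> (\<lambda>_. 0) \<in> carrier G" "E (swp i (Suc i)) (\<lambda>_. 0) \<in> carrier G"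
      by (rule E_carrier[OF swap(2) z], rule E_carrier[OF sp z])
    have "\<phi> (E (\<pi> \<circ> swp i (Suc i)) (\<lambda>_. 0)) = \<psi> (E (\<pi> \<circ> swp i (Suc i)) (\<lambda>_. 0))"
      unfolding m hom_mult[OF \<phi> c] hom_mult[OF \<psi> c] IH s[OF swap(1)] ..
    then show ?case .
  qed
  obtain \<pi> x where hx: "h = E \<pi> x" "\<pi> permutes {..<n}" "int p dvd Delta n x" using h by (elim G_cases)
  have c: "E \<pi> (\<lambda>_. 0) \<in> carrier G" "E id x \<in> carrier G"
    by (rule E_carrier[OF hx(2) z], rule E_carrier[OF permutes_id hx(3)])
  show ?thesis
    unfolding hx(1) E_decompose[OF hx(2), of x] hom_mult[OF \<phi> c] hom_mult[OF \<psi> c] perm[OF hx(2)] N[OF hx(3)] ..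
qed

end

section \<open>Automorphisms preserving the normal part\<close>

locale normal_part_automorphism = grpqn_params +
  fixes \<nu> :: "complex mat set \<Rightarrow> complex mat set"
  assumes iso: "\<nu> \<in> iso G G" and image_N: "\<nu> ` Nrpqn r p q n = Nrpqn r p q n"
begin

lemma hom: "\<nu> \<in> hom G G"
  using iso by (simp add: iso_def)

lemma nu_mult: "g \<in> carrier G \<Longrightarrow> h \<in> carrier G \<Longrightarrow> \<nu> (g \<otimes>\<^bsub>G\<^esub> h) = \<nu> g \<otimes>\<^bsub>G\<^esub> \<nu> h"
  by (rule hom_mult[OF hom])

lemma nu_inj: "g \<in> carrier G \<Longrightarrow> h \<in> carrier G \<Longrightarrow> \<nu> g = \<nu> h \<Longrightarrow> g = h"
  using iso by (auto simp: iso_def bij_betw_def inj_on_def)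

lemma E_id_eq_iff: "E id x = E id y \<longleftrightarrow> x \<simeq> y"
  using E_eq_iff[OF permutes_id permutes_id] by blast

definition F :: "(nat \<Rightarrow> int) \<Rightarrow> nat \<Rightarrow> int" where
  "F x = (SOME y. int p dvd Delta n y \<and> \<nu> (E id x) = E id y)"

lemma F:
  assumes "int p dvd Delta n x"
  shows "int p dvd Delta n (F x)" "\<nu> (E id x) = E id (F x)"
proof -
  have "E id x \<in> Nrpqn r p q n" unfolding N_eq using assms by blast
  then have "\<nu> (E id x) \<in> Nrpqn r p q n" using image_N by blast
  then have "\<exists>y. int p dvd Delta n y \<and> \<nu> (E id x) = E id y" unfolding N_eq by blast
  then have "int p dvd Delta n (F x) \<and> \<nu> (E id x) = E id (F x)" unfolding F_def by (rule someI_ex)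
  then show "int p dvd Delta n (F x)" "\<nu> (E id x) = E id (F x)" by blast+
qed

lemma F_inj:
  assumes x: "int p dvd Delta n x" and y: "int p dvd Delta n y" and eq: "F x \<simeq> F y"
  shows "x \<simeq> y"
proof -
  have "\<nu> (E id x) = \<nu> (E id y)" unfolding F(2)[OF x] F(2)[OF y] E_id_eq_iff by (rule eq)
  then have "E id x = E id y" by (rule nu_inj[OF E_carrier[OF permutes_id x] E_carrier[OF permutes_id y]])
  then show ?thesis unfolding E_id_eq_iff .
qed

lemma F_surj:
  assumes "int p dvd Delta n y" obtains x where "int p dvd Delta n x" "F x \<simeq> y"
proof -
  have "E id y \<in> Nrpqn r p q n" unfolding N_eq using assms by blast
  then have "E id y \<in> \<nu> ` Nrpqn r p q n" by (simp only: image_N)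
  then obtain x where x: "int p dvd Delta n x" "E id y = \<nu> (E id x)" unfolding N_eq by blast
  have "F x \<simeq> y" using x(2) unfolding F(2)[OF x(1)] E_id_eq_iff by (rule eqv_sym)
  with x(1) show thesis by (rule that)
qed

sublocale endomorphism r p q n F
proof (unfold_locales)
  fix x y assume x: "int p dvd Delta n x" and y: "int p dvd Delta n y"
  have xy: "int p dvd Delta n (\<lambda>i. x i + y i)" using x y by (simp add: Delta_add)
  have "E id (\<lambda>i. x i + y i) = E id x \<otimes>\<^bsub>G\<^esub> E id y" by (simp add: E_mult)
  then have "E id (F (\<lambda>i. x i + y i)) = E id (F x) \<otimes>\<^bsub>G\<^esub> E id (F y)"
    unfolding F(2)[OF xy, symmetric] F(2)[OF x, symmetric] F(2)[OF y, symmetric]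
    using nu_mult[OF E_carrier[OF permutes_id x] E_carrier[OF permutes_id y]] by (simp only:)
  also have "\<dots> = E id (\<lambda>i. F x i + F y i)" by (simp add: E_mult)
  finally show "F (\<lambda>i. x i + y i) \<simeq> (\<lambda>i. F x i + F y i)" unfolding E_id_eq_iff .
next
  fix x y assume x: "int p dvd Delta n x" and y: "int p dvd Delta n y" and eq: "x \<simeq> y"
  show "F x \<simeq> F y"
    using eq unfolding E_id_eq_iff[symmetric] F(2)[OF x, symmetric] F(2)[OF y, symmetric] by (rule arg_cong)
qed (rule F)

text \<open>\<open>P\<close> is the map induced on S_n, the quotient by N, and \<open>Y\<close> is
  the diagonal part. One choice yields both, so that they describe the same element.\<close>

definition PY :: "(nat \<Rightarrow> nat) \<Rightarrow> (nat \<Rightarrow> nat) \<times> (nat \<Rightarrow> int)" where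
  "PY \<pi> = (SOME \<sigma>y. fst \<sigma>y permutes {..<n} \<and> int p dvd Delta n (snd \<sigma>y) \<and>
    \<nu> (E \<pi> (\<lambda>_. 0)) = E (fst \<sigma>y) (snd \<sigma>y))"

definition P :: "(nat \<Rightarrow> nat) \<Rightarrow> nat \<Rightarrow> nat" where "P \<pi> = fst (PY \<pi>)"
definition Y :: "(nat \<Rightarrow> nat) \<Rightarrow> nat \<Rightarrow> int" where "Y \<pi> = snd (PY \<pi>)"

lemma PY:
  assumes "\<pi> permutes {..<n}"
  shows "P \<pi> permutes {..<n}" "int p dvd Delta n (Y \<pi>)" "\<nu> (E \<pi> (\<lambda>_. 0)) = E (P \<pi>) (Y \<pi>)"
proof -
  have "\<nu> (E \<pi> (\<lambda>_. 0)) \<in> carrier G"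
    by (rule hom_in_carrier[OF hom E_carrier[OF assms p_dvd_Delta_zero]])
  then obtain \<sigma> y where "\<sigma> permutes {..<n}" "int p dvd Delta n y" "\<nu> (E \<pi> (\<lambda>_. 0)) = E \<sigma> y"
    by (elim G_cases) blast
  then have "fst (\<sigma>, y) permutes {..<n} \<and> int p dvd Delta n (snd (\<sigma>, y)) \<and>
    \<nu> (E \<pi> (\<lambda>_. 0)) = E (fst (\<sigma>, y)) (snd (\<sigma>, y))" by simp
  from someI[of "\<lambda>\<sigma>y. fst \<sigma>y permutes {..<n} \<and> int p dvd Delta n (snd \<sigma>y) \<and>
    \<nu> (E \<pi> (\<lambda>_. 0)) = E (fst \<sigma>y) (snd \<sigma>y)", OF this]
  show "P \<pi> permutes {..<n}" "int p dvd Delta n (Y \<pi>)" "\<nu> (E \<pi> (\<lambda>_. 0)) = E (P \<pi>) (Y \<pi>)"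
    unfolding P_def Y_def PY_def[symmetric] by blast+
qed

lemma P_unique:
  assumes "\<pi> permutes {..<n}" "\<sigma> permutes {..<n}" "\<nu> (E \<pi> (\<lambda>_. 0)) = E \<sigma> y"
  shows "P \<pi> = \<sigma>" "Y \<pi> \<simeq> y"
  using assms(3) unfolding PY(3)[OF assms(1)] E_eq_iff[OF PY(1)[OF assms(1)] assms(2)] by blast+

lemma nu_comp:
  assumes \<pi>: "\<pi> permutes {..<n}" and \<sigma>: "\<sigma> permutes {..<n}"
  shows "\<nu> (E (\<pi> \<circ> \<sigma>) (\<lambda>_. 0)) = E (P \<pi> \<circ> P \<sigma>) (\<lambda>i. Y \<pi> (P \<sigma> i) + Y \<sigma> i)"
proof -
  have "E (\<pi> \<circ> \<sigma>) (\<lambda>_. 0) = E \<pi> (\<lambda>_. 0) \<otimes>\<^bsub>G\<^esub> E \<sigma> (\<lambda>_. 0)" using assms by (simp add: E_mult)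
  then have "\<nu> (E (\<pi> \<circ> \<sigma>) (\<lambda>_. 0)) = \<nu> (E \<pi> (\<lambda>_. 0)) \<otimes>\<^bsub>G\<^esub> \<nu> (E \<sigma> (\<lambda>_. 0))"
    using nu_mult[OF E_carrier[OF \<pi> p_dvd_Delta_zero] E_carrier[OF \<sigma> p_dvd_Delta_zero]] by (simp only:)
  then show ?thesis unfolding PY(3)[OF \<pi>] PY(3)[OF \<sigma>] E_mult[OF PY(1)[OF \<pi>] PY(1)[OF \<sigma>]] .
qed

lemma P_comp:
  assumes "\<pi> permutes {..<n}" "\<sigma> permutes {..<n}"
  shows "P (\<pi> \<circ> \<sigma>) = P \<pi> \<circ> P \<sigma>" "Y (\<pi> \<circ> \<sigma>) \<simeq> (\<lambda>i. Y \<pi> (P \<sigma> i) + Y \<sigma> i)"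
  by (rule P_unique[OF permutes_compose[OF assms(2,1)] permutes_compose[OF PY(1)[OF assms(2)] PY(1)[OF assms(1)]] nu_comp[OF assms]])+

text \<open>A permutation mapped into N is mapped into \<nu>(N), because \<open>image_N\<close> is
  an equality; by injectivity it lies in N itself.\<close>

lemma P_eq_id:
  assumes \<pi>: "\<pi> permutes {..<n}" and "P \<pi> = id" shows "\<pi> = id"
proof -
  have "E id (Y \<pi>) \<in> Nrpqn r p q n" using PY(2)[OF \<pi>] unfolding N_eq by blast
  then have "\<nu> (E \<pi> (\<lambda>_. 0)) \<in> \<nu> ` Nrpqn r p q n" unfolding PY(3)[OF \<pi>] assms(2) image_N .
  then obtain x where x: "int p dvd Delta n x" "\<nu> (E \<pi> (\<lambda>_. 0)) = \<nu> (E id x)" unfolding N_eq by blast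
  have "E \<pi> (\<lambda>_. 0) = E id x"
    by (rule nu_inj[OF E_carrier[OF \<pi> p_dvd_Delta_zero] E_carrier[OF permutes_id x(1)] x(2)])
  then show ?thesis unfolding E_eq_iff[OF \<pi> permutes_id] by blast
qed

lemma P_idem: "P id = id"
proof
  fix i
  have "P id \<circ> P id = P id" using P_comp(1)[OF permutes_id permutes_id] by simp
  then have "P id (P id i) = P id i" by (metis comp_apply)
  then show "P id i = id i" using injD[OF permutes_inj[OF PY(1)[OF permutes_id]]] by (metis id_apply)
qed

sublocale symmetric_group_aut n P
proof (unfold_locales)
  show "P (\<pi> \<circ> \<sigma>) = P \<pi> \<circ> P \<sigma>" if "\<pi> permutes {..<n}" "\<sigma> permutes {..<n}" for \<pi> \<sigma>
    using that by (rule P_comp)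
  have "inj_on P {\<pi>. \<pi> permutes {..<n}}"
  proof (rule inj_onI, unfold mem_Collect_eq)
    fix \<pi> \<sigma> assume \<pi>: "\<pi> permutes {..<n}" and \<sigma>: "\<sigma> permutes {..<n}" and eq: "P \<pi> = P \<sigma>"
    have s: "pinv \<sigma> permutes {..<n}" using \<sigma> by (rule permutes_inv)
    have "P (pinv \<sigma> \<circ> \<pi>) = P (pinv \<sigma> \<circ> \<sigma>)" using P_comp(1)[OF s \<pi>] P_comp(1)[OF s \<sigma>] eq by (simp only:)
    also have "\<dots> = id" unfolding permutes_inv_o(2)[OF \<sigma>] by (rule P_idem)
    finally have "pinv \<sigma> \<circ> \<pi> = id" by (rule P_eq_id[OF permutes_compose[OF \<pi> s]])
    then have "\<sigma> (pinv \<sigma> (\<pi> i)) = \<sigma> i" for i by (metis comp_apply id_apply)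
    then show "\<pi> = \<sigma>" by (simp add: fun_eq_iff permutes_inverses(1)[OF \<sigma>])
  qed
  moreover have "P ` {\<pi>. \<pi> permutes {..<n}} \<subseteq> {\<pi>. \<pi> permutes {..<n}}" using PY(1) by blast
  moreover have "finite {\<pi>. \<pi> permutes {..<n}}" by (rule finite_permutations) simp
  ultimately show "bij_betw P {\<pi>. \<pi> permutes {..<n}} {\<pi>. \<pi> permutes {..<n}}"
    unfolding bij_betw_def using endo_inj_surj by blast
qed (rule n3)

text \<open>This is \<nu> applied to the rule by which a permutation moves past a diagonal
  element.\<close>

lemma F_twisted:
  assumes \<pi>: "\<pi> permutes {..<n}" and x: "int p dvd Delta n x"
  shows "F (x \<circ> \<pi>) \<simeq> F x \<circ> P \<pi>"
proof -
  have xp: "int p dvd Delta n (x \<circ> \<pi>)" unfolding Delta_permute[OF \<pi>] by (rule x)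
  note c = E_carrier[OF \<pi> p_dvd_Delta_zero] E_carrier[OF permutes_id x] E_carrier[OF permutes_id xp]
  have "E \<pi> (\<lambda>_. 0) \<otimes>\<^bsub>G\<^esub> E id (x \<circ> \<pi>) = E id x \<otimes>\<^bsub>G\<^esub> E \<pi> (\<lambda>_. 0)"
    using \<pi> by (simp add: E_mult)
  then have "E (P \<pi>) (Y \<pi>) \<otimes>\<^bsub>G\<^esub> E id (F (x \<circ> \<pi>)) = E id (F x) \<otimes>\<^bsub>G\<^esub> E (P \<pi>) (Y \<pi>)"
    unfolding F(2)[OF x, symmetric] F(2)[OF xp, symmetric] PY(3)[OF \<pi>, symmetric]
      nu_mult[OF c(1,3), symmetric] nu_mult[OF c(2,1), symmetric] by (rule arg_cong)
  then have "E (P \<pi>) (\<lambda>i. Y \<pi> i + F (x \<circ> \<pi>) i) = E (P \<pi>) (\<lambda>i. F x (P \<pi> i) + Y \<pi> i)"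
    by (simp add: E_mult PY(1)[OF \<pi>])
  then have "(\<lambda>i. Y \<pi> i + F (x \<circ> \<pi>) i) \<simeq> (\<lambda>i. F x (P \<pi> i) + Y \<pi> i)"
    unfolding E_eq_iff[OF PY(1)[OF \<pi>] PY(1)[OF \<pi>]] by blast
  from eqv_diff[OF this eqv_refl[of "Y \<pi>"]] show ?thesis by (simp add: o_def)
qed

text \<open>
  The commutators of the normal part with a transposition are the multiples of one element, which
  fails for a product of three disjoint transpositions.
\<close>

lemma not_three_swaps:
  assumes r2: "r \<ge> 2" and dist: "distinct [a, b, c, e, f, g]"
    and all: "{a, b, c, e, f, g} = {..<n}"
  shows "P (swp 0 1) \<noteq> swp a b \<circ> swp c e \<circ> swp f g"
proof
  assume P: "P (swp 0 1) = swp a b \<circ> swp c e \<circ> swp f g"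
  define t where "t = P (swp 0 1)"
  have lt: "a < n" "b < n" "c < n" "e < n" "f < n" "g < n" using all by blast+
  have ne: "a \<noteq> b" "a \<noteq> c" "a \<noteq> e" "a \<noteq> f" "a \<noteq> g" "b \<noteq> c" "b \<noteq> e" "b \<noteq> f" "b \<noteq> g" "c \<noteq> e"
    "c \<noteq> f" "c \<noteq> g" "e \<noteq> f" "e \<noteq> g" "f \<noteq> g" using dist by simp_all
  have t: "t a = b" "t b = a" "t c = e" "t e = c" "t f = g" "t g = f"
    unfolding t_def P using ne ne[symmetric] by simp_all
  have s: "swp 0 1 permutes {..<n}" using n3 by (intro permutes_swap_id) simp_all
  \<comment> \<open>The commutator of any x with (0 1) is a multiple of this root. Applying
    \<open>F\<close> makes every commutator of N with t a multiple of w.\<close>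
  define u where "u i = (if i = 0 then 1 else 0) - (if i = 1 then 1 else (0::int))" for i :: nat
  have Du: "Delta n u = 0" using n3 by (simp add: u_def Delta_def sum_subtractf)
  then have pu: "int p dvd Delta n u" by simp
  define w where "w = F u"
  have key: "\<exists>m. (\<lambda>i. y (t i) - y i) \<simeq> (\<lambda>i. m * w i)" if y: "int p dvd Delta n y" for y
  proof -
    obtain x where x: "int p dvd Delta n x" "F x \<simeq> y" using F_surj[OF y] by blast
    define m where "m = x 1 - x 0"
    have pmu: "int p dvd Delta n (\<lambda>i. m * u i)" by (simp add: Delta_mult Du)
    have "x (swp 0 1 i) = x i + m * u i" for i
    proof -
      consider "i = 0" | "i = 1" | "i \<noteq> 0" "i \<noteq> 1" by blast
      then show ?thesis by cases (simp_all add: u_def m_def)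
    qed
    then have xs: "x \<circ> swp 0 1 = (\<lambda>i. x i + m * u i)" by (simp add: fun_eq_iff)
    have "F x \<circ> t \<simeq> F (x \<circ> swp 0 1)"
      unfolding t_def by (rule eqv_sym[OF F_twisted[OF s x(1)]])
    also have "\<dots> \<simeq> (\<lambda>i. F x i + F (\<lambda>i. m * u i) i)" unfolding xs by (rule F_add[OF x(1) pmu])
    also have "\<dots> \<simeq> (\<lambda>i. F x i + m * w i)"
      unfolding w_def by (intro eqv_add eqv_refl F_scale pu)
    finally have 1: "F x \<circ> t \<simeq> (\<lambda>i. F x i + m * w i)" .
    have "y \<circ> t \<simeq> F x \<circ> t"
      unfolding t_def by (rule eqv_permute[OF eqv_sym[OF x(2)] PY(1)[OF s]])
    also note 1
    finally have "y \<circ> t \<simeq> (\<lambda>i. F x i + m * w i)" .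
    from eqv_diff[OF this eqv_sym[OF x(2)]] have "(\<lambda>i. y (t i) - y i) \<simeq> (\<lambda>i. m * w i)" by simp
    then show ?thesis ..
  qed
  \<comment> \<open>The commutator of y1 with t takes equal values at b and c, that of y2 values
    differing by one. As both are multiples of w, this makes m1 zero modulo r; but the commutator of
    y1 is 1 at a and 0 at f.\<close>
  define y1 where "y1 i = (if i = c then 1 else 0) - (if i = a then 1 else (0::int))" for i :: nat
  define y2 where "y2 i = (if i = f then 1 else 0) - (if i = c then 1 else (0::int))" for i :: nat
  have "int p dvd Delta n y1" "int p dvd Delta n y2"
    using lt by (simp_all add: y1_def y2_def Delta_def sum_subtractf)
  from key[OF this(1)] key[OF this(2)] obtain m1 m2 where m1: "(\<lambda>i. y1 (t i) - y1 i) \<simeq> (\<lambda>i. m1 * w i)"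
    and m2: "(\<lambda>i. y2 (t i) - y2 i) \<simeq> (\<lambda>i. m2 * w i)" by blast
  have "(\<lambda>i. m2 * (y1 (t i) - y1 i)) \<simeq> (\<lambda>i. m2 * (m1 * w i))" by (rule eqv_scale[OF m1])
  also have "(\<lambda>i. m2 * (m1 * w i)) = (\<lambda>i. m1 * (m2 * w i))" by (simp add: ac_simps)
  also have "(\<lambda>i. m1 * (m2 * w i)) \<simeq> (\<lambda>i. m1 * (y2 (t i) - y2 i))" by (rule eqv_scale[OF eqv_sym[OF m2]])
  finally have m12: "(\<lambda>i. m2 * (y1 (t i) - y1 i)) \<simeq> (\<lambda>i. m1 * (y2 (t i) - y2 i))" .
  have v1: "y1 a = -1" "y1 b = 0" "y1 c = 1" "y1 e = 0" "y1 f = 0" "y1 g = 0"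
    unfolding y1_def using ne ne[symmetric] by simp_all
  have v2: "y2 a = 0" "y2 b = 0" "y2 c = -1" "y2 e = 0" "y2 f = 1" "y2 g = 0"
    unfolding y2_def using ne ne[symmetric] by simp_all
  have "int r dvd m1" using eqv_diff_const[OF m12 lt(2) lt(3)] by (simp add: t v1 v2)
  then have "(\<lambda>i. m1 * w i) \<simeq> (\<lambda>_. 0)" by (intro eqvI0) simp
  then have "(\<lambda>i. y1 (t i) - y1 i) \<simeq> (\<lambda>_. 0)" by (rule eqv_trans[OF m1])
  from eqv_diff_const[OF this lt(1) lt(5)] have "int r dvd 1" by (simp add: t v1)
  then show False using r2 by simp
qed

end

section \<open>The prescribed exotic images in coordinates\<close>

context grpqn_params
begin

lemma exotic_image_eq:
  assumes n4: "n = 4" and i: "i < 3"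
  shows "proj r q n (exotic_image r p q i) = E (swp i (Suc i))
    (\<lambda>l. (if l = (i + 2) mod 4 then int (r div 2) else 0) + (if even (r div p) then 0 else int (r div (2 * q))))"
proof -
  define a where "a = (i + 2) mod 4"
  have s: "swp i (Suc i) permutes {..<n}" using i n4 by (intro permutes_swap_id) simp_all
  \<comment> \<open>The position of t_{i+2} avoids i and i+1, so moving it past s_i does not change
    it.\<close>
  have "a \<noteq> i" "a \<noteq> Suc i" unfolding a_def by presburger+
  then have sa: "swp i (Suc i) l = a \<longleftrightarrow> l = a" for l by (auto simp: Transposition.transpose_def)
  have "tmat r n a = elt r n id (\<lambda>l. if l = a then int (r div 2) else 0)"
    unfolding tmat_def elt_nat_pow by (rule arg_cong[of _ _ "elt r n id"]) (simp add: fun_eq_iff)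
  then have ts: "tmat r n a * smat r n i = elt r n (swp i (Suc i)) (\<lambda>l. if l = a then int (r div 2) else 0)"
    using s by (simp add: smat_def elt_mult sa)
  have c: "cmat r n [^]\<^bsub>Grn r n\<^esub> (r div (2 * q)) = elt r n id (\<lambda>_. int (r div (2 * q)))"
    by (simp add: cmat_eq_elt elt_nat_pow)
  have "exotic_image r p q i = (if even (r div p) then tmat r n a * smat r n i
      else tmat r n a * smat r n i * (cmat r n [^]\<^bsub>Grn r n\<^esub> (r div (2 * q))))"
    unfolding exotic_image_def Grn_mult a_def n4 ..
  also have "\<dots> = elt r n (swp i (Suc i))
    (\<lambda>l. (if l = a then int (r div 2) else 0) + (if even (r div p) then 0 else int (r div (2 * q))))"
    unfolding ts c by (simp add: elt_mult)
  finally have "exotic_image r p q i = elt r n (swp i (Suc i))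
    (\<lambda>l. (if l = a then int (r div 2) else 0) + (if even (r div p) then 0 else int (r div (2 * q))))" .
  then show ?thesis by (simp only: a_def)
qed

end

section \<open>Automorphisms inducing the identity on the symmetric group\<close>

locale perm_trivial_automorphism = normal_part_automorphism +
  assumes P_trivial: "\<pi> permutes {..<n} \<Longrightarrow> P \<pi> = \<pi>"
begin

sublocale equivariant_endomorphism r p q n F
proof (unfold_locales)
  fix x \<pi> assume x: "int p dvd Delta n x" and \<pi>: "\<pi> permutes {..<n}"
  show "F (x \<circ> \<pi>) \<simeq> F x \<circ> \<pi>" using F_twisted[OF \<pi> x] unfolding P_trivial[OF \<pi>] .
qed

sublocale cocycle r p q n Y
proof (unfold_locales)
  fix \<pi> \<sigma> assume \<pi>: "\<pi> permutes {..<n}" and \<sigma>: "\<sigma> permutes {..<n}"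
  show "Y (\<pi> \<circ> \<sigma>) \<simeq> (\<lambda>i. Y \<pi> (\<sigma> i) + Y \<sigma> i)"
    using P_comp(2)[OF \<pi> \<sigma>] unfolding P_trivial[OF \<sigma>] .
qed

text \<open>On the diagonal part \<open>alpha\<close> agrees with \<nu> by \<open>FT\<close> and
  inherits bijectivity from it. It is multiplicative because d | 2c lets only the parity of the
  inversion number count.\<close>

lemma alpha_iso:
  assumes FT: "\<And>x. int p dvd Delta n x \<Longrightarrow> F x \<simeq> T j k x"
    and pc: "int p dvd int n * c" and dc: "d dvd 2 * c"
  shows "alpha r p q n j k (E id (\<lambda>_. c)) \<in> iso G G"
proof -
  let ?\<alpha> = "alpha r p q n j k (E id (\<lambda>_. c))"
  let ?l = "\<lambda>\<pi>. int (inversion_number n \<pi>) * c"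
  have D: "int p dvd Delta n (\<lambda>i. T j k x i + ?l \<pi>)" if "int p dvd Delta n x" for x \<pi>
  proof -
    have "Delta n (\<lambda>i. T j k x i + ?l \<pi>) = Delta n (T j k x) + (int n * c) * int (inversion_number n \<pi>)"
      by (simp add: Delta_add Delta_const ac_simps)
    then show ?thesis using p_dvd_Delta_T[OF that] pc by simp
  qed
  have parity: "d dvd int a * c - int b * c" if ab: "even a \<longleftrightarrow> even b" for a b :: nat
  proof -
    have "even (int a - int b)" using ab by simp
    then obtain m where "int a - int b = 2 * m" by blast
    then have "int a * c - int b * c = m * (2 * c)" by (simp add: algebra_simps flip: left_diff_distrib)
    then show ?thesis using dc by simp
  qed
  have "?\<alpha> \<in> hom G G"
  proof (rule homI)
    fix g assume "g \<in> carrier G"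
    then obtain \<pi> x where g: "g = E \<pi> x" "\<pi> permutes {..<n}" "int p dvd Delta n x" by (elim G_cases)
    show "?\<alpha> g \<in> carrier G" unfolding g(1) alpha_E[OF g(2,3)] by (rule E_carrier[OF g(2) D[OF g(3)]])
  next
    fix g h assume "g \<in> carrier G" "h \<in> carrier G"
    then obtain \<pi> x \<sigma> y where g: "g = E \<pi> x" "\<pi> permutes {..<n}" "int p dvd Delta n x"
      and h: "h = E \<sigma> y" "\<sigma> permutes {..<n}" "int p dvd Delta n y" by (elim G_cases) blast
    have comp: "\<pi> \<circ> \<sigma> permutes {..<n}" by (rule permutes_compose[OF h(2) g(2)])
    have xs: "int p dvd Delta n (x \<circ> \<sigma>)" unfolding Delta_permute[OF h(2)] by (rule g(3))
    have xy: "int p dvd Delta n (\<lambda>i. (x \<circ> \<sigma>) i + y i)" using xs h(3) by (simp only: Delta_add dvd_add)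
    have T_xy: "T j k (\<lambda>i. (x \<circ> \<sigma>) i + y i) = (\<lambda>i. T j k x (\<sigma> i) + T j k y i)"
      unfolding T_add[OF xs h(3)] T_permute[OF h(2)] by simp
    have "(\<lambda>i. (T j k x (\<sigma> i) + T j k y i) + ?l (\<pi> \<circ> \<sigma>))
        \<simeq> (\<lambda>i. (T j k x (\<sigma> i) + T j k y i) + int (inversion_number n \<pi> + inversion_number n \<sigma>) * c)"
      by (intro eqv_add eqv_refl eqv_const parity even_inversion_number_comp g h)
    moreover have "(\<lambda>i. (T j k x (\<sigma> i) + T j k y i) + int (inversion_number n \<pi> + inversion_number n \<sigma>) * c)
        = (\<lambda>i. (T j k x (\<sigma> i) + ?l \<pi>) + (T j k y i + ?l \<sigma>))"
      by (rule ext) (simp add: distrib_right)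
    ultimately have eq: "(\<lambda>i. T j k (\<lambda>i. (x \<circ> \<sigma>) i + y i) i + ?l (\<pi> \<circ> \<sigma>)) \<simeq>
      (\<lambda>i. (T j k x (\<sigma> i) + ?l \<pi>) + (T j k y i + ?l \<sigma>))" by (simp only: T_xy)
    have "g \<otimes>\<^bsub>G\<^esub> h = E (\<pi> \<circ> \<sigma>) (\<lambda>i. (x \<circ> \<sigma>) i + y i)"
      unfolding g(1) h(1) E_mult[OF g(2) h(2)] by simp
    then have "?\<alpha> (g \<otimes>\<^bsub>G\<^esub> h) = E (\<pi> \<circ> \<sigma>) (\<lambda>i. T j k (\<lambda>i. (x \<circ> \<sigma>) i + y i) i + ?l (\<pi> \<circ> \<sigma>))"
      by (simp only: alpha_E[OF comp xy])
    also have "\<dots> = E (\<pi> \<circ> \<sigma>) (\<lambda>i. (T j k x (\<sigma> i) + ?l \<pi>) + (T j k y i + ?l \<sigma>))"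
      unfolding E_eq_iff[OF comp comp] using eq by blast
    also have "\<dots> = ?\<alpha> g \<otimes>\<^bsub>G\<^esub> ?\<alpha> h"
      unfolding g(1) h(1) alpha_E[OF g(2,3)] alpha_E[OF h(2,3)] E_mult[OF g(2) h(2)] ..
    finally show "?\<alpha> (g \<otimes>\<^bsub>G\<^esub> h) = ?\<alpha> g \<otimes>\<^bsub>G\<^esub> ?\<alpha> h" .
  qed
  moreover have "inj_on ?\<alpha> (carrier G)"
  proof (rule inj_onI)
    fix g h assume "g \<in> carrier G" "h \<in> carrier G" and eq: "?\<alpha> g = ?\<alpha> h"
    then obtain \<pi> x \<sigma> y where g: "g = E \<pi> x" "\<pi> permutes {..<n}" "int p dvd Delta n x"
      and h: "h = E \<sigma> y" "\<sigma> permutes {..<n}" "int p dvd Delta n y" by (elim G_cases) blast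
    have "\<pi> = \<sigma>" and "(\<lambda>i. T j k x i + ?l \<pi>) \<simeq> (\<lambda>i. T j k y i + ?l \<sigma>)"
      using eq unfolding g(1) h(1) alpha_E[OF g(2,3)] alpha_E[OF h(2,3)] E_eq_iff[OF g(2) h(2)] by blast+
    then have "T j k x \<simeq> T j k y" using eqv_diff[OF _ eqv_refl[of "\<lambda>_. ?l \<pi>"]] by fastforce
    then have "F x \<simeq> F y" using FT[OF g(3)] FT[OF h(3)] eqv_trans eqv_sym by metis
    then have "x \<simeq> y" by (rule F_inj[OF g(3) h(3)])
    then show "g = h" unfolding g(1) h(1) E_eq_iff[OF g(2) h(2)] using \<open>\<pi> = \<sigma>\<close> by blast
  qed
  moreover have "carrier G \<subseteq> ?\<alpha> ` carrier G"
  proof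
    fix h assume "h \<in> carrier G"
    then obtain \<pi> y where h: "h = E \<pi> y" "\<pi> permutes {..<n}" "int p dvd Delta n y" by (elim G_cases)
    \<comment> \<open>The scalar that \<pi> will contribute is subtracted before a preimage under
      \<open>F\<close> is taken.\<close>
    have "Delta n (\<lambda>i. y i + - ?l \<pi>) = Delta n y - (int n * c) * int (inversion_number n \<pi>)"
      unfolding Delta_add Delta_const by (simp add: algebra_simps)
    then have "int p dvd Delta n (\<lambda>i. y i + - ?l \<pi>)" using h(3) pc by simp
    then obtain x where x: "int p dvd Delta n x" "F x \<simeq> (\<lambda>i. y i + - ?l \<pi>)" using F_surj by blast
    have "T j k x \<simeq> (\<lambda>i. y i + - ?l \<pi>)" using eqv_trans[OF eqv_sym[OF FT[OF x(1)]] x(2)] .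
    from eqv_add[OF this eqv_refl[of "\<lambda>_. ?l \<pi>"]] have "(\<lambda>i. T j k x i + ?l \<pi>) \<simeq> y" by simp
    then have "?\<alpha> (E \<pi> x) = h" unfolding h(1) alpha_E[OF h(2) x(1)] E_eq_iff[OF h(2) h(2)] by blast
    then show "h \<in> ?\<alpha> ` carrier G" using E_carrier[OF h(2) x(1)] by blast
  qed
  ultimately show ?thesis unfolding iso_def bij_betw_def hom_def by blast
qed

text \<open>The scalar \<gamma> can serve as the z of \<open>alpha\<close> only if it lies in G,
  that is, if p | n \<gamma>. Since the image of s_0 lies in G, this holds after adding the sum of
  the exceptional vector. If p divides that sum, \<gamma> becomes c; otherwise c = 0 and S absorbs
  the scalar.\<close>

lemma Y_normal_form:
  "\<exists>\<beta> c S. int p dvd int n * c \<and> d dvd 2 * c \<and>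
    (\<forall>i. Suc i < n \<longrightarrow> Y (swp i (Suc i)) \<simeq> (\<lambda>l. c + S i l + (\<beta> (swp i (Suc i) l) - \<beta> l))) \<and>
    ((\<forall>i l. S i l = 0) \<or> exotic_cond r p q n \<and>
      (\<forall>i<3. E (swp i (Suc i)) (S i) = proj r q n (exotic_image r p q i)))"
proof -
  obtain \<beta> \<gamma> H where dg: "d dvd 2 * \<gamma>" and H: "H = 0 \<or> n = 4 \<and> even q \<and> H = int (r div 2)"
    and Y': "\<forall>i. Suc i < n \<longrightarrow> Y (swp i (Suc i)) \<simeq>
      (\<lambda>l. \<gamma> + (if l = (i + 2) mod 4 then H else 0) + (\<beta> (swp i (Suc i) l) - \<beta> l))"
    using Y_classification by blast
  note Y = Y'[rule_format]
  define h where "h = (\<lambda>i l :: nat. if l = (i + 2) mod 4 then H else 0)"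
  have p\<gamma>: "int p dvd int n * \<gamma> + Delta n (h 0)"
  proof -
    have lt: "Suc 0 < n" using n3 by simp
    have s: "swp 0 (Suc 0) permutes {..<n}" using lt by (intro permutes_swap_id) simp_all
    have "int p dvd Delta n (\<lambda>l. \<gamma> + h 0 l + ((\<beta> \<circ> swp 0 (Suc 0)) l - \<beta> l))"
      using PY(2)[OF s] p_dvd_Delta_eqv[OF Y[OF lt]] by (simp add: h_def)
    also have "Delta n (\<lambda>l. \<gamma> + h 0 l + ((\<beta> \<circ> swp 0 (Suc 0)) l - \<beta> l))
      = int n * \<gamma> + Delta n (h 0) + (Delta n (\<beta> \<circ> swp 0 (Suc 0)) - Delta n \<beta>)"
      by (simp add: Delta_def sum.distrib sum_subtractf)
    also have "\<dots> = int n * \<gamma> + Delta n (h 0)" by (simp only: Delta_permute[OF s] diff_self add_0_right)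
    finally show ?thesis .
  qed
  show ?thesis
  proof (cases "H = 0")
    case True
    then have "h 0 = (\<lambda>_. 0)" by (simp add: h_def cong: if_cong)
    then have "int p dvd int n * \<gamma>" using p\<gamma> by (simp add: Delta_const)
    moreover have "Y (swp i (Suc i)) \<simeq> (\<lambda>l. \<gamma> + 0 + (\<beta> (swp i (Suc i) l) - \<beta> l))" if "Suc i < n" for i
      using Y[OF that] unfolding True by simp
    ultimately show ?thesis using dg by (intro exI[of _ \<beta>] exI[of _ \<gamma>] exI[of _ "\<lambda>_ _. 0"]) simp
  next
    case False
    then have n4: "n = 4" and qe: "even q" and Hr: "H = int (r div 2)" using H by blast+
    have Dh: "Delta n (h 0) = H"
    proof -
      have "h 0 = (\<lambda>l. if l = 2 then H else 0)" by (simp add: h_def fun_eq_iff)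
      then show ?thesis using Delta_single[of 2 n H] n4 by simp
    qed
    have p4: "int p dvd 4 * \<gamma> + H" using p\<gamma> unfolding Dh by (simp add: n4)
    have re: "even r" by (rule dvd_trans[OF qe qr])
    obtain r' where r': "r = p * r'" using pr by blast
    have rp: "r div p = r'" using p0 by (simp add: r')
    show ?thesis
    proof (cases "even r'")
      case True
      \<comment> \<open>If r/p is even, p divides r/2 = H, so the scalar lies in G on its
        own.\<close>
      then obtain r2 where "r' = 2 * r2" by blast
      then have "r div 2 = p * r2" by (simp add: r')
      then have "int p dvd H" by (simp add: Hr)
      then have "int p dvd int n * \<gamma>" using p4 by (simp add: n4 dvd_add_left_iff)
      moreover have "exotic_cond r p q n" using n4 qe True by (simp add: exotic_cond_def rp)
      moreover have "\<forall>i<3. E (swp i (Suc i)) (h i) = proj r q n (exotic_image r p q i)"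
        using exotic_image_eq[OF n4] True by (simp add: h_def Hr rp cong: if_cong)
      ultimately show ?thesis using dg Y'
        by (intro exI[of _ \<beta>] exI[of _ \<gamma>] exI[of _ h]) (simp add: h_def)
    next
      case False
      have np: "\<not> int p dvd 4 * \<gamma>"
      proof
        assume "int p dvd 4 * \<gamma>"
        then have "int p dvd H" using p4 by (simp add: dvd_add_right_iff)
        then have "p dvd r div 2" by (simp add: Hr)
        then obtain s where "r div 2 = p * s" by blast
        then have "r = 2 * (p * s)" using dvd_mult_div_cancel[OF re] by simp
        then have "p * r' = p * (2 * s)" unfolding r' by (simp only: ac_simps)
        then show False using False p0 by simp
      qed
      \<comment> \<open>A scalar trivial in the quotient is excluded, as p divides n d = 4d. Since
        2\<gamma> = d m, it follows that m is odd and d even, so \<gamma> is d/2 up to a multiple of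
        d.\<close>
      have nd: "\<not> d dvd \<gamma>"
      proof
        assume "d dvd \<gamma>"
        then obtain m where "\<gamma> = d * m" by blast
        then have "4 * \<gamma> = (int n * d) * m" by (simp add: n4)
        then show False using np p_dvd_nd by simp
      qed
      obtain m where m: "2 * \<gamma> = d * m" using dg by blast
      have mo: "odd m"
      proof
        assume "even m" then obtain m' where "m = 2 * m'" by blast
        with m have "\<gamma> = d * m'" by simp
        with nd show False by simp
      qed
      have "even (d * m)" unfolding m[symmetric] by simp
      then obtain d' where d': "d = 2 * d'" using mo by auto
      have \<gamma>: "\<gamma> = d' * m" using m by (simp add: d')
      obtain m' where m': "m = 2 * m' + 1" using mo by (rule oddE)
      have rq: "int (r div (2 * q)) = d'"
      proof -
        have "r div (2 * q) = r div q div 2" using div_mult2_eq[of r q 2] by (simp add: mult.commute)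
        then have "int (r div (2 * q)) = d div 2" by (simp add: d_def zdiv_int)
        then show ?thesis by (simp add: d')
      qed
      have cond: "exotic_cond r p q n"
      proof -
        have "even (int (r div q))" unfolding d_def[symmetric] d' by simp
        then have "even (r div q)" by simp
        \<comment> \<open>If the quotient were 2K', then 2d = p K', and 4\<gamma> = 2d m would be
          divisible by p, against \<open>np\<close>.\<close>
        moreover have "odd (4 * r div (p * q))"
        proof
          obtain K where K: "4 * r = p * q * K" using pqn unfolding n4 mult.commute[of r 4] by blast
          then have "4 * r div (p * q) = K" using p0 q0 by simp
          moreover assume "even (4 * r div (p * q))"
          ultimately obtain K' where "K = 2 * K'" by blast
          have "4 * int r = int p * int q * int K"
            using arg_cong[OF K, of int] by (simp only: of_nat_mult of_nat_numeral)
          then have "int q * (2 * (2 * d)) = int q * (2 * (int p * int K'))"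
            unfolding r_eq \<open>K = 2 * K'\<close> by simp
          then have "2 * d = int p * int K'" using q0 by simp
          moreover have "4 * \<gamma> = (2 * d) * m" using m by simp
          ultimately have "4 * \<gamma> = int p * int K' * m" by simp
          then show False using np by simp
        qed
        ultimately show ?thesis using n4 qe by (simp add: exotic_cond_def)
      qed
      let ?S = "\<lambda>i l. h i l + d'"
      have "\<forall>i<3. E (swp i (Suc i)) (?S i) = proj r q n (exotic_image r p q i)"
        using exotic_image_eq[OF n4] False by (simp add: h_def Hr rp rq cong: if_cong)
      moreover have "Y (swp i (Suc i)) \<simeq> (\<lambda>l. 0 + ?S i l + (\<beta> (swp i (Suc i) l) - \<beta> l))" if "Suc i < n" for i
      proof -
        have "(\<lambda>l. \<gamma> + h i l + (\<beta> (swp i (Suc i) l) - \<beta> l)) =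
          (\<lambda>l. (0 + ?S i l + (\<beta> (swp i (Suc i) l) - \<beta> l)) + d * m')"
          by (rule ext) (simp add: \<gamma> m' d' algebra_simps)
        then have "Y (swp i (Suc i)) \<simeq> (\<lambda>l. (0 + ?S i l + (\<beta> (swp i (Suc i) l) - \<beta> l)) + d * m')"
          using Y[OF that] by (simp only: h_def)
        also have "(\<lambda>l. (0 + ?S i l + (\<beta> (swp i (Suc i) l) - \<beta> l)) + d * m')
            \<simeq> (\<lambda>l. 0 + ?S i l + (\<beta> (swp i (Suc i) l) - \<beta> l))"
          by (rule eqv_shift) simp
        finally show ?thesis .
      qed
      ultimately show ?thesis using cond by (intro exI[of _ \<beta>] exI[of _ 0] exI[of _ ?S]) simp
    qed
  qed
qed

theorem decomposition:
  "\<exists>g \<in> carrier (Grpqn r 1 q n). \<exists>\<phi>. \<exists>j k :: int. \<exists>z \<in> Crpqn r p q n.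
     z \<otimes>\<^bsub>G\<^esub> z = \<one>\<^bsub>G\<^esub> \<and> alpha r p q n j k z \<in> iso G G \<and>
     (\<phi> = id \<or> exotic_cond r p q n \<and> is_unique_exotic r p q \<phi>) \<and>
     (\<forall>h \<in> carrier G. \<nu> h = (Ad r q n g \<circ> \<phi> \<circ> alpha r p q n j k z) h)"
proof -
  obtain j k where FT': "\<forall>x. int p dvd Delta n x \<longrightarrow> F x \<simeq> T j k x" using F_eq_T by blast
  note FT = FT'[rule_format]
  obtain \<beta> c S where pc: "int p dvd int n * c" and dc: "d dvd 2 * c"
    and Y': "\<forall>i. Suc i < n \<longrightarrow> Y (swp i (Suc i)) \<simeq> (\<lambda>l. c + S i l + (\<beta> (swp i (Suc i) l) - \<beta> l))"
    and S: "(\<forall>i l. S i l = 0) \<or> exotic_cond r p q n \<and>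
      (\<forall>i<3. E (swp i (Suc i)) (S i) = proj r q n (exotic_image r p q i))"
    using Y_normal_form by blast
  note Y = Y'[rule_format]
  note z0 = p_dvd_Delta_zero
  define z where "z = E id (\<lambda>_. c)"
  define \<alpha> where "\<alpha> = alpha r p q n j k z"
  \<comment> \<open>Conjugation by this diagonal element produces the coboundary of \<beta>; below,
    \<open>\<theta>\<close> is \<nu> with that conjugation removed.\<close>
  define g where "g = E id \<beta>"
  have zC: "z \<in> Crpqn r p q n" unfolding z_def C_eq using pc by blast
  have "(\<lambda>_. c + c) \<simeq> (\<lambda>_. 0)" by (rule eqv_const) (use dc in simp)
  then have zz: "z \<otimes>\<^bsub>G\<^esub> z = \<one>\<^bsub>G\<^esub>" unfolding z_def G_one by (simp add: E_mult E_id_eq_iff)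
  have \<alpha>: "\<alpha> \<in> iso G G" unfolding \<alpha>_def z_def by (rule alpha_iso[OF FT pc dc])
  have g: "g \<in> carrier (Grpqn r 1 q n)" unfolding g_def by (rule E_one_carrier[OF permutes_id])
  define \<theta> where "\<theta> = Ad r q n (inv\<^bsub>Grpqn r 1 q n\<^esub> g) \<circ> \<nu>"
  have \<theta>: "\<theta> \<in> iso G G"
    unfolding \<theta>_def by (rule iso_set_trans[OF iso Ad_iso[OF inv_one_carrier[OF g]]])
  have \<nu>\<theta>: "\<nu> h = Ad r q n g (\<theta> h)" if "h \<in> carrier G" for h
    using Ad_inverse(2)[OF g hom_in_carrier[OF hom that]] by (simp add: \<theta>_def)
  have \<theta>I: "\<theta> h = h'" if "h' \<in> carrier G" "\<nu> h = Ad r q n g h'" for h h'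
    unfolding \<theta>_def comp_apply that(2) by (rule Ad_inverse(1)[OF g that(1)])
  have Ad_g: "Ad r q n g (E \<pi> x) = E \<pi> (\<lambda>i. \<beta> (\<pi> i) + x i - \<beta> i)" if "\<pi> permutes {..<n}" for \<pi> x
    using Ad_E[OF permutes_id that, of \<beta> x] by (simp add: g_def)
  have s: "swp i (Suc i) permutes {..<n}" if "Suc i < n" for i
    using that by (intro permutes_swap_id) simp_all
  have \<theta>N: "\<theta> (E id x) = E id (F x)" if "int p dvd Delta n x" for x
  proof (rule \<theta>I)
    show "E id (F x) \<in> carrier G" by (rule E_carrier[OF permutes_id F(1)[OF that]])
    show "\<nu> (E id x) = Ad r q n g (E id (F x))" unfolding F(2)[OF that] Ad_g[OF permutes_id] by simp
  qed
  have \<alpha>N: "\<alpha> (E id x) = E id (F x)" if "int p dvd Delta n x" for x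
  proof -
    \<comment> \<open>The identity is even, so the scalar coming from z is a multiple of 2c, which
      is trivial in the quotient.\<close>
    have "even (inversion_number n id)" by (simp add: even_inversion_number_iff)
    then obtain m where "inversion_number n id = 2 * m" by (rule evenE)
    then have "int (inversion_number n id) * c = int m * (2 * c)" by simp
    then have "d dvd int (inversion_number n id) * c" using dvd_mult[OF dc, of "int m"] by (simp only:)
    from eqv_trans[OF eqv_shift[OF this] eqv_sym[OF FT[OF that]]] show ?thesis
      unfolding \<alpha>_def z_def alpha_E[OF permutes_id that] E_id_eq_iff .
  qed
  have \<alpha>s: "\<alpha> (E (swp i (Suc i)) (\<lambda>_. 0)) = E (swp i (Suc i)) (\<lambda>_. c)" if i: "Suc i < n" for i
  proof -
    obtain m where "inversion_number n (swp i (Suc i)) = 2 * m + 1"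
      using odd_inversion_number_swap[OF i] by (rule oddE)
    then have "int (inversion_number n (swp i (Suc i))) * c - c = int m * (2 * c)"
      by (simp add: algebra_simps)
    then have "(\<lambda>_. int (inversion_number n (swp i (Suc i))) * c) \<simeq> (\<lambda>_. c)"
      using dc by (intro eqv_const) simp
    then show ?thesis unfolding \<alpha>_def z_def alpha_E[OF s[OF i] z0] T_zero E_eq_iff[OF s[OF i] s[OF i]] by simp
  qed
  have \<theta>s: "\<theta> (E (swp i (Suc i)) (\<lambda>_. 0)) = E (swp i (Suc i)) (\<lambda>l. c + S i l)"
    if i: "Suc i < n" for i
  proof -
    have "int p dvd Delta n (\<lambda>l. c + S i l + ((\<beta> \<circ> swp i (Suc i)) l - \<beta> l))"
      using PY(2)[OF s[OF i]] p_dvd_Delta_eqv[OF Y[OF i]] by simp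
    also have "Delta n (\<lambda>l. c + S i l + ((\<beta> \<circ> swp i (Suc i)) l - \<beta> l))
      = Delta n (\<lambda>l. c + S i l) + (Delta n (\<beta> \<circ> swp i (Suc i)) - Delta n \<beta>)"
      by (simp add: Delta_def sum.distrib sum_subtractf)
    also have "\<dots> = Delta n (\<lambda>l. c + S i l)" by (simp only: Delta_permute[OF s[OF i]] diff_self add_0_right)
    finally have C: "E (swp i (Suc i)) (\<lambda>l. c + S i l) \<in> carrier G" by (rule E_carrier[OF s[OF i]])
    show "\<theta> (E (swp i (Suc i)) (\<lambda>_. 0)) = E (swp i (Suc i)) (\<lambda>l. c + S i l)"
    proof (rule \<theta>I[OF C])
      have "Y (swp i (Suc i)) \<simeq> (\<lambda>l. \<beta> (swp i (Suc i) l) + (c + S i l) - \<beta> l)"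
        using Y[OF i] by (simp add: algebra_simps)
      then show "\<nu> (E (swp i (Suc i)) (\<lambda>_. 0)) = Ad r q n g (E (swp i (Suc i)) (\<lambda>l. c + S i l))"
        unfolding PY(3)[OF s[OF i]] P_trivial[OF s[OF i]] Ad_g[OF s[OF i]] E_eq_iff[OF s[OF i] s[OF i]] by blast
    qed
  qed
  have hom': "\<psi> \<in> hom G G" if "\<psi> \<in> iso G G" for \<psi> using that by (simp add: iso_def)
  have "\<exists>\<phi>. (\<phi> = id \<or> exotic_cond r p q n \<and> is_unique_exotic r p q \<phi>) \<and> (\<forall>h \<in> carrier G. \<theta> h = \<phi> (\<alpha> h))"
    using S
  proof
    assume "\<forall>i l. S i l = 0"
    then have "\<theta> h = \<alpha> h" if "h \<in> carrier G" for h
      using \<theta>N \<alpha>N \<theta>s \<alpha>s by (intro hom_eqI[OF hom'[OF \<theta>] hom'[OF \<alpha>] _ _ that]) simp_all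
    then show ?thesis by (intro exI[of _ id]) simp
  next
    assume ex: "exotic_cond r p q n \<and>
      (\<forall>i<3. E (swp i (Suc i)) (S i) = proj r q n (exotic_image r p q i))"
    then have n4: "n = 4" by (simp add: exotic_cond_def)
    \<comment> \<open>\<open>\<theta>\<close> and \<open>\<alpha>\<close> agree on N, so
      \<open>\<phi>\<close> fixes N pointwise; on s_i they differ by \<open>S i\<close>, the exotic
      factor.\<close>
    define \<phi> where "\<phi> = \<theta> \<circ> inv_into (carrier G) \<alpha>"
    have \<phi>: "\<phi> \<in> iso G G"
      unfolding \<phi>_def by (rule iso_set_trans[OF group.iso_set_sym[OF group_G \<alpha>] \<theta>])
    have "inj_on \<alpha> (carrier G)" using \<alpha> by (simp add: iso_def bij_betw_def)
    then have \<phi>\<alpha>: "\<phi> (\<alpha> h) = \<theta> h" if "h \<in> carrier G" for h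
      using that by (simp add: \<phi>_def)
    have \<phi>N: "\<phi> (E id y) = E id y" if y: "int p dvd Delta n y" for y
    proof -
      obtain x where x: "int p dvd Delta n x" "F x \<simeq> y" using F_surj[OF y] by blast
      have "E id y = E id (F x)" unfolding E_id_eq_iff by (rule eqv_sym[OF x(2)])
      then show ?thesis
        using \<phi>\<alpha>[OF E_carrier[OF permutes_id x(1)]] \<alpha>N[OF x(1)] \<theta>N[OF x(1)] by simp
    qed
    have \<phi>s: "\<phi> (E (swp i (Suc i)) (\<lambda>_. 0)) = E (swp i (Suc i)) (S i)" if i: "Suc i < n" for i
    proof -
      have pc': "int p dvd Delta n (\<lambda>_. - c)" using pc by (simp add: Delta_const)
      have "\<alpha> (E (swp i (Suc i)) (\<lambda>_. 0)) \<in> carrier G"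
        by (rule hom_in_carrier[OF hom'[OF \<alpha>] E_carrier[OF s[OF i] z0]])
      then have C: "E (swp i (Suc i)) (\<lambda>_. c) \<in> carrier G" unfolding \<alpha>s[OF i] .
      \<comment> \<open>\<open>\<alpha>\<close> takes s_i to s_i times the scalar c. Splitting off
        that scalar leaves its inverse, which lies in N and is fixed by
        \<open>\<phi>\<close>.\<close>
      have "E (swp i (Suc i)) (\<lambda>_. 0) = E (swp i (Suc i)) (\<lambda>_. c) \<otimes>\<^bsub>G\<^esub> E id (\<lambda>_. - c)"
        by (simp add: E_mult s[OF i])
      then have "\<phi> (E (swp i (Suc i)) (\<lambda>_. 0)) = \<phi> (E (swp i (Suc i)) (\<lambda>_. c)) \<otimes>\<^bsub>G\<^esub> E id (\<lambda>_. - c)"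
        using hom_mult[OF hom'[OF \<phi>] C E_carrier[OF permutes_id pc']] by (simp only: \<phi>N[OF pc'])
      also have "\<phi> (E (swp i (Suc i)) (\<lambda>_. c)) = E (swp i (Suc i)) (\<lambda>l. c + S i l)"
        using \<phi>\<alpha>[OF E_carrier[OF s[OF i] z0]] unfolding \<alpha>s[OF i] \<theta>s[OF i] .
      finally show ?thesis unfolding E_mult[OF s[OF i] permutes_id] by simp
    qed
    have "is_exotic r p q \<phi>"
      unfolding is_exotic_def n4[symmetric]
    proof (intro conjI ballI allI impI)
      show "\<phi> \<in> iso G G" by (rule \<phi>)
      show "\<phi> h = h" if "h \<in> Nrpqn r p q n" for h using that \<phi>N unfolding N_eq by blast
      show "\<phi> (proj r q n (smat r n i)) = proj r q n (exotic_image r p q i)" if "i < 3" for i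
      proof -
        have "Suc i < n" using that n4 by simp
        from \<phi>s[OF this] show ?thesis using ex that unfolding smat_eq by simp
      qed
    qed
    moreover have "\<psi> h = \<phi> h" if \<psi>: "is_exotic r p q \<psi>" and h: "h \<in> carrier G" for \<psi> h
    proof -
      have \<psi>iso: "\<psi> \<in> iso G G" and \<psi>N: "\<And>h. h \<in> Nrpqn r p q n \<Longrightarrow> \<psi> h = h"
        and \<psi>s: "\<And>i. i < 3 \<Longrightarrow> \<psi> (proj r q n (smat r n i)) = proj r q n (exotic_image r p q i)"
        using \<psi> unfolding is_exotic_def n4[symmetric] by blast+
      show ?thesis
      proof (rule hom_eqI[OF hom'[OF \<psi>iso] hom'[OF \<phi>] _ _ h])
        fix x assume x: "int p dvd Delta n x"
        then have "E id x \<in> Nrpqn r p q n" unfolding N_eq by blast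
        then show "\<psi> (E id x) = \<phi> (E id x)" using \<psi>N \<phi>N[OF x] by simp
      next
        fix i assume i: "Suc i < n"
        then have "i < 3" using n4 by simp
        then show "\<psi> (E (swp i (Suc i)) (\<lambda>_. 0)) = \<phi> (E (swp i (Suc i)) (\<lambda>_. 0))"
          using \<psi>s[of i] ex unfolding smat_eq \<phi>s[OF i] by simp
      qed
    qed
    ultimately have "is_unique_exotic r p q \<phi>"
      unfolding is_unique_exotic_def n4[symmetric] by blast
    then show ?thesis using ex \<phi>\<alpha> by (intro exI[of _ \<phi>]) simp
  qed
  then obtain \<phi> where \<phi>: "\<phi> = id \<or> exotic_cond r p q n \<and> is_unique_exotic r p q \<phi>"
    and \<theta>\<phi>: "\<forall>h \<in> carrier G. \<theta> h = \<phi> (\<alpha> h)" by blast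
  have "\<forall>h \<in> carrier G. \<nu> h = (Ad r q n g \<circ> \<phi> \<circ> \<alpha>) h" using \<nu>\<theta> \<theta>\<phi> by simp
  then show ?thesis using g zC zz \<alpha> \<phi> unfolding \<alpha>_def by blast
qed

end

section \<open>Reduction to a trivial action on the symmetric group\<close>

context normal_part_automorphism
begin

text \<open>The map induced on S_n is conjugation by f. Conjugating by the inverse of the
  permutation matrix of f undoes it, and the two conjugators are multiplied at the end.\<close>

theorem decomposition_general:
  assumes "(r, p, q, n) \<noteq> (1, 1, 1, 6)"
  shows "\<exists>g \<in> carrier (Grpqn r 1 q n). \<exists>\<phi>. \<exists>j k :: int. \<exists>z \<in> Crpqn r p q n.
     z \<otimes>\<^bsub>G\<^esub> z = \<one>\<^bsub>G\<^esub> \<and> alpha r p q n j k z \<in> iso G G \<and>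
     (\<phi> = id \<or> exotic_cond r p q n \<and> is_unique_exotic r p q \<phi>) \<and>
     (\<forall>h \<in> carrier G. \<nu> h = (Ad r q n g \<circ> \<phi> \<circ> alpha r p q n j k z) h)"
proof -
  have "P (swp 0 1) \<noteq> swp a b \<circ> swp c e \<circ> swp f g"
    if "n = 6" "distinct [a, b, c, e, f, g]" "{a, b, c, e, f, g} = {..<n}" for a b c e f g
  proof (rule not_three_swaps[OF _ that(2,3)])
    \<comment> \<open>For r = 1 also p = q = 1; with n = 6 this is the excluded case, where G is
      S_6.\<close>
    have "r \<noteq> 1"
    proof
      assume "r = 1"
      then have "p = 1" "q = 1" using pr qr by simp_all
      with \<open>r = 1\<close> assms that(1) show False by simp
    qed
    then show "r \<ge> 2" using r0 by simp
  qed
  then obtain f where f: "f permutes {..<n}" "\<And>\<pi>. \<pi> permutes {..<n} \<Longrightarrow> P \<pi> = f \<circ> \<pi> \<circ> pinv f"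
    using inner by blast
  interpret group1: group "Grpqn r 1 q n" by (rule group_one)
  define b where "b = E f (\<lambda>_. 0)"
  have b: "b \<in> carrier (Grpqn r 1 q n)" unfolding b_def by (rule E_one_carrier[OF f(1)])
  define b' where "b' = inv\<^bsub>Grpqn r 1 q n\<^esub> b"
  have b': "b' \<in> carrier (Grpqn r 1 q n)" unfolding b'_def by (rule inv_one_carrier[OF b])
  have pf: "pinv f permutes {..<n}" by (rule permutes_inv[OF f(1)])
  have b'E: "b' = E (pinv f) (\<lambda>_. 0)" unfolding b'_def b_def using E_one_inv[OF f(1), of "\<lambda>_. 0"] by simp
  define \<mu> where "\<mu> = Ad r q n b' \<circ> \<nu>"
  have \<mu>: "\<mu> \<in> iso G G" unfolding \<mu>_def by (rule iso_set_trans[OF iso Ad_iso[OF b']])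
  have "\<mu> ` Nrpqn r p q n = Nrpqn r p q n"
    unfolding \<mu>_def image_comp[symmetric] image_N by (rule Ad_image_N[OF b'])
  then interpret mu: normal_part_automorphism r p q n \<mu> using \<mu> by unfold_locales
  have "mu.P \<pi> = \<pi>" if \<pi>: "\<pi> permutes {..<n}" for \<pi>
  proof -
    have "\<mu> (E \<pi> (\<lambda>_. 0)) = Ad r q n b' (E (P \<pi>) (Y \<pi>))" unfolding \<mu>_def comp_apply PY(3)[OF \<pi>] ..
    also have "\<dots> = E (pinv f \<circ> P \<pi> \<circ> pinv (pinv f)) (\<lambda>i. Y \<pi> (pinv (pinv f) i))"
      unfolding b'E Ad_E[OF pf PY(1)[OF \<pi>]] by simp
    also have "pinv (pinv f) = f" by (rule permutes_inv_inv[OF f(1)])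
    also have "pinv f \<circ> P \<pi> \<circ> f = \<pi>"
      unfolding f(2)[OF \<pi>] by (simp add: fun_eq_iff permutes_inverses(2)[OF f(1)])
    finally show ?thesis by (intro mu.P_unique(1)[OF \<pi> \<pi>])
  qed
  then interpret mu: perm_trivial_automorphism r p q n \<mu> by unfold_locales
  obtain g \<phi> j k z where g: "g \<in> carrier (Grpqn r 1 q n)" and z: "z \<in> Crpqn r p q n"
    and rest: "z \<otimes>\<^bsub>G\<^esub> z = \<one>\<^bsub>G\<^esub>" "alpha r p q n j k z \<in> iso G G"
      "\<phi> = id \<or> exotic_cond r p q n \<and> is_unique_exotic r p q \<phi>"
    and \<mu>_eq: "\<forall>h \<in> carrier G. \<mu> h = (Ad r q n g \<circ> \<phi> \<circ> alpha r p q n j k z) h"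
    using mu.decomposition by blast
  \<comment> \<open>\<open>Ad_mult\<close> merges the two conjugations only at elements of G, so
    \<phi> must map G into itself.\<close>
  have \<phi>c: "\<phi> h \<in> carrier G" if "h \<in> carrier G" for h
  proof -
    have "\<phi> = id \<or> \<phi> \<in> iso G G"
      using rest(3) by (auto simp: exotic_cond_def is_unique_exotic_def is_exotic_def)
    then show ?thesis using that by (auto simp: iso_def hom_def)
  qed
  have "\<nu> h = (Ad r q n (b \<otimes>\<^bsub>Grpqn r 1 q n\<^esub> g) \<circ> \<phi> \<circ> alpha r p q n j k z) h" if h: "h \<in> carrier G" for h
  proof -
    have "alpha r p q n j k z h \<in> carrier G" using rest(2) h by (auto simp: iso_def hom_def)
    then have c: "\<phi> (alpha r p q n j k z h) \<in> carrier G" by (rule \<phi>c)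
    have "\<nu> h = Ad r q n b (\<mu> h)"
      unfolding \<mu>_def b'_def comp_apply
      by (rule Ad_inverse(2)[OF b hom_in_carrier[OF hom h], symmetric])
    then show ?thesis using \<mu>_eq h Ad_mult[OF b g c] by simp
  qed
  moreover have "b \<otimes>\<^bsub>Grpqn r 1 q n\<^esub> g \<in> carrier (Grpqn r 1 q n)" using b g by simp
  ultimately show ?thesis using z rest by blast
qed

end

theorem theorem9p5:
  fixes r p q n :: nat
    and \<nu> :: "complex mat set \<Rightarrow> complex mat set"
  assumes "r > 0" and "p > 0" and "q > 0"
    and "p dvd r" and "q dvd r" and "p * q dvd r * n"
    and "n \<ge> 3"
    and "(r, p, q, n) \<noteq> (1, 1, 1, 6)"
    and "\<nu> \<in> iso (Grpqn r p q n) (Grpqn r p q n)"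
    and "\<nu> ` Nrpqn r p q n = Nrpqn r p q n"
  shows "\<exists>g \<in> carrier (Grpqn r 1 q n). \<exists>\<phi>. \<exists>j k :: int. \<exists>z \<in> Crpqn r p q n.
           z \<otimes>\<^bsub>Grpqn r p q n\<^esub> z = \<one>\<^bsub>Grpqn r p q n\<^esub> \<and>
           alpha r p q n j k z \<in> iso (Grpqn r p q n) (Grpqn r p q n) \<and>
           (\<phi> = id \<or> exotic_cond r p q n \<and> is_unique_exotic r p q \<phi>) \<and>
           (\<forall>h \<in> carrier (Grpqn r p q n). \<nu> h = (Ad r q n g \<circ> \<phi> \<circ> alpha r p q n j k z) h)"
proof -
  interpret normal_part_automorphism r p q n \<nu> using assms by unfold_locales
  show ?thesis by (rule decomposition_general[OF assms(8)])
qed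

end
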